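(* The PACKING-COLORING algorithm, which takes as input a Halin graph $G$ with $\Delta(G)\le 5$ (with characteristic tree $T$ and adjoint cycle $C=a_1a_2\cdots a_na_1$) and outputs a $(1^2,2^3)$-packing coloring of $G$, operates in linear time, i.e. it has time complexity $O(|G|)$, where $|G|$ is the number of vertices of $G$.
   Context: A Halin graph is a plane graph constructed from a (plane) tree $T$ without vertices of degree two (the characteristic tree) by connecting all leaves of $T$ through a cycle $C$ (the adjoint cycle, in the cyclic order of the leaves in the embedding). Write $C=a_1a_2\cdots a_na_1$; each $a_i$ is a leaf of $T$ and $b_i$ denotes its unique neighbor in $T$. A $(1^2,2^3)$-packing coloring is a partition of $V(G)$ into five (possibly empty) classes, labelled $1,1',2_a,2_b,2_c$, such that distinct vertices in class $1$ (resp. $1'$) are at distance at least $2$, and distinct vertices in the same class among $2_a,2_b,2_c$ are at distance at least $3$. The PACKING-COLORING algorithm consists of the following steps. (1) Properly color $T$ with colors $1,1'$ (by BFS from an arbitrary root colored $1$); call the coloring $\varphi$. (2) RECOLORING. If $\varphi(a_1)\neq\varphi(a_n)$, go to CASE-1. If $\varphi(a_1)=\varphi(a_n)$ but not all $\varphi(a_i)$ are equal, take the least $i\ge 2$ with $\varphi(a_i)\ne\varphi(a_{i-1})$, relabel cyclically $(a_1,\dots,a_n):=(a_i,\dots,a_n,a_1,\dots,a_{i-1})$ (and the $b_j$ accordingly), and go to CASE-1. If all $\varphi(a_i)$ are equal, go to CASE-2. Let $1_k$ denote the color in $\{1,1'\}$ different from $\varphi(b_k)$, and $m=4\lfloor n/4\rfloor$.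 In both cases, for $1\le k\le m$ recolor $a_k$ with $1_k$ if $k$ is odd, $2_a$ if $k\equiv2\pmod 4$, and $2_b$ if $k\equiv 0\pmod 4$. CASE-1, remaining vertices: if $n-m=1$, $\varphi(a_n)=1_n$; if $n-m=2$, $\varphi(a_{n-1})=2_a$, $\varphi(a_n)=1_n$; if $n-m=3$, $\varphi(a_{n-2})=1_{n-2}$, $\varphi(a_{n-1})=2_a$, $\varphi(a_n)=1_n$. CASE-2, remaining vertices: if $n-m=1$, $\varphi(a_n)=2_c$; if $n-m=2$, $\varphi(a_{n-1})=1_{n-1}$, $\varphi(a_n)=2_c$; if $n-m=3$, $\varphi(a_{n-2})=2_a$, $\varphi(a_{n-1})=1_{n-1}$, $\varphi(a_n)=2_b$. In CASE-2, two further modifications follow in order: (i) if $\varphi(a_n)=2_c$ and there is $i\in\{1,\dots,n-2\}$ with $\varphi(a_{n-1})=\varphi(a_i)=2_b$ and $b_n=b_{n-1}=b_i$, set $\varphi(a_2)=2_c$, $\varphi(a_{n-1})=2_c$, $\varphi(a_n)=2_a$; (ii) then, if $\varphi(a_n)=2_c$, no $i\in\{1,\dots,n-1\}$ satisfies both $\varphi(a_i)\in\{2_a,2_b\}$ and $b_i=b_n$, and some $i\in\{4,\dots,n-1\}$ satisfies $\varphi(a_i)=2_a$ and $b_i=b_2$, set $\varphi(a_2)=2_c$, $\varphi(a_n)=2_a$. Each existence check is a single loop over the indices. (3) CONFLICTS-RESOLVING. In one pass over the pairs $(a_1,b_1),\dots,(a_n,b_n)$, build a dictionary whose keys are the $b$'s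 and where $\mathcal N[b]$ is the set of vertices $a_j$ adjacent to $b$ whose color (after RECOLORING) is not in $\{1,1'\}$. Put $a_0:=a_n$. For $i=1,\dots,n$ in increasing order, when $i$ is even: loop over the $j\neq i$ with $a_j\in\mathcal N[b_i]$; at the first $j$ with $\varphi(a_j)=\varphi(a_i)\ne 2_c$ (current colors), recolor $a_i$ with $2_c$ if $\varphi(a_{i-2})\neq 2_c$, recolor $a_j$ with $2_c$ if $\varphi(a_{i-2})=2_c$, and leave the inner loop. The final $\varphi$ is returned. *)

theory Defs
  imports
    "Graph_Theory.Graph_Theory"
    "HOL-Library.While_Combinator"
    "HOL-Library.Monad_Syntax"
begin

section \<open>Halin graphs\<close>

text \<open>
  Undirected graphs are the symmetric, loop-free, finite digraphs of the locale
  \<^locale>\<open>pair_graph\<close>: an edge is a pair of opposite arcs, and degrees are out-degrees.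

  A plane tree is given by a rotation system: \<open>rot T v\<close> lists the neighbours of \<open>v\<close> in the
  cyclic order in which they occur around \<open>v\<close> in the embedding, starting anywhere.  For a tree,
  every rotation system is the one of a plane embedding, unique up to homeomorphism.  The lists
  \<open>rot T v\<close> are at the same time the adjacency lists on which the algorithm works.
\<close>

record 'v plane_tree =
  vlist :: "'v list"
  rot :: "'v \<Rightarrow> 'v list"

definition tree_graph :: "'v plane_tree \<Rightarrow> 'v pair_pre_digraph" where
  "tree_graph T =
     \<lparr> pverts = set (vlist T), parcs = {(u, v). u \<in> set (vlist T) \<and> v \<in> set (rot T u)} \<rparr>"

text \<open>
  The library constants \<^const>\<open>forest\<close> and \<^const>\<open>tree\<close> are of no use for symmetric digraphs,
  because an edge traversed back and forth is a \<^const>\<open>pre_digraph.cycle\<close> of length 2.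
\<close>

definition undirected_tree :: "'v pair_pre_digraph \<Rightarrow> bool" where
  "undirected_tree G \<longleftrightarrow>
     pair_graph G \<and> connected G \<and> \<not> (\<exists>p. pre_digraph.cycle G p \<and> 3 \<le> length p)"

definition is_plane_tree :: "'v plane_tree \<Rightarrow> bool" where
  "is_plane_tree T \<longleftrightarrow>
     distinct (vlist T) \<and> (\<forall>v \<in> set (vlist T). distinct (rot T v)) \<and> undirected_tree (tree_graph T)"

definition is_leaf :: "'v plane_tree \<Rightarrow> 'v \<Rightarrow> bool" where
  "is_leaf T v \<longleftrightarrow> v \<in> set (vlist T) \<and> out_degree (tree_graph T) v = 1"

definition cyclic_next :: "'a list \<Rightarrow> 'a \<Rightarrow> 'a" where
  "cyclic_next xs x = hd (tl (dropWhile (\<lambda>y. y \<noteq> x) xs) @ xs)"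

text \<open>
  A plane tree has a single face, whose boundary walk leaves a vertex \<open>v\<close> that was entered from
  \<open>u\<close> along the next edge of the rotation at \<open>v\<close>.  The cyclic order of the leaves is the one in
  which this walk meets them.
\<close>

definition face_step :: "'v plane_tree \<Rightarrow> 'v \<times> 'v \<Rightarrow> 'v \<times> 'v" where
  "face_step T = (\<lambda>(u, v). (v, cyclic_next (rot T v) u))"

definition next_leaf :: "'v plane_tree \<Rightarrow> 'v \<Rightarrow> 'v \<Rightarrow> bool" where
  "next_leaf T x y \<longleftrightarrow>
     (let walk = (\<lambda>k. snd ((face_step T ^^ k) (x, hd (rot T x))))
      in \<exists>k. walk k = y \<and> is_leaf T y \<and> (\<forall>l < k. \<not> is_leaf T (walk l)))"

definition adjoint_cycle :: "'v plane_tree \<Rightarrow> 'v list \<Rightarrow> bool" where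
  "adjoint_cycle T as \<longleftrightarrow>
     distinct as \<and> set as = {v. is_leaf T v} \<and> 3 \<le> length as \<and>
     (\<forall>i < length as. next_leaf T (as ! i) (as ! (Suc i mod length as)))"

text \<open>\<open>is_halin T as\<close>: \<open>T\<close> is the characteristic tree and \<open>as\<close> the adjoint cycle of a Halin graph.\<close>

definition is_halin :: "'v plane_tree \<Rightarrow> 'v list \<Rightarrow> bool" where
  "is_halin T as \<longleftrightarrow>
     is_plane_tree T \<and> (\<forall>v \<in> set (vlist T). out_degree (tree_graph T) v \<noteq> 2) \<and> adjoint_cycle T as"

definition halin_graph :: "'v plane_tree \<Rightarrow> 'v list \<Rightarrow> 'v pair_pre_digraph" where
  "halin_graph T as =
     (let C = {(as ! i, as ! (Suc i mod length as)) | i. i < length as}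
      in \<lparr> pverts = pverts (tree_graph T), parcs = parcs (tree_graph T) \<union> C \<union> C\<inverse> \<rparr>)"

definition max_degree :: "'v pair_pre_digraph \<Rightarrow> nat" where
  "max_degree G = Max (out_degree G ` pverts G)"


section \<open>Packing colorings\<close>

text \<open>\<open>One\<close>, \<open>One'\<close>, \<open>TwoA\<close>, \<open>TwoB\<close>, \<open>TwoC\<close> stand for the classes \<open>1\<close>, \<open>1'\<close>, \<open>2\<^sub>a\<close>, \<open>2\<^sub>b\<close>, \<open>2\<^sub>c\<close>.\<close>

datatype color = One | One' | TwoA | TwoB | TwoC

definition distance :: "'v pair_pre_digraph \<Rightarrow> 'v \<Rightarrow> 'v \<Rightarrow> ereal" where
  "distance G = wf_digraph.\<mu> G (\<lambda>_. 1)"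

fun separation :: "color \<Rightarrow> ereal" where
  "separation One = 2"
| "separation One' = 2"
| "separation TwoA = 3"
| "separation TwoB = 3"
| "separation TwoC = 3"

definition packing_coloring :: "'v pair_pre_digraph \<Rightarrow> ('v \<rightharpoonup> color) \<Rightarrow> bool" where
  "packing_coloring G \<phi> \<longleftrightarrow>
     dom \<phi> = pverts G \<and>
     (\<forall>u \<in> pverts G. \<forall>v \<in> pverts G. \<forall>c.
        u \<noteq> v \<and> \<phi> u = Some c \<and> \<phi> v = Some c \<longrightarrow> separation c \<le> distance G u v)"


section \<open>Cost model\<close>

text \<open>
  A computation is a result together with the number of elementary steps spent on it (unit-cost
  random access machine).  Arrays are modelled as functions, vertices serving as array indices as
  well; lists in the input are read like
  arrays, whose length is known.  One step is charged for
  \<^item> reading or writing an array cell (\<open>rd\<close>, \<open>wr\<close>),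
  \<^item> evaluating a constant-size expression over values already read, or appending one entry to a
    list kept with a pointer to its end (\<open>op\<close>),
  \<^item> each conditional branch (\<open>test\<close>),
  \<^item> each iteration, and for the termination, of a loop,
  \<^item> each cell of a newly allocated array, plus one for the allocation.

  Only \<open>return\<close> and the binding of intermediate results are free.
\<close>

type_synonym 'a tm = "'a \<times> nat"

definition return :: "'a \<Rightarrow> 'a tm" where
  "return x = (x, 0)"

definition bind_tm :: "'a tm \<Rightarrow> ('a \<Rightarrow> 'b tm) \<Rightarrow> 'b tm" where
  "bind_tm m f = (case m of (x, t) \<Rightarrow> case f x of (y, t') \<Rightarrow> (y, t + t'))"

adhoc_overloading Monad_Syntax.bind \<rightleftharpoons> bind_tm

definition op :: "'a \<Rightarrow> 'a tm" where
  "op x = (x, 1)"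

definition rd :: "('i \<Rightarrow> 'a) \<Rightarrow> 'i \<Rightarrow> 'a tm" where
  "rd A i = (A i, 1)"

definition wr :: "('i \<Rightarrow> 'a) \<Rightarrow> 'i \<Rightarrow> 'a \<Rightarrow> ('i \<Rightarrow> 'a) tm" where
  "wr A i x = (A(i := x), 1)"

definition new_array :: "nat \<Rightarrow> 'a \<Rightarrow> ('i \<Rightarrow> 'a) tm" where
  "new_array k x = (\<lambda>_. x, k + 1)"

definition test :: "bool \<Rightarrow> 'a tm \<Rightarrow> 'a tm \<Rightarrow> 'a tm" where
  "test c m m' = do { b \<leftarrow> op c; if b then m else m' }"

fun for_each :: "'i list \<Rightarrow> ('i \<Rightarrow> 's \<Rightarrow> 's tm) \<Rightarrow> 's \<Rightarrow> 's tm" where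
  "for_each [] f s = op s"
| "for_each (i # is) f s = do { s' \<leftarrow> op s; s'' \<leftarrow> f i s'; for_each is f s'' }"

text \<open>The first entry of a list that passes a test; the loop is left there.\<close>

fun first_such :: "'i list \<Rightarrow> ('i \<Rightarrow> bool tm) \<Rightarrow> 'i option tm" where
  "first_such [] p = op None"
| "first_such (i # is) p = do { b \<leftarrow> p i; test b (return (Some i)) (first_such is p) }"

text \<open>A while loop; \<^const>\<open>None\<close> stands for non-termination.\<close>

definition while_tm :: "('s \<Rightarrow> bool) \<Rightarrow> ('s \<Rightarrow> 's tm) \<Rightarrow> 's \<Rightarrow> 's tm option" where
  "while_tm b f s =
     while_option (\<lambda>(s, t). b s) (\<lambda>m. do { s \<leftarrow> m; s' \<leftarrow> op s; f s' }) (op s)"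


section \<open>The algorithm\<close>

type_synonym 'v coloring = "'v \<Rightarrow> color option"

text \<open>Used only for \<open>c\<close> in \<open>{One, One'}\<close>.\<close>

definition other :: "color \<Rightarrow> color" where
  "other c = (if c = One then One' else One)"

subsection \<open>Step 1: coloring the tree by breadth-first search\<close>

text \<open>The queue consists of the cells of the array \<open>Q\<close> from \<open>h\<close> up to, excluding, \<open>t\<close>.\<close>

definition bfs_visit ::
  "'v plane_tree \<Rightarrow> 'v coloring \<times> (nat \<Rightarrow> 'v) \<times> nat \<times> nat
    \<Rightarrow> ('v coloring \<times> (nat \<Rightarrow> 'v) \<times> nat \<times> nat) tm" where
  "bfs_visit T = (\<lambda>(\<phi>, Q, h, t). do {
     u \<leftarrow> rd Q h;
     h \<leftarrow> op (h + 1);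
     c \<leftarrow> rd \<phi> u;
     ws \<leftarrow> rd (rot T) u;
     (\<phi>, Q, t) \<leftarrow> for_each ws (\<lambda>w (\<phi>, Q, t). do {
       cw \<leftarrow> rd \<phi> w;
       test (cw = None)
         (do {
           \<phi> \<leftarrow> wr \<phi> w (Some (other (the c)));
           Q \<leftarrow> wr Q t w;
           t \<leftarrow> op (t + 1);
           return (\<phi>, Q, t) })
         (return (\<phi>, Q, t)) }) (\<phi>, Q, t);
     return (\<phi>, Q, h, t) })"

definition bfs_init ::
  "'v plane_tree \<Rightarrow> 'v \<Rightarrow> ('v coloring \<times> (nat \<Rightarrow> 'v) \<times> nat \<times> nat) tm" where
  "bfs_init T r = do {
     \<phi> \<leftarrow> new_array (length (vlist T)) None;
     Q \<leftarrow> new_array (length (vlist T)) r;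
     \<phi> \<leftarrow> wr \<phi> r (Some One);
     Q \<leftarrow> wr Q 0 r;
     return (\<phi>, Q, 0, 1) }"

definition bfs_coloring :: "'v plane_tree \<Rightarrow> 'v \<Rightarrow> 'v coloring tm option" where
  "bfs_coloring T r =
     (case bfs_init T r of (s, t0) \<Rightarrow>
      case while_tm (\<lambda>(\<phi>, Q, h, t). h < t) (bfs_visit T) s of
        None \<Rightarrow> None
      | Some ((\<phi>, _), t) \<Rightarrow> Some (\<phi>, t0 + t))"

subsection \<open>Step 2: RECOLORING\<close>

text \<open>
  The vertices \<open>a\<^sub>1, \<dots>, a\<^sub>n\<close> and \<open>b\<^sub>1, \<dots>, b\<^sub>n\<close> are kept in arrays \<open>a\<close> and \<open>b\<close>, indexed from 1.
\<close>

definition color_of :: "(nat \<Rightarrow> 'v) \<Rightarrow> 'v coloring \<Rightarrow> nat \<Rightarrow> color tm" where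
  "color_of a \<phi> k = do { v \<leftarrow> rd a k; c \<leftarrow> rd \<phi> v; op (the c) }"

definition paint :: "(nat \<Rightarrow> 'v) \<Rightarrow> nat \<Rightarrow> color \<Rightarrow> 'v coloring \<Rightarrow> 'v coloring tm" where
  "paint a k c \<phi> = do { v \<leftarrow> rd a k; wr \<phi> v (Some c) }"

text \<open>\<open>\<phi>(a\<^sub>k) := 1\<^sub>k\<close>\<close>

definition paint_one ::
  "(nat \<Rightarrow> 'v) \<Rightarrow> (nat \<Rightarrow> 'v) \<Rightarrow> nat \<Rightarrow> 'v coloring \<Rightarrow> 'v coloring tm" where
  "paint_one a b k \<phi> = do { c \<leftarrow> color_of b \<phi> k; one_k \<leftarrow> op (other c); paint a k one_k \<phi> }"

definition load :: "'v plane_tree \<Rightarrow> 'v list \<Rightarrow> nat \<Rightarrow> ((nat \<Rightarrow> 'v) \<times> (nat \<Rightarrow> 'v)) tm" where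
  "load T as n = do {
     a \<leftarrow> new_array (n + 1) (hd as);
     b \<leftarrow> new_array (n + 1) (hd as);
     for_each [1..<n + 1] (\<lambda>k (a, b). do {
       v \<leftarrow> rd ((!) as) (k - 1);
       a \<leftarrow> wr a k v;
       ws \<leftarrow> rd (rot T) v;
       w \<leftarrow> op (hd ws);
       b \<leftarrow> wr b k w;
       return (a, b) }) (a, b) }"

text \<open>\<open>(x\<^sub>1, \<dots>, x\<^sub>n) := (x\<^sub>i, \<dots>, x\<^sub>n, x\<^sub>1, \<dots>, x\<^sub>i\<^sub>-\<^sub>1)\<close>\<close>

definition relabel :: "nat \<Rightarrow> nat \<Rightarrow> (nat \<Rightarrow> 'v) \<Rightarrow> (nat \<Rightarrow> 'v) tm" where
  "relabel n i x = do {
     x0 \<leftarrow> rd x i;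
     y \<leftarrow> new_array (n + 1) x0;
     for_each [1..<n + 1] (\<lambda>k y. do {
       l \<leftarrow> op (i + k - 1);
       l \<leftarrow> test (l \<le> n) (return l) (op (l - n));
       v \<leftarrow> rd x l;
       wr y k v }) y }"

definition recolor_blocks ::
  "(nat \<Rightarrow> 'v) \<Rightarrow> (nat \<Rightarrow> 'v) \<Rightarrow> nat \<Rightarrow> 'v coloring \<Rightarrow> 'v coloring tm" where
  "recolor_blocks a b m = for_each [1..<m + 1] (\<lambda>k \<phi>.
     test (odd k)
       (paint_one a b k \<phi>)
       (test (k mod 4 = 2) (paint a k TwoA \<phi>) (paint a k TwoB \<phi>)))"

definition case_1_rest ::
  "(nat \<Rightarrow> 'v) \<Rightarrow> (nat \<Rightarrow> 'v) \<Rightarrow> nat \<Rightarrow> nat \<Rightarrow> 'v coloring \<Rightarrow> 'v coloring tm" where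
  "case_1_rest a b n m \<phi> = do {
     d \<leftarrow> op (n - m);
     test (d = 1) (paint_one a b n \<phi>)
     (test (d = 2) (do {
        \<phi> \<leftarrow> paint a (n - 1) TwoA \<phi>;
        paint_one a b n \<phi> })
     (test (d = 3) (do {
        \<phi> \<leftarrow> paint_one a b (n - 2) \<phi>;
        \<phi> \<leftarrow> paint a (n - 1) TwoA \<phi>;
        paint_one a b n \<phi> })
     (return \<phi>))) }"

definition case_2_rest ::
  "(nat \<Rightarrow> 'v) \<Rightarrow> (nat \<Rightarrow> 'v) \<Rightarrow> nat \<Rightarrow> nat \<Rightarrow> 'v coloring \<Rightarrow> 'v coloring tm" where
  "case_2_rest a b n m \<phi> = do {
     d \<leftarrow> op (n - m);
     test (d = 1) (paint a n TwoC \<phi>)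
     (test (d = 2) (do {
        \<phi> \<leftarrow> paint_one a b (n - 1) \<phi>;
        paint a n TwoC \<phi> })
     (test (d = 3) (do {
        \<phi> \<leftarrow> paint a (n - 2) TwoA \<phi>;
        \<phi> \<leftarrow> paint_one a b (n - 1) \<phi>;
        paint a n TwoB \<phi> })
     (return \<phi>))) }"

definition modification_i ::
  "(nat \<Rightarrow> 'v) \<Rightarrow> (nat \<Rightarrow> 'v) \<Rightarrow> nat \<Rightarrow> 'v coloring \<Rightarrow> 'v coloring tm" where
  "modification_i a b n \<phi> = do {
     cn \<leftarrow> color_of a \<phi> n;
     test (cn = TwoC)
       (do {
         found \<leftarrow> first_such [1..<n - 1] (\<lambda>i. do {
           c \<leftarrow> color_of a \<phi> (n - 1);
           ci \<leftarrow> color_of a \<phi> i;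
           bn \<leftarrow> rd b n;
           bn1 \<leftarrow> rd b (n - 1);
           bi \<leftarrow> rd b i;
           op (c = TwoB \<and> ci = TwoB \<and> bn = bn1 \<and> bn1 = bi) });
         test (found \<noteq> None)
           (do {
             \<phi> \<leftarrow> paint a 2 TwoC \<phi>;
             \<phi> \<leftarrow> paint a (n - 1) TwoC \<phi>;
             paint a n TwoA \<phi> })
           (return \<phi>) })
       (return \<phi>) }"

definition modification_ii ::
  "(nat \<Rightarrow> 'v) \<Rightarrow> (nat \<Rightarrow> 'v) \<Rightarrow> nat \<Rightarrow> 'v coloring \<Rightarrow> 'v coloring tm" where
  "modification_ii a b n \<phi> = do {
     cn \<leftarrow> color_of a \<phi> n;
     test (cn = TwoC)
       (do {
         blocked \<leftarrow> first_such [1..<n] (\<lambda>i. do {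
           ci \<leftarrow> color_of a \<phi> i;
           bi \<leftarrow> rd b i;
           bn \<leftarrow> rd b n;
           op ((ci = TwoA \<or> ci = TwoB) \<and> bi = bn) });
         found \<leftarrow> first_such [4..<n] (\<lambda>i. do {
           ci \<leftarrow> color_of a \<phi> i;
           bi \<leftarrow> rd b i;
           b2 \<leftarrow> rd b 2;
           op (ci = TwoA \<and> bi = b2) });
         test (blocked = None \<and> found \<noteq> None)
           (do {
             \<phi> \<leftarrow> paint a 2 TwoC \<phi>;
             paint a n TwoA \<phi> })
           (return \<phi>) })
       (return \<phi>) }"

definition run_case_1 ::
  "(nat \<Rightarrow> 'v) \<Rightarrow> (nat \<Rightarrow> 'v) \<Rightarrow> nat \<Rightarrow> 'v coloring \<Rightarrow> 'v coloring tm" where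
  "run_case_1 a b n \<phi> = do {
     m \<leftarrow> op (4 * (n div 4));
     \<phi> \<leftarrow> recolor_blocks a b m \<phi>;
     case_1_rest a b n m \<phi> }"

definition run_case_2 ::
  "(nat \<Rightarrow> 'v) \<Rightarrow> (nat \<Rightarrow> 'v) \<Rightarrow> nat \<Rightarrow> 'v coloring \<Rightarrow> 'v coloring tm" where
  "run_case_2 a b n \<phi> = do {
     m \<leftarrow> op (4 * (n div 4));
     \<phi> \<leftarrow> recolor_blocks a b m \<phi>;
     \<phi> \<leftarrow> case_2_rest a b n m \<phi>;
     \<phi> \<leftarrow> modification_i a b n \<phi>;
     modification_ii a b n \<phi> }"

text \<open>Besides the coloring, the possibly relabelled arrays are returned.\<close>

definition recoloring ::
  "(nat \<Rightarrow> 'v) \<Rightarrow> (nat \<Rightarrow> 'v) \<Rightarrow> nat \<Rightarrow> 'v coloring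
    \<Rightarrow> ((nat \<Rightarrow> 'v) \<times> (nat \<Rightarrow> 'v) \<times> 'v coloring) tm" where
  "recoloring a b n \<phi> = do {
     c1 \<leftarrow> color_of a \<phi> 1;
     cn \<leftarrow> color_of a \<phi> n;
     test (c1 \<noteq> cn)
       (do { \<phi> \<leftarrow> run_case_1 a b n \<phi>; return (a, b, \<phi>) })
       (do {
         change \<leftarrow> first_such [2..<n + 1] (\<lambda>i. do {
           ci \<leftarrow> color_of a \<phi> i;
           cp \<leftarrow> color_of a \<phi> (i - 1);
           op (ci \<noteq> cp) });
         test (change \<noteq> None)
           (do {
             a \<leftarrow> relabel n (the change) a;
             b \<leftarrow> relabel n (the change) b;
             \<phi> \<leftarrow> run_case_1 a b n \<phi>;
             return (a, b, \<phi>) })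
           (do { \<phi> \<leftarrow> run_case_2 a b n \<phi>; return (a, b, \<phi>) }) }) }"

subsection \<open>Step 3: CONFLICTS-RESOLVING\<close>

text \<open>
  The dictionary \<open>\<N>\<close> is an array indexed by vertices, with \<^const>\<open>None\<close> for vertices that are not
  keys.  A set \<open>\<N>[b]\<close> is kept as the list of its elements in the order of their insertion.
\<close>

definition build_dictionary ::
  "'v plane_tree \<Rightarrow> (nat \<Rightarrow> 'v) \<Rightarrow> (nat \<Rightarrow> 'v) \<Rightarrow> nat \<Rightarrow> 'v coloring \<Rightarrow> ('v \<Rightarrow> 'v list option) tm" where
  "build_dictionary T a b n \<phi> = do {
     \<N> \<leftarrow> new_array (length (vlist T)) None;
     for_each [1..<n + 1] (\<lambda>j \<N>. do {
       aj \<leftarrow> rd a j;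
       bj \<leftarrow> rd b j;
       entry \<leftarrow> rd \<N> bj;
       \<N> \<leftarrow> test (entry = None) (wr \<N> bj (Some [])) (return \<N>);
       c \<leftarrow> rd \<phi> aj;
       test (c \<notin> {Some One, Some One'})
         (do {
           entry \<leftarrow> rd \<N> bj;
           entry' \<leftarrow> op (the entry @ [aj]);
           wr \<N> bj (Some entry') })
         (return \<N>) }) \<N> }"

definition resolve_conflicts ::
  "'v plane_tree \<Rightarrow> (nat \<Rightarrow> 'v) \<Rightarrow> (nat \<Rightarrow> 'v) \<Rightarrow> nat \<Rightarrow> 'v coloring \<Rightarrow> 'v coloring tm" where
  "resolve_conflicts T a b n \<phi> = do {
     \<N> \<leftarrow> build_dictionary T a b n \<phi>;
     an \<leftarrow> rd a n;
     a \<leftarrow> wr a 0 an;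
     for_each [1..<n + 1] (\<lambda>i \<phi>.
       test (even i)
         (do {
           ai \<leftarrow> rd a i;
           bi \<leftarrow> rd b i;
           Nb \<leftarrow> rd \<N> bi;
           conflict \<leftarrow> first_such (the Nb) (\<lambda>aj. do {
             cj \<leftarrow> rd \<phi> aj;
             ci \<leftarrow> rd \<phi> ai;
             op (aj \<noteq> ai \<and> cj = ci \<and> ci \<noteq> Some TwoC) });
           test (conflict \<noteq> None)
             (do {
               c \<leftarrow> color_of a \<phi> (i - 2);
               test (c \<noteq> TwoC)
                 (wr \<phi> ai (Some TwoC))
                 (wr \<phi> (the conflict) (Some TwoC)) })
             (return \<phi>) })
         (return \<phi>)) \<phi> }"

subsection \<open>PACKING-COLORING\<close>

text \<open>
  The input is a Halin graph, given by its characteristic tree \<open>T\<close> and its adjoint cycle \<open>as\<close>,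
  and the root \<open>r\<close> chosen for the search.  The output is the coloring and the number of steps,
  or \<^const>\<open>None\<close> if the algorithm does not terminate.
\<close>

definition packing_coloring_algorithm ::
  "'v plane_tree \<Rightarrow> 'v list \<Rightarrow> 'v \<Rightarrow> 'v coloring tm option" where
  "packing_coloring_algorithm T as r =
     map_option (\<lambda>step1. do {
       \<phi> \<leftarrow> step1;
       n \<leftarrow> op (length as);
       (a, b) \<leftarrow> load T as n;
       (a, b, \<phi>) \<leftarrow> recoloring a b n \<phi>;
       resolve_conflicts T a b n \<phi> }) (bfs_coloring T r)"

end

theory Submission
  imports Defs
begin

text \<open>
  The search colors the tree properly with the classes \<open>1\<close> and \<open>1'\<close>
  (\<open>bfs_coloring_correct\<close>).  Afterwards only leaves change their colors.  The colors in the classes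
  \<open>2\<^sub>a\<close>, \<open>2\<^sub>b\<close>, \<open>2\<^sub>c\<close> are given to leaves only, and two leaves are at distance less than 3 exactly if
  they have the same neighbour in the tree or are at most two steps apart on the cycle.  A leaf that
  is not given such a color gets the class that its neighbour in the tree does not have.  Hence
  everything depends on the sequence of colors along the cycle and on the partition of the leaves
  into blocks of siblings, that is, of leaves with the same neighbour in the tree
  (\<open>packing_coloringI\<close>).

  Only two properties of the blocks matter.  They do not cross (\<open>noncrossing\<close>): the walk along the
  face of the tree passes no dart twice in a round, and since the tree has no cycle, each component
  that is left when a vertex is removed can be entered through one dart only.  And three leaves of a
  block are never pairwise nonadjacent (\<open>sibling_spread\<close>), because otherwise their common neighbour
  would have degree at least 6.

  RECOLORING spaces equal colors properly along the cycle, so what remains are conflicts between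
  siblings of the same color, \<open>2\<^sub>a\<close> or \<open>2\<^sub>b\<close>.  By the second property a block contains at most one such
  pair (\<open>one_conflict\<close>), and one of the two leaves gets the color \<open>2\<^sub>c\<close>: the lower one \<open>x\<close>, unless
  \<open>x - 2\<close> has color \<open>2\<^sub>c\<close> already.  The point of the proof is that leaves of color \<open>2\<^sub>c\<close> do not come too
  close to each other.  If an upper leaf is recolored, then because of \<open>x - 2\<close>, which can itself be
  the upper leaf of another conflict, and so on.  By noncrossing such a chain of conflicts runs
  straight to the left; it cannot leave an interval between two siblings (\<open>nested_not_TwoC\<close>), and
  outside of all such intervals it can only end in the leaf 2, with \<open>2\<^sub>c\<close> on the last leaf
  (\<open>outermost_TwoC\<close>).  The first statement keeps recolored leaves apart from each other.  The second one
  shows that a recolored leaf comes near a last leaf of color \<open>2\<^sub>c\<close> only in the situation that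
  modification (ii) of CASE-2 removes; modification (i) removes conflicts among the siblings of such a
  last leaf.

  All loops run over the leaves or over the vertices, with a bounded number of steps per iteration:
  the search visits every vertex once and looks at no more than 5 neighbours, and the list of the
  siblings of a leaf has at most 5 entries.  This gives linear time
  (\<open>packing_coloring_algorithm_correct\<close>).
\<close>

section \<open>Trees given by rotation systems\<close>

lemma cyclic_next_nth:
  assumes "distinct xs" "i < length xs"
  shows "cyclic_next xs (xs ! i) = xs ! (Suc i mod length xs)"
proof -
  have "takeWhile (\<lambda>y. y \<noteq> xs ! i) xs = take i xs"
    using assms by (intro takeWhile_eq_take_P_nth) (auto simp: nth_eq_iff_index_eq)
  then have drop: "dropWhile (\<lambda>y. y \<noteq> xs ! i) xs = drop i xs"
    using assms by (simp add: dropWhile_eq_drop)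
  then have "cyclic_next xs (xs ! i) = hd (drop (Suc i) xs @ xs)"
    by (simp add: cyclic_next_def drop_Suc tl_drop)
  also have "\<dots> = xs ! (Suc i mod length xs)"
  proof (cases "Suc i < length xs")
    case True
    then show ?thesis by (simp add: hd_append hd_drop_conv_nth)
  next
    case False
    then have "Suc i = length xs" using assms by simp
    moreover have "xs \<noteq> []" using assms by auto
    ultimately show ?thesis by (simp add: hd_conv_nth)
  qed
  finally show ?thesis .
qed

lemma inj_on_cyclic_next:
  assumes "distinct xs"
  shows "inj_on (cyclic_next xs) (set xs)"
proof (rule inj_onI)
  fix x y assume xy: "x \<in> set xs" "y \<in> set xs" and eq: "cyclic_next xs x = cyclic_next xs y"
  obtain i j where ij: "i < length xs" "j < length xs" "x = xs ! i" "y = xs ! j"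
    using xy by (auto simp: in_set_conv_nth)
  have "xs ! (Suc i mod length xs) = xs ! (Suc j mod length xs)"
    using eq ij assms by (simp add: cyclic_next_nth)
  moreover have "Suc i mod length xs < length xs" "Suc j mod length xs < length xs"
    using ij(1) by (auto intro!: mod_less_divisor)
  ultimately have "Suc i mod length xs = Suc j mod length xs"
    using assms by (simp only: nth_eq_iff_index_eq)
  then have "i = j"
    using ij by (metis Suc_inject Suc_lessI mod_Suc mod_less nat.distinct(1))
  then show "x = y" using ij by simp
qed

lemma cyclic_next_in_set:
  assumes "xs \<noteq> []"
  shows "cyclic_next xs x \<in> set xs"
proof -
  have "set (tl (dropWhile (\<lambda>y. y \<noteq> x) xs)) \<subseteq> set xs"
    by (metis (no_types, lifting) list.set_sel(2) list.sel(2) set_dropWhileD subsetI)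
  then show ?thesis
    using assms hd_in_set[of "tl (dropWhile (\<lambda>y. y \<noteq> x) xs) @ xs"]
    by (auto simp: cyclic_next_def)
qed

lemma cyclic_next_singleton: "cyclic_next [p] x = p"
  by (simp add: cyclic_next_def)

locale embedded_tree =
  fixes T :: "'v plane_tree"
  assumes plane: "is_plane_tree T"
begin

abbreviation V where "V \<equiv> set (vlist T)"
abbreviation E where "E \<equiv> parcs (tree_graph T)"

sublocale tree: pair_graph "tree_graph T"
  using plane by (simp add: is_plane_tree_def undirected_tree_def)

lemma pverts_tree: "pverts (tree_graph T) = V"
  by (simp add: tree_graph_def)

lemma arc_iff: "(u, v) \<in> E \<longleftrightarrow> u \<in> V \<and> v \<in> set (rot T u)"
  by (simp add: tree_graph_def)

lemma arc_sym: "(u, v) \<in> E \<Longrightarrow> (v, u) \<in> E"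
  by (rule tree.arcs_symmetric)

lemma arc_verts: "(u, v) \<in> E \<Longrightarrow> u \<in> V" "(u, v) \<in> E \<Longrightarrow> v \<in> V"
  using tree.wellformed' pverts_tree by auto

lemma no_loop: "(u, u) \<notin> E"
  using tree.no_loops' by blast

lemma distinct_rot: "v \<in> V \<Longrightarrow> distinct (rot T v)"
  using plane by (simp add: is_plane_tree_def)

lemma out_degree_rot: "v \<in> V \<Longrightarrow> out_degree (tree_graph T) v = length (rot T v)"
proof -
  assume v: "v \<in> V"
  have "out_arcs (tree_graph T) v = Pair v ` set (rot T v)"
    using v by (auto simp: out_arcs_def arc_iff)
  then show ?thesis
    using distinct_rot[OF v] by (simp add: out_degree_def card_image inj_on_def distinct_card)
qed

lemma rot_leaf:
  assumes "is_leaf T v"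
  obtains p where "rot T v = [p]"
  using assms out_degree_rot by (auto simp: is_leaf_def length_Suc_conv)

lemma connected_arcs: "u \<in> V \<Longrightarrow> v \<in> V \<Longrightarrow> (u, v) \<in> E\<^sup>*"
proof -
  assume uv: "u \<in> V" "v \<in> V"
  have "connected (tree_graph T)"
    using plane by (simp add: is_plane_tree_def undirected_tree_def)
  then have "strongly_connected (tree_graph T)"
    by (rule tree.symmetric_connected_imp_strongly_connected[OF tree.sym_arcs])
  then have "u \<rightarrow>\<^sup>*\<^bsub>tree_graph T\<^esub> v"
    using uv by (auto simp: strongly_connected_def pverts_tree)
  then show ?thesis
    unfolding reachable_def by (metis rtrancl_on_rtranclI with_proj_simps(3))
qed

lemma pawalk_verts_snoc:
  "pcas u p w \<Longrightarrow> pawalk_verts u (p @ [(w, v)]) = pawalk_verts u p @ [v]"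
  by (induction u p w rule: pcas.induct) auto

text \<open>
  A path from \<open>y\<close> to \<open>y'\<close> that avoids \<open>v\<close>, closed up through \<open>v\<close>, is a cycle.  Acyclicity is used in this
  form only: no vertex outside of a connected set of vertices has more than one arc into it.
\<close>

lemma no_detour:
  assumes vy: "(v, y) \<in> E" and vy': "(v, y') \<in> E"
    and path: "(y, y') \<in> (E \<inter> X \<times> X)\<^sup>*" and v: "v \<notin> X"
  shows "y = y'"
proof (rule ccontr)
  assume "y \<noteq> y'"
  define H where "H = \<lparr>pverts = V \<inter> X, parcs = E \<inter> X \<times> X\<rparr>"
  interpret H: pair_wf_digraph H
    by unfold_locales (auto simp: H_def dest: arc_verts)
  obtain z where "(y, z) \<in> E \<inter> X \<times> X"
    using path by (rule converse_rtranclE) (use \<open>y \<noteq> y'\<close> in auto)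
  then have "y \<in> X" "y \<in> V" by (auto dest: arc_verts)
  have "\<exists>p. H.awalk y p y'"
    using path
  proof (induction rule: rtrancl_induct)
    case base
    have "H.awalk y [] y"
      unfolding H.awalk_Nil_iff using \<open>y \<in> X\<close> \<open>y \<in> V\<close> by (simp add: H_def)
    then show ?case ..
  next
    case (step z z')
    then obtain p where "H.awalk y p z" by blast
    moreover have "H.awalk z [(z, z')] z'"
      unfolding H.awalk_simps using step(2) by (auto simp: H_def dest: arc_verts)
    ultimately show ?case
      using H.awalk_appendI by blast
  qed
  then obtain p where p: "H.apath y p y'"
    using H.apath_awalk_to_apath by blast
  then have pH: "H.awalk y p y'" and dist: "distinct (pawalk_verts y p)"
    by (auto simp: H.apath_def)
  have cas: "pcas y p y'" and sub: "set p \<subseteq> E \<inter> X \<times> X"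
    using pH unfolding H.awalk_def by (auto simp: H_def)
  have "p \<noteq> []" using cas \<open>y \<noteq> y'\<close> by auto
  have notin: "v \<notin> set (pawalk_verts y p)"
    using H.awalk_verts_in_verts[of y p v] cas sub v \<open>y \<in> X\<close> \<open>y \<in> V\<close> by (auto simp: H_def)
  have "tree.awalk y p y'"
    using cas sub arc_verts(2)[OF vy] by (auto simp: tree.awalk_def pverts_tree)
  moreover have "tree.awalk y' [(y', v)] v"
    using arc_sym[OF vy'] arc_verts[OF vy'] by (auto simp: tree.awalk_simps pverts_tree)
  ultimately have "tree.awalk v ((v, y) # p @ [(y', v)]) v"
    using vy by (auto simp: tree.awalk_Cons_iff intro: tree.awalk_appendI)
  then have "tree.cycle ((v, y) # p @ [(y', v)])"
    unfolding tree.cycle_def using notin dist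
    by (intro exI[of _ v]) (simp add: pawalk_verts_snoc[OF cas])
  moreover have "3 \<le> length ((v, y) # p @ [(y', v)])"
    using \<open>p \<noteq> []\<close> by (cases p) auto
  ultimately show False
    using plane by (auto simp: is_plane_tree_def undirected_tree_def)
qed

end


section \<open>The cyclic order of the leaves\<close>

locale halin =
  fixes T :: "'v plane_tree" and as :: "'v list"
  assumes halin: "is_halin T as"
begin

sublocale embedded_tree T
  using halin by unfold_locales (simp add: is_halin_def)

abbreviation n where "n \<equiv> length as"
abbreviation G where "G \<equiv> halin_graph T as"

definition parent :: "'v \<Rightarrow> 'v" where
  "parent v = hd (rot T v)"

lemma n_ge_3: "3 \<le> n"
  using halin by (simp add: is_halin_def adjoint_cycle_def)

lemma distinct_as: "distinct as"
  using halin by (simp add: is_halin_def adjoint_cycle_def)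

lemma set_as: "set as = {v. is_leaf T v}"
  using halin by (simp add: is_halin_def adjoint_cycle_def)

lemma leaf_nth: "i < n \<Longrightarrow> is_leaf T (as ! i)"
  using set_as nth_mem by blast

lemma next_leaf_nth: "i < n \<Longrightarrow> next_leaf T (as ! i) (as ! (Suc i mod n))"
  using halin by (simp add: is_halin_def adjoint_cycle_def)

lemma leaf_V: "is_leaf T v \<Longrightarrow> v \<in> V"
  by (simp add: is_leaf_def)

lemma rot_leaf_parent: "is_leaf T v \<Longrightarrow> rot T v = [parent v]"
  by (auto elim!: rot_leaf simp: parent_def)

lemma leaf_arc_iff: "is_leaf T v \<Longrightarrow> (v, u) \<in> E \<longleftrightarrow> u = parent v"
  by (auto simp: arc_iff rot_leaf_parent leaf_V)

text \<open>
  Two adjacent leaves would be a whole component of the tree, which has at least three leaves.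
\<close>

lemma parent_not_leaf:
  assumes "is_leaf T v"
  shows "\<not> is_leaf T (parent v)"
proof
  assume p: "is_leaf T (parent v)"
  have "(v, parent v) \<in> E"
    using assms by (simp add: leaf_arc_iff)
  then have "(parent v, v) \<in> E" by (rule arc_sym)
  then have pp: "parent (parent v) = v"
    using leaf_arc_iff[OF p] by simp
  have "x \<in> {v, parent v}" if "(v, x) \<in> E\<^sup>*" for x
    using that by induction (auto simp: leaf_arc_iff assms p pp)
  then have "V \<subseteq> {v, parent v}"
    using connected_arcs leaf_V[OF assms] by blast
  then have "set as \<subseteq> {v, parent v}"
    using set_as leaf_V by blast
  then have "card (set as) \<le> card {v, parent v}"
    by (intro card_mono) auto
  also have "\<dots> \<le> 2" by (simp add: card_insert_if)
  finally show False
    using n_ge_3 distinct_card[OF distinct_as] by simp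
qed

abbreviation step where "step \<equiv> face_step T"

text \<open>
  The walk along the face moves through darts, that is, arcs.  This is the dart by which it leaves the
  leaf number \<open>i\<close>, where the numbers are taken modulo \<open>n\<close> so that the walk can go on after the last leaf.
\<close>

definition leaf_dart :: "nat \<Rightarrow> 'v \<times> 'v" where
  "leaf_dart i = (as ! (i mod n), parent (as ! (i mod n)))"

lemma fst_step: "fst (step d) = snd d"
  by (simp add: face_step_def split: prod.split)

lemma step_arc: "d \<in> E \<Longrightarrow> step d \<in> E"
proof -
  assume "d \<in> E"
  moreover obtain u v where d: "d = (u, v)" by fastforce
  ultimately have "(v, u) \<in> E" by (simp add: arc_sym)
  then have "v \<in> V" "rot T v \<noteq> []" by (auto simp: arc_iff)
  then show "step d \<in> E"
    by (simp add: d face_step_def arc_iff cyclic_next_in_set)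
qed

lemma n_pos: "0 < n"
  using n_ge_3 by linarith

lemma leaf_dart_arc: "leaf_dart i \<in> E"
  using leaf_nth[of "i mod n"] n_pos by (simp add: leaf_dart_def leaf_arc_iff)

lemma walk_arc: "(step ^^ k) (leaf_dart i) \<in> E"
  by (induction k) (auto simp: leaf_dart_arc step_arc simp del: face_step_def)

text \<open>
  A leaf has a single edge, so the walk leaves it in the same way whatever dart it comes from.  Hence
  the walks from each leaf to the next one are the segments of one walk around the tree.
\<close>

lemma leaf_dart_segment:
  "\<exists>k. (step ^^ Suc k) (leaf_dart i) = leaf_dart (Suc i) \<and>
       (\<forall>l. 0 < l \<and> l < Suc k \<longrightarrow> \<not> is_leaf T (fst ((step ^^ l) (leaf_dart i))))"
proof -
  let ?i = "i mod n" and ?j = "Suc i mod n"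
  have i: "?i < n" using n_pos by simp
  have "next_leaf T (as ! ?i) (as ! ?j)"
    using next_leaf_nth[OF i] by (simp add: mod_Suc_eq)
  then obtain k where k: "snd ((step ^^ k) (leaf_dart i)) = as ! ?j"
    and nl: "\<And>l. l < k \<Longrightarrow> \<not> is_leaf T (snd ((step ^^ l) (leaf_dart i)))"
    by (auto simp: next_leaf_def leaf_dart_def parent_def)
  have leaf: "is_leaf T (as ! ?j)"
    using n_pos by (intro leaf_nth) simp
  obtain u where u: "(step ^^ k) (leaf_dart i) = (u, as ! ?j)"
    using k by (metis prod.collapse)
  have "(step ^^ Suc k) (leaf_dart i) = step (u, as ! ?j)"
    by (simp add: u)
  also have "\<dots> = leaf_dart (Suc i)"
    by (simp add: face_step_def rot_leaf_parent[OF leaf] cyclic_next_singleton leaf_dart_def)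
  finally have "(step ^^ Suc k) (leaf_dart i) = leaf_dart (Suc i)" .
  moreover have "\<not> is_leaf T (fst ((step ^^ l) (leaf_dart i)))" if l: "0 < l" "l < Suc k" for l
  proof -
    obtain m where m: "l = Suc m" using l(1) by (cases l) auto
    then have "fst ((step ^^ l) (leaf_dart i)) = snd ((step ^^ m) (leaf_dart i))"
      by (simp add: fst_step)
    then show ?thesis using nl[of m] l(2) m by simp
  qed
  ultimately show ?thesis by blast
qed

definition segment_length :: "nat \<Rightarrow> nat" where
  "segment_length i = (SOME k. (step ^^ Suc k) (leaf_dart i) = leaf_dart (Suc i) \<and>
       (\<forall>l. 0 < l \<and> l < Suc k \<longrightarrow> \<not> is_leaf T (fst ((step ^^ l) (leaf_dart i)))))"

lemma segment_length:
  "(step ^^ Suc (segment_length i)) (leaf_dart i) = leaf_dart (Suc i)"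
  "0 < l \<Longrightarrow> l < Suc (segment_length i) \<Longrightarrow> \<not> is_leaf T (fst ((step ^^ l) (leaf_dart i)))"
  using someI_ex[OF leaf_dart_segment[of i]] unfolding segment_length_def[symmetric] by blast+

definition leaf_time :: "nat \<Rightarrow> nat" where
  "leaf_time i = (\<Sum>j<i. Suc (segment_length j))"

abbreviation walk :: "nat \<Rightarrow> 'v \<times> 'v" where
  "walk t \<equiv> (step ^^ t) (leaf_dart 0)"

lemma leaf_time_Suc: "leaf_time (Suc i) = Suc (segment_length i) + leaf_time i"
  by (simp add: leaf_time_def)

lemma strict_mono_leaf_time: "strict_mono leaf_time"
  by (simp add: strict_mono_Suc_iff leaf_time_Suc)

lemma walk_leaf_time: "walk (leaf_time i) = leaf_dart i"
proof (induction i)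
  case (Suc i)
  have "walk (leaf_time (Suc i)) = (step ^^ Suc (segment_length i)) (walk (leaf_time i))"
    by (simp only: leaf_time_Suc funpow_add comp_apply)
  then show ?case using segment_length(1) Suc by simp
qed (simp add: leaf_time_def)

lemma fst_walk_leaf_time: "i < n \<Longrightarrow> fst (walk (leaf_time i)) = as ! i"
  unfolding walk_leaf_time by (simp add: leaf_dart_def)

lemma walk_add: "walk (s + t) = (step ^^ s) (walk t)"
  by (simp add: funpow_add)

lemma leaf_at_time:
  assumes "t < leaf_time i" "is_leaf T (fst (walk t))"
  shows "\<exists>j < i. t = leaf_time j"
  using assms
proof (induction i)
  case (Suc i)
  show ?case
  proof (cases "t < leaf_time i")
    case True
    then show ?thesis using Suc by (meson less_SucI)
  next
    case False
    then obtain l where l: "t = l + leaf_time i"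
      by (metis add.commute le_Suc_ex not_less)
    then have "walk t = (step ^^ l) (leaf_dart i)"
      by (simp add: funpow_add walk_leaf_time)
    then have "l = 0"
      using segment_length(2)[of l i] Suc.prems l by (auto simp: leaf_time_Suc)
    then show ?thesis using l by auto
  qed
qed (simp add: leaf_time_def)

text \<open>
  After \<open>n\<close> segments the walk is back at its first dart.  If it met a dart twice before that, it would
  return to the first dart too early, and the first leaf would occur again among the other leaves.
\<close>

lemma inj_on_walk: "inj_on walk {..< leaf_time n}"
proof -
  have False if "t < t'" "t' < leaf_time n" "walk t = walk t'" for t t'
  proof -
    let ?r = "leaf_time n - (t' - t)"
    have "?r = (leaf_time n - t') + t" "(leaf_time n - t') + t' = leaf_time n"
      using that by linarith+
    then have "walk ?r = (step ^^ (leaf_time n - t')) (walk t)"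
      by (simp only: walk_add)
    also have "\<dots> = (step ^^ (leaf_time n - t')) (walk t')"
      by (simp only: that)
    also have "\<dots> = walk (leaf_time n)"
      by (simp only: walk_add[symmetric] \<open>(leaf_time n - t') + t' = leaf_time n\<close>)
    also have "\<dots> = leaf_dart 0"
      unfolding walk_leaf_time by (simp add: leaf_dart_def)
    finally have w: "walk ?r = leaf_dart 0" .
    have "is_leaf T (fst (walk ?r))"
      unfolding w using leaf_nth[of 0] n_pos by (simp add: leaf_dart_def)
    moreover have "?r < leaf_time n" using that by linarith
    ultimately obtain j where j: "j < n" "?r = leaf_time j"
      using leaf_at_time by blast
    then have "leaf_dart j = leaf_dart 0"
      using w walk_leaf_time[of j] by simp
    then have "as ! j = as ! 0"
      using j n_pos by (simp add: leaf_dart_def)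
    then have "j = 0"
      using j n_pos distinct_as by (simp add: nth_eq_iff_index_eq)
    then show False
      using j that by (simp add: leaf_time_def)
  qed
  then show ?thesis
    by (intro inj_onI) (metis lessThan_iff linorder_neqE_nat)
qed

lemma enters:
  assumes "i < j" "j < n" "as ! i \<notin> B" "as ! j \<in> B"
  shows "\<exists>t \<ge> leaf_time i. t < leaf_time j \<and> fst (walk t) \<notin> B \<and> snd (walk t) \<in> B"
proof (rule ccontr)
  assume contra: "\<not> ?thesis"
  have "leaf_time i + d \<le> leaf_time j \<Longrightarrow> fst (walk (leaf_time i + d)) \<notin> B" for d
  proof (induction d)
    case 0
    then show ?case using assms by (simp add: fst_walk_leaf_time)
  next
    case (Suc d)
    then have "fst (walk (leaf_time i + d)) \<notin> B" "leaf_time i + d < leaf_time j" by auto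
    then have "snd (walk (leaf_time i + d)) \<notin> B"
      using contra by (meson le_add1)
    then show ?case by (simp add: fst_step)
  qed
  from this[of "leaf_time j - leaf_time i"] have "fst (walk (leaf_time j)) \<notin> B"
    using strict_mono_less[OF strict_mono_leaf_time, of i j] assms by simp
  then show False
    using assms by (simp add: fst_walk_leaf_time)
qed

text \<open>
  Let \<open>B\<close> be the component of \<open>w\<close>, the parent of the leaves \<open>j\<close> and \<open>l\<close>, in the tree without \<open>v\<close>, the
  parent of the leaves \<open>i\<close> and \<open>k\<close>.  The walk can enter \<open>B\<close> only from \<open>v\<close>, and only through one arc.  But
  if the leaves alternated, the walk would enter \<open>B\<close> between \<open>i\<close> and \<open>j\<close> and again between \<open>k\<close> and \<open>l\<close>,
  and would thus repeat a dart.
\<close>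

lemma noncrossing:
  assumes ord: "i < j" "j < k" "k < l" "l < n"
    and ik: "parent (as ! i) = parent (as ! k)" and jl: "parent (as ! j) = parent (as ! l)"
  shows "parent (as ! i) = parent (as ! j)"
proof (rule ccontr)
  define v w where "v = parent (as ! i)" and "w = parent (as ! j)"
  assume "parent (as ! i) \<noteq> parent (as ! j)"
  then have vw: "v \<noteq> w" by (simp add: v_def w_def)
  define R where "R = E \<inter> (- {v}) \<times> (- {v})"
  define B where "B = {x. (w, x) \<in> R\<^sup>*}"
  have leaves: "is_leaf T (as ! i)" "is_leaf T (as ! j)" "is_leaf T (as ! k)" "is_leaf T (as ! l)"
    using ord by (auto intro: leaf_nth)
  then have inner: "\<not> is_leaf T v" "\<not> is_leaf T w"
    by (auto simp: v_def w_def parent_not_leaf)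
  have symR: "sym (R\<^sup>*)"
    by (intro sym_rtrancl symI) (auto simp: R_def arc_sym)
  have inside: "x \<in> B" if "is_leaf T x" "parent x = w" for x
  proof -
    have "(x, w) \<in> E" using leaf_arc_iff[OF that(1), of w] that(2) by simp
    then have "(w, x) \<in> E" by (rule arc_sym)
    then have "(w, x) \<in> R" using that(1) inner vw by (auto simp: R_def)
    then show ?thesis by (auto simp: B_def)
  qed
  have outside: "x \<notin> B" if x: "is_leaf T x" "parent x = v" for x
  proof
    assume "x \<in> B"
    then have "(w, x) \<in> R\<^sup>*" by (simp add: B_def)
    then show False
    proof (cases rule: rtranclE)
      case base
      then show False using inner x by simp
    next
      case (step y)
      then have "(x, y) \<in> E" "y \<noteq> v" using arc_sym by (auto simp: R_def)
      then show False using leaf_arc_iff[OF x(1)] x(2) by simp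
    qed
  qed
  have entry: "u = v" if "(u, y) \<in> E" "u \<notin> B" "y \<in> B" for u y
  proof (rule ccontr)
    assume "u \<noteq> v"
    have "y \<noteq> v"
      using that(3) vw by (auto simp: B_def R_def elim: rtranclE)
    then have "(y, u) \<in> R"
      using \<open>u \<noteq> v\<close> that(1) arc_sym by (simp add: R_def)
    then have "u \<in> B"
      using that(3) by (auto simp: B_def)
    then show False using that(2) by simp
  qed
  have io: "as ! i \<notin> B" "as ! j \<in> B" "as ! k \<notin> B" "as ! l \<in> B"
    using outside[OF leaves(1)] inside[OF leaves(2)] outside[OF leaves(3)] inside[OF leaves(4)] ik jl
    by (simp_all add: v_def w_def)
  obtain t where t: "leaf_time i \<le> t" "t < leaf_time j" "fst (walk t) \<notin> B" "snd (walk t) \<in> B"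
    using enters[OF ord(1) _ io(1,2)] ord by (meson less_trans)
  obtain t' where t': "leaf_time k \<le> t'" "t' < leaf_time l" "fst (walk t') \<notin> B" "snd (walk t') \<in> B"
    using enters[OF ord(3,4) io(3,4)] by blast
  have "\<exists>y. walk s = (v, y) \<and> (v, y) \<in> E \<and> y \<in> B"
    if "fst (walk s) \<notin> B" "snd (walk s) \<in> B" for s
  proof -
    obtain u y where uy: "walk s = (u, y)" by fastforce
    have "(u, y) \<in> E" "u \<notin> B" "y \<in> B"
      using walk_arc[of s 0] that by (simp_all add: uy)
    moreover from entry[OF this] have "u = v" .
    ultimately show ?thesis by (simp add: uy)
  qed
  then obtain y y' where y: "walk t = (v, y)" "(v, y) \<in> E" "y \<in> B"
    and y': "walk t' = (v, y')" "(v, y') \<in> E" "y' \<in> B"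
    using t(3,4) t'(3,4) by meson
  have "(y, y') \<in> R\<^sup>*"
    using y(3) y'(3) unfolding B_def mem_Collect_eq by (meson rtrancl_trans symD[OF symR])
  then have "y = y'"
    using no_detour[OF y(2) y'(2)] by (simp add: R_def)
  then have "walk t = walk t'" using y y' by simp
  moreover have "leaf_time j < leaf_time k" "leaf_time l < leaf_time n"
    using ord by (simp_all add: strict_mono_less[OF strict_mono_leaf_time])
  ultimately show False
    using inj_onD[OF inj_on_walk, of t t'] t t' by simp
qed

text \<open>
  The neighbour of \<open>v\<close> that follows a leaf in the rotation at \<open>v\<close> is the next leaf on the cycle if it is
  a leaf at all.  So if none of the three leaves is followed on the cycle by another one of them, then
  they and their successors in the rotation are six different neighbours of \<open>v\<close>.
\<close>

lemma sibling_spread: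
  assumes deg: "out_degree (tree_graph T) v \<le> 5"
    and xyz: "x < n" "y < n" "z < n" "parent (as ! x) = v" "parent (as ! y) = v" "parent (as ! z) = v"
    and neq: "x \<noteq> y" "x \<noteq> z" "y \<noteq> z"
  shows "\<exists>p \<in> {x, y, z}. \<exists>q \<in> {x, y, z}. q = Suc p mod n"
proof (rule ccontr)
  assume contra: "\<not> ?thesis"
  define S where "S = (!) as ` {x, y, z}"
  define S' where "S' = cyclic_next (rot T v) ` S"
  have leaf: "is_leaf T (as ! p)" "parent (as ! p) = v" "p < n" if "p \<in> {x, y, z}" for p
    using that xyz by (auto intro: leaf_nth)
  have nl: "\<not> is_leaf T v"
    using parent_not_leaf[OF leaf(1)[of x]] leaf(2)[of x] by simp
  have SE: "(v, a) \<in> E" if a: "a \<in> S" for a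
  proof -
    obtain p where p: "p \<in> {x, y, z}" "a = as ! p"
      using a unfolding S_def by blast
    have "(as ! p, v) \<in> E"
      using leaf_arc_iff[OF leaf(1)[OF p(1)], of v] leaf(2)[OF p(1)] by simp
    then show ?thesis unfolding p(2) by (rule arc_sym)
  qed
  then have vV: "v \<in> V" and Srot: "S \<subseteq> set (rot T v)"
    by (auto simp: arc_iff S_def)
  have S'rot: "S' \<subseteq> set (rot T v)"
    using Srot by (auto simp: S'_def S_def intro!: cyclic_next_in_set)
  have inj: "inj_on ((!) as) {x, y, z}"
    using xyz distinct_as by (auto simp: inj_on_def nth_eq_iff_index_eq)
  have cS: "card S = 3"
    using card_image[OF inj] neq by (simp add: S_def)
  have cS': "card S' = 3"
    using card_image[OF inj_on_subset[OF inj_on_cyclic_next[OF distinct_rot[OF vV]] Srot]] cS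
    by (simp add: S'_def)
  have succ: "cyclic_next (rot T v) (as ! p) = as ! (Suc p mod n)"
    if p: "p \<in> {x, y, z}" and l: "is_leaf T (cyclic_next (rot T v) (as ! p))" for p
  proof -
    let ?w = "\<lambda>k. snd ((step ^^ k) (as ! p, v))"
    obtain k where k: "?w k = as ! (Suc p mod n)" "\<And>l. l < k \<Longrightarrow> \<not> is_leaf T (?w l)"
      using next_leaf_nth[OF leaf(3)[OF p]] leaf(2)[OF p] by (auto simp: next_leaf_def parent_def)
    have "is_leaf T (as ! (Suc p mod n))"
      using n_pos by (intro leaf_nth) simp
    then have "k \<noteq> 0" using k(1) nl by (cases k) auto
    moreover have "?w 1 = cyclic_next (rot T v) (as ! p)"
      by (simp add: face_step_def)
    ultimately have "k = 1"
      using k(2)[of 1] l by (metis less_one linorder_neqE_nat)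
    then show ?thesis using k(1) by (simp add: face_step_def)
  qed
  have "S \<inter> S' = {}"
  proof (rule ccontr)
    assume "S \<inter> S' \<noteq> {}"
    then obtain p q where pq: "p \<in> {x, y, z}" "q \<in> {x, y, z}"
      and eq: "as ! q = cyclic_next (rot T v) (as ! p)"
      unfolding S_def S'_def by blast
    then have "as ! q = as ! (Suc p mod n)"
      using succ[OF pq(1)] leaf(1)[OF pq(2)] by simp
    then have "q = Suc p mod n"
      using leaf(3)[OF pq(2)] n_pos distinct_as by (simp add: nth_eq_iff_index_eq)
    then show False using contra pq by blast
  qed
  then have "card (S \<union> S') = 6"
    using cS cS' by (subst card_Un_disjoint) (auto simp: S_def S'_def)
  moreover have "card (S \<union> S') \<le> card (set (rot T v))"
    using Srot S'rot by (intro card_mono) auto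
  ultimately show False
    using deg vV by (simp add: out_degree_rot distinct_card distinct_rot)
qed

end

section \<open>Conflicts between sibling leaves\<close>

definition is_two :: "color \<Rightarrow> bool" where
  "is_two c \<longleftrightarrow> c \<in> {TwoA, TwoB, TwoC}"

lemma is_two_iff: "is_two c \<longleftrightarrow> c = TwoA \<or> c = TwoB \<or> c = TwoC"
  by (simp add: is_two_def)

text \<open>
  The positions on the cycle are \<open>1, \<dots>, n\<close>.  For \<open>i < j\<close>, being near means that the distance along the
  cycle is at most 2.
\<close>

definition near :: "nat \<Rightarrow> nat \<Rightarrow> nat \<Rightarrow> bool" where
  "near n i j \<longleftrightarrow> j \<le> i + 2 \<or> i + n \<le> j + 2"

definition adjacent :: "nat \<Rightarrow> nat \<Rightarrow> nat \<Rightarrow> bool" where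
  "adjacent n i j \<longleftrightarrow> j = Suc i \<or> i = Suc j \<or> (i = 1 \<and> j = n) \<or> (i = n \<and> j = 1)"

text \<open>
  All that the recoloring has to know about the tree, where \<open>b k\<close> is the neighbour of the leaf \<open>k\<close> in the
  tree, called its parent: leaves with equal parents form noncrossing blocks, and three leaves of a
  block are never pairwise nonadjacent.
\<close>

locale leaf_blocks =
  fixes n :: nat and b :: "nat \<Rightarrow> 'v"
  assumes n_ge_3: "3 \<le> n"
    and noncrossing: "\<lbrakk>1 \<le> i; i < j; j < k; k < l; l \<le> n; b i = b k; b j = b l\<rbrakk> \<Longrightarrow> b i = b j"
    and spread: "\<lbrakk>1 \<le> i; i < j; j < k; k \<le> n; b i = b j; b j = b k\<rbrakk>
      \<Longrightarrow> adjacent n i j \<or> adjacent n j k \<or> adjacent n i k"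

definition sibling_conflict :: "nat \<Rightarrow> (nat \<Rightarrow> 'v) \<Rightarrow> (nat \<Rightarrow> color) \<Rightarrow> nat \<Rightarrow> nat \<Rightarrow> bool" where
  "sibling_conflict n b f x y \<longleftrightarrow>
     1 \<le> x \<and> x < y \<and> y \<le> n \<and> b x = b y \<and> f x = f y \<and> (f x = TwoA \<or> f x = TwoB)"

text \<open>
  What CONFLICTS-RESOLVING does to a coloring \<open>f\<close>, without reference to the order of the steps.  The
  color of the leaf \<open>x - 2\<close> is final when it is inspected in step \<open>x\<close>, so it may be taken from the outcome
  \<open>g\<close>; in step 2, where \<open>a\<^sub>0\<close> stands for \<open>a\<^sub>n\<close>, the inspected color is still the old one.
\<close>

definition resolves :: "nat \<Rightarrow> (nat \<Rightarrow> 'v) \<Rightarrow> (nat \<Rightarrow> color) \<Rightarrow> (nat \<Rightarrow> color) \<Rightarrow> bool" where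
  "resolves n b f g \<longleftrightarrow>
     (\<forall>k. 1 \<le> k \<longrightarrow> k \<le> n \<longrightarrow> (\<forall>x y. sibling_conflict n b f x y \<longrightarrow> k \<noteq> x \<and> k \<noteq> y) \<longrightarrow> g k = f k) \<and>
     (\<forall>x y. sibling_conflict n b f x y \<longrightarrow>
        (if (if x = 2 then f n else g (x - 2)) = TwoC
         then g x = f x \<and> g y = TwoC
         else g x = TwoC \<and> g y = f y))"

definition spaced :: "nat \<Rightarrow> (nat \<Rightarrow> 'v) \<Rightarrow> (nat \<Rightarrow> color) \<Rightarrow> bool" where
  "spaced n b g \<longleftrightarrow> (\<forall>i j. 1 \<le> i \<longrightarrow> i < j \<longrightarrow> j \<le> n \<longrightarrow> g i = g j \<longrightarrow> is_two (g i) \<longrightarrow>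
     \<not> near n i j \<and> b i \<noteq> b j)"

text \<open>
  The properties shared by all colorings that RECOLORING produces.  Leaves with a class \<open>2\<close> color sit on
  the even positions, apart from a few positions at the end of the cycle; there, two such leaves can
  be adjacent, but this happens with the colors \<open>2\<^sub>a\<close> and \<open>2\<^sub>b\<close> at one place only.
\<close>

locale recolored = leaf_blocks n b for n and b :: "nat \<Rightarrow> 'v" +
  fixes f :: "nat \<Rightarrow> color"
  assumes far: "\<lbrakk>1 \<le> i; i < j; j \<le> n; near n i j; is_two (f i)\<rbrakk> \<Longrightarrow> f i \<noteq> f j"
    and odd_unmatched: "\<lbrakk>1 \<le> i; i < j; j \<le> n; odd i; is_two (f i)\<rbrakk> \<Longrightarrow> f i \<noteq> f j"
    and no_even_after_odd: "\<lbrakk>1 \<le> i; i < j; j \<le> n; odd i; even j; is_two (f i)\<rbrakk> \<Longrightarrow> \<not> is_two (f j)"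
    and one_contact: "\<lbrakk>i \<in> {1..n}; j \<in> {1..n}; i' \<in> {1..n}; j' \<in> {1..n};
      adjacent n i j; adjacent n i' j'; f i = TwoA; f i' = TwoA; f j = TwoB; f j' = TwoB\<rbrakk> \<Longrightarrow> j = j'"
    and no_three: "\<lbrakk>1 \<le> i; i + 2 \<le> n; is_two (f i); is_two (f (i + 1))\<rbrakk> \<Longrightarrow> \<not> is_two (f (i + 2))"
begin

abbreviation conflict :: "nat \<Rightarrow> nat \<Rightarrow> bool" where
  "conflict \<equiv> sibling_conflict n b f"

lemma conflictD:
  assumes "conflict x y"
  shows "1 \<le> x" "x < y" "y \<le> n" "b x = b y" "f x = f y" "f x \<noteq> TwoC" "f y \<noteq> TwoC"
    "is_two (f x)" "is_two (f y)"
  using assms by (auto simp: sibling_conflict_def is_two_iff)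

lemma conflict_even: "conflict x y \<Longrightarrow> even x"
  using odd_unmatched conflictD by metis

lemma conflict_ge_2: "conflict x y \<Longrightarrow> 2 \<le> x"
  using conflict_even[of x y] conflictD(1)[of x y] by (cases "x = 1") auto

text \<open>
  Leaves of equal class \<open>2\<close> color are not near, hence not adjacent, so three of them cannot be siblings.
\<close>

lemma no_triple:
  assumes "1 \<le> i" "i < j" "j < k" "k \<le> n" "b i = b j" "b j = b k" "f i = f j" "f j = f k" "is_two (f i)"
  shows False
proof -
  have "\<not> near n i j" "\<not> near n j k" "\<not> near n i k"
    using far[of i j] far[of j k] far[of i k] assms by auto
  then show False
    using spread[of i j k] assms by (auto simp: adjacent_def near_def)
qed

lemma touching:
  assumes c: "conflict i j" and k: "1 \<le> k" "k \<le> n" "b k = b i" "k \<noteq> i" "k \<noteq> j"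
  shows "adjacent n i k \<or> adjacent n j k"
proof -
  note D = conflictD[OF c]
  have "\<not> near n i j" using far[of i j] D by auto
  then have nij: "\<not> adjacent n i j" using D by (auto simp: adjacent_def near_def)
  have sym: "adjacent n p q \<longleftrightarrow> adjacent n q p" for p q by (auto simp: adjacent_def)
  consider "k < i" | "i < k" "k < j" | "j < k" using k by linarith
  then show ?thesis
  proof cases
    case 1
    then show ?thesis using spread[of k i j] D k nij sym[of k i] sym[of k j] by (metis (no_types))
  next
    case 2
    then show ?thesis using spread[of i k j] D k nij sym[of k j] by (metis (no_types))
  next
    case 3
    then show ?thesis using spread[of i j k] D k nij by (metis (no_types))
  qed
qed

text \<open>
  The leaves of a conflict are not adjacent.  A further sibling of them is therefore adjacent to one
  of them; if it has the other color, this is the one place where \<open>2\<^sub>a\<close> meets \<open>2\<^sub>b\<close>, which has no room for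
  two siblings of that color.
\<close>

lemma no_two_conflicts:
  assumes a: "conflict i j" "f i = TwoA" and b: "conflict k l" "f k = TwoB" and eq: "b i = b k"
  shows False
proof -
  note D = conflictD[OF a(1)] and D' = conflictD[OF b(1)]
  have col: "f j = TwoA" "f l = TwoB" using D D' a b by auto
  have "k \<noteq> i" "k \<noteq> j" "l \<noteq> i" "l \<noteq> j" using a b col by auto
  then have "adjacent n i k \<or> adjacent n j k" "adjacent n i l \<or> adjacent n j l"
    using touching[OF a(1)] D D' eq by auto
  then obtain p q where "p \<in> {i, j}" "q \<in> {i, j}" "adjacent n p k" "adjacent n q l" by auto
  then have "k = l"
    using one_contact[of p k q l] D D' col a(2) b(2) by auto
  then show False using D' by simp
qed

lemma one_conflict:
  assumes c: "conflict x y" and c': "conflict x' y'" and eq: "b x = b x'"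
  shows "x = x' \<and> y = y'"
proof (cases "f x = f x'")
  case True
  note D = conflictD[OF c] and D' = conflictD[OF c']
  have T: False if "p \<in> {x, y, x', y'}" "q \<in> {x, y, x', y'}" "r \<in> {x, y, x', y'}" "p < q" "q < r" for p q r
  proof -
    have "\<forall>s \<in> {x, y, x', y'}. 1 \<le> s \<and> s \<le> n \<and> b s = b x \<and> f s = f x"
      using D D' True eq by auto
    then show False
      using no_triple[of p q r] that D(8) by metis
  qed
  show ?thesis
  proof (rule ccontr)
    assume "\<not> ?thesis"
    then consider "x < x'" | "x' < x" | "x = x'" "y < y'" | "x = x'" "y' < y" by linarith
    then show False
    proof cases
      case 1 then show ?thesis using T[of x x' y'] D D' by simp
    next
      case 2 then show ?thesis using T[of x' x y] D D' by simp
    next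
      case 3 then show ?thesis using T[of x y y'] D D' by simp
    next
      case 4 then show ?thesis using T[of x y' y] D D' by simp
    qed
  qed
next
  case False
  then show ?thesis
    using c c' eq no_two_conflicts[of x y x' y'] no_two_conflicts[of x' y' x y]
    by (auto simp: sibling_conflict_def)
qed

text \<open>
  The leaf 2 and two conflicting siblings would be pairwise nonadjacent, since the lower one of a
  conflict is on an even position.
\<close>

lemma second_not_involved:
  assumes C: "f 2 = TwoC" and c: "conflict p q"
  shows "b p \<noteq> b 2"
proof
  assume eq: "b p = b 2"
  note D = conflictD[OF c]
  have "p \<noteq> 2" using D(6) C by auto
  then have p: "2 \<le> p" "even p" "p \<noteq> 2" using conflict_ge_2[OF c] conflict_even[OF c] by auto
  have "\<not> near n p q" using far[of p q] D by auto
  moreover have "p \<noteq> 3" using p by auto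
  ultimately show False
    using spread[of 2 p q] D p eq by (auto simp: adjacent_def near_def)
qed

text \<open>
  By noncrossing, \<open>q\<close> cannot lie between \<open>l\<close> and \<open>z\<close>; it is not \<open>l - 1\<close> either, because an odd position
  with a class \<open>2\<close> color does not precede an even one.
\<close>

lemma conflict_chain_end:
  assumes c: "conflict l z" and c': "conflict p q" and p: "p \<le> l - 2" "l - 2 < q"
  shows "z < q"
proof (rule ccontr)
  assume "\<not> z < q"
  note D = conflictD[OF c] and D' = conflictD[OF c']
  have l: "even l" "2 \<le> l" using conflict_even[OF c] conflict_ge_2[OF c] by auto
  then have "p < l" using p by linarith
  then have ne: "b p \<noteq> b l" using one_conflict[OF c' c] by auto
  then have "q \<noteq> z" "q \<noteq> l" using D D' by auto
  moreover have "q \<noteq> l - 1"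
  proof
    assume q: "q = l - 1"
    then have "odd q" "q < l" using l by auto
    then show False using no_even_after_odd[of q l] l D D' by auto
  qed
  ultimately have "l < q" "q < z" using p \<open>\<not> z < q\<close> by linarith+
  then show False
    using noncrossing[of p l q z] ne \<open>p < l\<close> D D' by auto
qed

end

text \<open>
  The initial leaves of color \<open>2\<^sub>c\<close> are assumed to have no conflict in their blocks and not to lie
  between the two leaves of a conflict.
\<close>

locale resolved = recolored n b f for n and b :: "nat \<Rightarrow> 'v" and f +
  fixes f' :: "nat \<Rightarrow> color"
  assumes resolves: "resolves n b f f'"
    and TwoC_apart: "\<lbrakk>f z = TwoC; conflict p q\<rbrakk> \<Longrightarrow> b p \<noteq> b z"
    and TwoC_outside: "\<lbrakk>conflict p q; p < z; z < q\<rbrakk> \<Longrightarrow> f z \<noteq> TwoC"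
begin

lemma kept: "\<lbrakk>1 \<le> k; k \<le> n; \<And>x y. conflict x y \<Longrightarrow> k \<noteq> x \<and> k \<noteq> y\<rbrakk> \<Longrightarrow> f' k = f k"
  using resolves unfolding resolves_def by blast

lemma chosen: "conflict x y \<Longrightarrow>
      (if (if x = 2 then f n else f' (x - 2)) = TwoC
       then f' x = f x \<and> f' y = TwoC
       else f' x = TwoC \<and> f' y = f y)"
  using resolves unfolding resolves_def by blast

text \<open>
  The reason for recoloring the upper leaf of a conflict rather than the lower leaf \<open>x\<close>.
\<close>

definition trigger :: "nat \<Rightarrow> bool" where
  "trigger x \<longleftrightarrow> (if x = 2 then f n else f' (x - 2)) = TwoC"

lemma chosen_upper: "conflict x y \<Longrightarrow> trigger x \<Longrightarrow> f' x = f x \<and> f' y = TwoC"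
  using chosen[of x y] by (simp add: trigger_def)

lemma chosen_lower: "conflict x y \<Longrightarrow> \<not> trigger x \<Longrightarrow> f' x = TwoC \<and> f' y = f y"
  using chosen[of x y] by (simp add: trigger_def)

lemma changed_to_TwoC: "1 \<le> k \<Longrightarrow> k \<le> n \<Longrightarrow> f' k = f k \<or> f' k = TwoC"
  using kept[of k] chosen_upper chosen_lower by blast

lemma TwoC_kept: "1 \<le> k \<Longrightarrow> k \<le> n \<Longrightarrow> f k = TwoC \<Longrightarrow> f' k = TwoC"
  using changed_to_TwoC by metis

lemma TwoC_cases:
  assumes "1 \<le> k" "k \<le> n" "f' k = TwoC"
  obtains "f k = TwoC"
  | (lower) y where "conflict k y" "\<not> trigger k"
  | (upper) x where "conflict x k" "trigger x"
proof (cases "\<exists>x y. conflict x y \<and> (k = x \<or> k = y)")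
  case True
  then show ?thesis
    using assms(3) chosen_upper chosen_lower conflictD(6,7) that(2,3) by metis
next
  case False
  then have "f' k = f k" using kept[OF assms(1,2)] by blast
  then show ?thesis using assms(3) that(1) by simp
qed

lemma TwoC_was_two:
  assumes "1 \<le> k" "k \<le> n" "f' k = TwoC"
  shows "is_two (f k)"
  using assms by (cases rule: TwoC_cases) (auto simp: is_two_iff dest: conflictD(8,9))

lemma kept_last:
  assumes "\<And>p q. conflict p q \<Longrightarrow> q \<noteq> n"
  shows "f' n = f n"
  using assms conflictD n_ge_3 by (intro kept) fastforce+

text \<open>
  If 4 is the lower leaf of a conflict, then the upper leaf is recolored, because 2 has color \<open>2\<^sub>c\<close>; and 4
  can be the upper leaf only of a conflict with 2.
\<close>

lemma fourth_not_TwoC: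
  assumes "f 2 = TwoC" "f 4 \<noteq> TwoC" "4 \<le> n"
  shows "f' 4 \<noteq> TwoC"
proof
  assume four: "f' 4 = TwoC"
  have "1 \<le> (4::nat)" "4 \<le> n" using assms(3) by simp_all
  then show False using four
  proof (cases rule: TwoC_cases)
    case 1
    then show False using assms by simp
  next
    case (lower y)
    then show False using TwoC_kept[of 2] assms by (simp add: trigger_def)
  next
    case (upper x)
    have "x = 2"
      using conflict_ge_2[OF upper(1)] conflict_even[OF upper(1)] conflictD(2)[OF upper(1)] by presburger
    then show False using conflictD(6)[OF upper(1)] assms by simp
  qed
qed

text \<open>
  Suppose that \<open>z\<close>, inside the interval from \<open>k\<close> to \<open>x\<close>, is recolored, although no conflict inside the
  interval spans the place after \<open>z\<close>.  Then \<open>z\<close> is the upper leaf of a conflict with some \<open>l\<close>, because a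
  lower leaf has its partner to the right.  So \<open>l - 2\<close> has color \<open>2\<^sub>c\<close>, and it satisfies the same
  hypotheses as \<open>z\<close>.  This chain of conflicts descends to the left, stays above \<open>k\<close> by noncrossing, and
  can only end in \<open>k\<close>, which is not recolored.
\<close>

lemma nested_not_TwoC:
  assumes kx: "1 \<le> k" "even k" "x \<le> n" "b k = b x" "f' k \<noteq> TwoC"
    and only: "\<And>p q. conflict p q \<Longrightarrow> b p = b k \<Longrightarrow> p = k \<and> q = x"
    and noC: "\<And>z. k < z \<Longrightarrow> z < x \<Longrightarrow> f z \<noteq> TwoC"
  shows "even z \<Longrightarrow> k \<le> z \<Longrightarrow> z < x \<Longrightarrow>
    (\<And>p q. conflict p q \<Longrightarrow> k < p \<Longrightarrow> p \<le> z \<Longrightarrow> z < q \<Longrightarrow> q < x \<Longrightarrow> False) \<Longrightarrow> f' z \<noteq> TwoC"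
proof (induction z rule: less_induct)
  case (less z)
  note clear = less.prems(4)
  show ?case
  proof
    assume C: "f' z = TwoC"
    then have "k < z" using kx less.prems by (cases "z = k") auto
    have "1 \<le> z" "z \<le> n" using kx less.prems by auto
    then show False using C
    proof (cases rule: TwoC_cases)
      case 1
      then show False using noC \<open>k < z\<close> less.prems by blast
    next
      case (lower q)
      note D = conflictD[OF lower(1)]
      have ne: "b z \<noteq> b k" using only[OF lower(1)] \<open>k < z\<close> by auto
      then have "q \<noteq> x" using D kx by auto
      moreover have "\<not> x < q"
        using noncrossing[of k z x q] ne D kx \<open>k < z\<close> less.prems by auto
      ultimately show False using clear[OF lower(1)] \<open>k < z\<close> D by simp
    next
      case (upper l)
      note D = conflictD[OF upper(1)]
      have ne: "b l \<noteq> b k" using only[OF upper(1)] less.prems by auto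
      then have "l \<noteq> k" by auto
      moreover have "\<not> l < k"
        using noncrossing[of l k z x] ne D kx \<open>k < z\<close> less.prems by auto
      ultimately have "k < l" by simp
      moreover have l: "even l" using conflict_even[OF upper(1)] .
      ultimately have kl: "k \<le> l - 2" "2 < l" using kx by (auto elim!: evenE)
      have "f' (l - 2) \<noteq> TwoC"
      proof (rule less.IH)
        show "l - 2 < z" "even (l - 2)" "k \<le> l - 2" "l - 2 < x"
          using D l kl less.prems by auto
        fix p q assume c: "conflict p q" and pq: "k < p" "p \<le> l - 2" "l - 2 < q" "q < x"
        have "z < q" using conflict_chain_end[OF upper(1) c pq(2,3)] .
        moreover have "p \<le> z" using pq(2) D(2) by linarith
        ultimately show False using clear[OF c] pq by simp
      qed
      then show False using upper(2) kl by (simp add: trigger_def)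
    qed
  qed
qed

text \<open>
  The same descent without an enclosing interval.  Here the chain of conflicts can only end in the leaf
  2, whose partner is recolored because the last leaf has color \<open>2\<^sub>c\<close>.  The conflicts of the chain cover
  all even positions up to \<open>z\<close>, so by noncrossing none of these is a sibling of the last leaf.
\<close>

lemma outermost_TwoC:
  assumes noC: "\<And>z. 1 \<le> z \<Longrightarrow> z < n \<Longrightarrow> f z \<noteq> TwoC"
  shows "even z \<Longrightarrow> 1 \<le> z \<Longrightarrow> z < n \<Longrightarrow>
    (\<And>p q. conflict p q \<Longrightarrow> p \<le> z \<Longrightarrow> z < q \<Longrightarrow> False) \<Longrightarrow> f' z = TwoC \<Longrightarrow>
    f n = TwoC \<and> (\<exists>q. conflict 2 q) \<and> (\<forall>x. even x \<longrightarrow> 1 \<le> x \<longrightarrow> x \<le> z \<longrightarrow> b x \<noteq> b n)"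
proof (induction z rule: less_induct)
  case (less z)
  note clear = less.prems(4)
  have "1 \<le> z" "z \<le> n" using less.prems by auto
  then show ?case using less.prems(5)
  proof (cases rule: TwoC_cases)
    case 1
    then show ?thesis using noC less.prems by blast
  next
    case (lower q)
    then show ?thesis using clear[OF lower(1)] conflictD[OF lower(1)] by simp
  next
    case (upper l)
    note D = conflictD[OF upper(1)]
    have l: "even l" "2 \<le> l" using conflict_even[OF upper(1)] conflict_ge_2[OF upper(1)] .
    have bl: "b l \<noteq> b n" if "f n = TwoC" using TwoC_apart[OF that upper(1)] .
    have inside: "b x \<noteq> b n" if "f n = TwoC" "l \<le> x" "x \<le> z" for x
      using noncrossing[of l x z n] that bl[OF that(1)] D less.prems
      by (cases "x = l \<or> x = z") auto
    show ?thesis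
    proof (cases "l = 2")
      case True
      then have fn: "f n = TwoC" using upper(2) by (simp add: trigger_def)
      moreover have "b x \<noteq> b n" if "even x" "1 \<le> x" "x \<le> z" for x
      proof -
        have "2 \<le> x" using that by (cases "x = 1") auto
        then show ?thesis using inside[OF fn] True that by simp
      qed
      ultimately show ?thesis using upper(1) True by auto
    next
      case False
      then have "2 < l" using l by simp
      have "f n = TwoC \<and> (\<exists>q. conflict 2 q) \<and> (\<forall>x. even x \<longrightarrow> 1 \<le> x \<longrightarrow> x \<le> l - 2 \<longrightarrow> b x \<noteq> b n)"
      proof (rule less.IH)
        show "l - 2 < z" "even (l - 2)" "1 \<le> l - 2" "l - 2 < n"
          using D l \<open>2 < l\<close> by auto
        show "f' (l - 2) = TwoC" using upper(2) False by (simp add: trigger_def)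
        fix p q assume c: "conflict p q" and pq: "p \<le> l - 2" "l - 2 < q"
        have "z < q" using conflict_chain_end[OF upper(1) c pq] .
        moreover have "p \<le> z" using pq(1) D(2) by linarith
        ultimately show False using clear[OF c] by simp
      qed
      moreover have "x \<le> l - 2 \<or> l \<le> x" if "even x" for x :: nat
        using that l(1) by presburger
      ultimately show ?thesis using inside by metis
    qed
  qed
qed

text \<open>
  Two conflicts whose upper leaves are close are nested.  If both upper leaves were recolored, the
  chain that starts with the inner conflict would end in the lower leaf \<open>k\<close> of the outer one.
\<close>

lemma uppers_apart:
  assumes c: "conflict l y" "trigger l" and c': "conflict k x" "trigger k" and yx: "y < x" "x \<le> y + 2"
  shows False
proof -
  note D = conflictD[OF c(1)] and D' = conflictD[OF c'(1)]
  have ne: "b l \<noteq> b k" using one_conflict[OF c(1) c'(1)] yx by auto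
  have ev: "even l" "even k" using conflict_even c c' by auto
  have "k < l"
  proof (rule ccontr)
    assume "\<not> k < l"
    then have "l < k" using ne by (metis linorder_neqE_nat)
    moreover have "k \<noteq> y" using ne D by auto
    moreover have "\<not> k < y"
      using noncrossing[of l k y x] ne \<open>l < k\<close> D D' yx by auto
    ultimately have "k = y + 1" using D' yx by simp
    then show False using no_even_after_odd[of y k] D D' ev by auto
  qed
  then have l: "k \<le> l - 2" "2 < l" using ev D' by (auto elim!: evenE)
  have "f' (l - 2) \<noteq> TwoC"
  proof (rule nested_not_TwoC[of k x])
    show "1 \<le> k" "even k" "x \<le> n" "b k = b x" "even (l - 2)" "k \<le> l - 2" "l - 2 < x"
      using D D' ev l yx by auto
    show "f' k \<noteq> TwoC" using chosen_upper[OF c'] D' by simp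
    show "p = k \<and> q = x" if "conflict p q" "b p = b k" for p q
      using one_conflict[OF that(1) c'(1) that(2)] .
    show "f z \<noteq> TwoC" if "k < z" "z < x" for z
      using TwoC_outside[OF c'(1) that] .
    fix p q assume cc: "conflict p q" and pq: "k < p" "p \<le> l - 2" "l - 2 < q" "q < x"
    have "y < q" using conflict_chain_end[OF c(1) cc pq(2,3)] .
    then have "q = y + 1" "x = y + 2" using pq yx by auto
    then show False using no_three[of y] D D' conflictD[OF cc] by auto
  qed
  then show False using c(2) l by (simp add: trigger_def)
qed

lemma chosen_apart:
  assumes ij: "1 \<le> i" "i < j" "j \<le> i + 2" "j \<le> n"
    and C: "f' i = TwoC" "f i \<noteq> TwoC" "f' j = TwoC" "f j \<noteq> TwoC"
  shows False
proof -
  have i: "1 \<le> i" "i \<le> n" and j: "1 \<le> j" "j \<le> n" using ij by auto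
  show False using j C(3)
  proof (cases rule: TwoC_cases)
    case 1
    then show False using C by simp
  next
    case (lower y)
    note D = conflictD[OF lower(1)]
    have ev: "even j" using conflict_even[OF lower(1)] .
    have "is_two (f i)" using TwoC_was_two i C(1) .
    then have "even i" using no_even_after_odd[of i j] ij ev D by auto
    then have "j = i + 2" using ij ev by presburger
    then show False using lower(2) C ij by (simp add: trigger_def)
  next
    case (upper l)
    note D = conflictD[OF upper(1)]
    show False using i C(1)
    proof (cases rule: TwoC_cases)
      case 1
      then show False using C by simp
    next
      case (upper k)
      then show False using uppers_apart \<open>conflict l j\<close> \<open>trigger l\<close> ij by blast
    next
      case (lower q)
      note D' = conflictD[OF lower(1)]
      have ev: "even i" "even l" using conflict_even lower upper by auto
      have "l \<noteq> i" using lower(2) upper(2) by auto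
      then have ne: "b i \<noteq> b l" using one_conflict[OF lower(1) upper(1)] by auto
      then have "q \<noteq> j" using D D' by auto
      have "\<not> i < l"
      proof
        assume "i < l"
        then have "l = i + 1" using D ij by linarith
        then show False using ev by simp
      qed
      then have "l < i" using \<open>l \<noteq> i\<close> by simp
      then have "\<not> j < q"
        using noncrossing[of l i j q] ne D D' ij by auto
      then have "q = i + 1" "j = i + 2" using D' ij \<open>q \<noteq> j\<close> by linarith+
      then show False using no_three[of i] D D' ij by auto
    qed
  qed
qed

lemma chosen_not_1: "f' 1 = TwoC \<Longrightarrow> f 1 = TwoC"
proof (rule ccontr)
  assume a: "f' 1 = TwoC" "f 1 \<noteq> TwoC"
  have "(1::nat) \<le> 1" "1 \<le> n" using n_ge_3 by auto
  then show False using a(1)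
    by (cases rule: TwoC_cases) (use a(2) conflict_even conflictD conflict_ge_2 in fastforce)+
qed

text \<open>
  A recolored last leaf is the upper leaf of an outermost conflict, so its chain would end in the leaf 2
  and require the last leaf to have had color \<open>2\<^sub>c\<close> from the start.
\<close>

lemma chosen_apart_cyclic:
  assumes "f' 2 = TwoC" "f 2 \<noteq> TwoC" "f' n = TwoC" "f n \<noteq> TwoC"
    and noC: "\<And>z. 1 \<le> z \<Longrightarrow> z < n \<Longrightarrow> f z \<noteq> TwoC"
  shows False
proof -
  have "1 \<le> n" "n \<le> n" using n_ge_3 by auto
  then show False using assms(3)
  proof (cases rule: TwoC_cases)
    case 1
    then show False using assms by simp
  next
    case (lower y)
    then show False using conflictD[OF lower(1)] by simp
  next
    case (upper l)
    note D = conflictD[OF upper(1)]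
    have l: "even l" "2 \<le> l" using conflict_even[OF upper(1)] conflict_ge_2[OF upper(1)] .
    have "l \<noteq> 2" using upper(2) assms by (auto simp: trigger_def)
    then have "2 < l" using l by simp
    have "f n = TwoC \<and> (\<exists>q. conflict 2 q) \<and> (\<forall>x. even x \<longrightarrow> 1 \<le> x \<longrightarrow> x \<le> l - 2 \<longrightarrow> b x \<noteq> b n)"
    proof (rule outermost_TwoC)
      show "even (l - 2)" "1 \<le> l - 2" "l - 2 < n" using l D \<open>2 < l\<close> by auto
      show "f' (l - 2) = TwoC" using upper(2) \<open>l \<noteq> 2\<close> by (simp add: trigger_def)
      fix p q assume c: "conflict p q" "p \<le> l - 2" "l - 2 < q"
      show False using conflict_chain_end[OF upper(1) c] conflictD[OF c(1)] by simp
    qed (use noC in blast)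
    then show False using assms by simp
  qed
qed

text \<open>
  Leaves of color \<open>2\<^sub>a\<close> or \<open>2\<^sub>b\<close> cause no problem: if they are siblings, they were in conflict.  For the
  color \<open>2\<^sub>c\<close>, new leaves are far from each other by the chain arguments; the cases of RECOLORING differ
  only in the distance between new leaves and the initial ones.
\<close>

lemma separated:
  assumes apart: "\<And>i j. \<lbrakk>1 \<le> i; i < j; j \<le> n; f i = TwoC; f j = TwoC\<rbrakk> \<Longrightarrow> b i \<noteq> b j"
    and old_new: "\<And>i j. \<lbrakk>1 \<le> i; i < j; j \<le> n; near n i j; f' i = TwoC; f' j = TwoC\<rbrakk>
      \<Longrightarrow> f i = TwoC \<longleftrightarrow> f j = TwoC"
    and cyc: "\<And>z. f 2 \<noteq> TwoC \<Longrightarrow> f n \<noteq> TwoC \<Longrightarrow> 1 \<le> z \<Longrightarrow> z < n \<Longrightarrow> f z \<noteq> TwoC"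
  shows "spaced n b f'"
  unfolding spaced_def
proof (intro allI impI, rule ccontr)
  fix i j assume ij: "1 \<le> i" "i < j" "j \<le> n" "f' i = f' j" "is_two (f' i)"
    and "\<not> (\<not> near n i j \<and> b i \<noteq> b j)"
  then have nb: "near n i j \<or> b i = b j" by auto
  show False
  proof (cases "f' i = TwoC")
    case False
    then have "f i = f' i" "f j = f' i"
      using changed_to_TwoC[of i] changed_to_TwoC[of j] ij by auto
    then have "\<not> near n i j" using far[of i j] ij by auto
    then have "conflict i j"
      using ij nb False \<open>f i = f' i\<close> \<open>f j = f' i\<close> by (auto simp: sibling_conflict_def is_two_iff)
    then show False using chosen_upper chosen_lower False ij by metis
  next
    case True
    then have C: "f' i = TwoC" "f' j = TwoC" using ij by auto
    have i: "1 \<le> i" "i \<le> n" and j: "1 \<le> j" "j \<le> n" using ij by auto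
    have new: "\<exists>x y. conflict x y \<and> b x = b k \<and> (k = x \<and> \<not> trigger x \<or> k = y \<and> trigger x)"
      if "f' k = TwoC" "f k \<noteq> TwoC" "1 \<le> k" "k \<le> n" for k
      using that(3,4,1)
      by (cases rule: TwoC_cases) (use that conflictD in metis)+
    show False
    proof (cases "f i = TwoC \<or> f j = TwoC")
      case True
      show False
      proof (cases "f i = TwoC \<and> f j = TwoC")
        case True
        then show False using apart[of i j] far[of i j] ij nb by (auto simp: is_two_iff)
      next
        case False
        then have "b i = b j" using old_new[of i j] ij nb C True by blast
        moreover obtain k k' where k: "k \<in> {i, j}" "k' \<in> {i, j}" "f k = TwoC" "f k' \<noteq> TwoC"
          using True False by auto
        moreover have "\<exists>x y. conflict x y \<and> b x = b k'"
          using new[of k'] k C i j by auto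
        ultimately show False
          using TwoC_apart[of k] by auto
      qed
    next
      case False
      obtain x y where c: "conflict x y" "b x = b i" "i = x \<and> \<not> trigger x \<or> i = y \<and> trigger x"
        using new[of i] C i False by auto
      obtain x' y' where c': "conflict x' y'" "b x' = b j" "j = x' \<and> \<not> trigger x' \<or> j = y' \<and> trigger x'"
        using new[of j] C j False by auto
      have "b i \<noteq> b j"
      proof
        assume "b i = b j"
        then have "x = x'" "y = y'" using one_conflict[OF c(1) c'(1)] c c' by auto
        then show False using c c' ij by auto
      qed
      then have "near n i j" using nb by simp
      moreover have "\<not> j \<le> i + 2" using chosen_apart[of i j] ij C False by auto
      moreover have "i \<noteq> 1" using chosen_not_1 C False by auto
      ultimately have "i = 2" "j = n" using ij by (auto simp: near_def)
      then have ends: "f' 2 = TwoC" "f 2 \<noteq> TwoC" "f' n = TwoC" "f n \<noteq> TwoC"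
        using C False by auto
      show False
        by (rule chosen_apart_cyclic[OF ends]) (rule cyc[OF ends(2,4)])
    qed
  qed
qed

end


context recolored
begin

lemma spaced_without_TwoC:
  assumes res: "resolves n b f g" and no: "\<And>z. f z \<noteq> TwoC"
  shows "spaced n b g"
proof -
  interpret resolved n b f g
    by unfold_locales (simp_all add: res no)
  show ?thesis
    by (rule separated) (simp_all add: no)
qed

text \<open>
  CASE-2 without modifications, when the last leaf has color \<open>2\<^sub>c\<close>.  The hypotheses \<open>no_i\<close> and \<open>no_ii\<close> say
  that neither modification applies.  A new leaf of color \<open>2\<^sub>c\<close> near the last one would be the end of a chain
  that starts with a conflict of the leaf 2, and no sibling of the last leaf would have color \<open>2\<^sub>a\<close> or
  \<open>2\<^sub>b\<close>: exactly the situation in which modification (ii) applies.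
\<close>

lemma spaced_TwoC_last:
  assumes res: "resolves n b f g" and C: "\<And>z. f z = TwoC \<longleftrightarrow> z = n"
    and evens: "\<And>k. 1 \<le> k \<Longrightarrow> k < n \<Longrightarrow> is_two (f k) \<Longrightarrow> even k"
    and cols: "f (n - 1) \<noteq> TwoA" "f 2 \<noteq> TwoB"
    and no_i: "\<not> (\<exists>i \<in> {1..<n - 1}. f (n - 1) = TwoB \<and> f i = TwoB \<and> b n = b (n - 1) \<and> b (n - 1) = b i)"
    and no_ii: "\<not> ((\<forall>i \<in> {1..<n}. \<not> ((f i = TwoA \<or> f i = TwoB) \<and> b i = b n)) \<and>
                 (\<exists>i \<in> {4..<n}. f i = TwoA \<and> b i = b 2))"
  shows "spaced n b g"
proof -
  have unpaired: "q < n" if "conflict p q" for p q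
    using conflictD(3,7)[OF that] C by (metis le_neq_implies_less)
  have apart: "b p \<noteq> b n" if c: "conflict p q" for p q
  proof
    assume eq: "b p = b n"
    note D = conflictD[OF c]
    have q: "q < n" using unpaired[OF c] .
    have "2 \<le> p" using conflict_ge_2[OF c] .
    have "\<not> near n p q" using far[of p q] D by auto
    then have "n = q + 1"
      using spread[of p q n] D q eq \<open>2 \<le> p\<close> by (auto simp: adjacent_def near_def)
    moreover from this have "f q = TwoB"
      using c cols by (auto simp: sibling_conflict_def)
    ultimately show False
      using no_i D eq q by (auto simp: Bex_def)
  qed
  interpret resolved n b f g
  proof unfold_locales
    show "b p \<noteq> b z" if "f z = TwoC" "conflict p q" for p q z
      using that C apart by auto
    show "f z \<noteq> TwoC" if c: "conflict p q" "p < z" "z < q" for p q z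
      using C c unpaired[OF c(1)] by auto
  qed (rule res)
  have new: "g j = TwoC \<Longrightarrow> 1 \<le> j \<Longrightarrow> j < n \<Longrightarrow> near n j n \<Longrightarrow> False" for j
  proof -
    assume j: "g j = TwoC" "1 \<le> j" "j < n" "near n j n"
    have "1 \<le> j" "j \<le> n" using j by auto
    then have is_two: "is_two (f j)" and j2: "j \<noteq> 2"
      using j(1)
      by (cases rule: TwoC_cases; use j C conflictD(1,2,8,9) conflict_ge_2 in \<open>fastforce simp: trigger_def\<close>)+
    then have ev: "even j" using evens j by blast
    then have jn: "n \<le> j + 2" using j j2 by (auto simp: near_def elim!: evenE)
    have clear: False if c: "conflict p q" and "p \<le> j" "j < q" for p q
    proof -
      have "q = j + 1" "n = j + 2" using unpaired[OF c] that jn by linarith+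
      then show False using no_three[of j] is_two j conflictD[OF c] C[of n] by (auto simp: is_two_iff)
    qed
    have "f n = TwoC \<and> (\<exists>q. conflict 2 q) \<and> (\<forall>x. even x \<longrightarrow> 1 \<le> x \<longrightarrow> x \<le> j \<longrightarrow> b x \<noteq> b n)"
      by (rule outermost_TwoC) (use C j ev clear in auto)
    then obtain q where q: "conflict 2 q" and no: "\<And>x. even x \<Longrightarrow> 1 \<le> x \<Longrightarrow> x \<le> j \<Longrightarrow> b x \<noteq> b n"
      by blast
    have "\<not> near n 2 q" using far[of 2 q] conflictD[OF q] by auto
    then have "4 \<le> q" by (auto simp: near_def)
    then have "\<exists>i \<in> {4..<n}. f i = TwoA \<and> b i = b 2"
      using unpaired[OF q] q cols by (intro bexI[of _ q]) (auto simp: sibling_conflict_def)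
    then obtain i where i: "1 \<le> i" "i < n" "f i = TwoA \<or> f i = TwoB" "b i = b n"
      using no_ii by auto
    then have "is_two (f i)" by (auto simp: is_two_iff)
    then have "even i" using evens i by blast
    then have "j < i" using no i by (meson not_less)
    then have "i = j + 1" using jn i by linarith
    then show False using ev \<open>even i\<close> by simp
  qed
  show ?thesis
  proof (rule separated)
    fix u v assume uv: "1 \<le> u" "u < v" "v \<le> n" "near n u v" "g u = TwoC" "g v = TwoC"
    show "f u = TwoC \<longleftrightarrow> f v = TwoC"
      using C[of u] C[of v] uv new[of u] by (cases "v = n") auto
  qed (use C in auto)
qed

text \<open>
  CASE-2 after modification (i), whose witness is the leaf \<open>i\<close>.  The only leaf that could be recolored
  too close to the leaf \<open>n - 1\<close> is \<open>n - 3\<close>.  The chain leading to it would be enclosed in the interval from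
  \<open>i\<close> to \<open>n - 1\<close>, whose ends are siblings and not in any conflict.
\<close>

lemma spaced_TwoC_second_and_last_but_one:
  assumes res: "resolves n b f g" and C: "\<And>z. f z = TwoC \<longleftrightarrow> z = 2 \<or> z = n - 1"
    and evens: "\<And>k. 1 \<le> k \<Longrightarrow> k < n \<Longrightarrow> is_two (f k) \<Longrightarrow> even k"
    and n: "odd n" "9 \<le> n" and cols: "f n = TwoA" "f (n - 3) \<noteq> TwoB"
    and i: "1 \<le> i" "i < n - 1" "f i = TwoB" "b n = b (n - 1)" "b (n - 1) = b i"
  shows "spaced n b g"
proof -
  have evi: "even i" using evens[of i] i by (auto simp: is_two_iff)
  have i_less: "i < n - 3"
  proof -
    have "i \<noteq> n - 3" using i cols by auto
    moreover have "i \<noteq> n - 2" using evi n by auto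
    ultimately show ?thesis using i by linarith
  qed
  have apart1: "b p \<noteq> b (n - 1)" if c: "conflict p q" for p q
  proof
    assume eq: "b p = b (n - 1)"
    note D = conflictD[OF c]
    have p: "2 \<le> p" "even p" using conflict_ge_2[OF c] conflict_even[OF c] by auto
    have nn: "\<not> near n p q" using far[of p q] D by auto
    have q1: "q \<noteq> n - 1" using D C by auto
    show False
    proof (cases "q = n")
      case True
      have "p \<noteq> i" using i D cols True by auto
      have pn: "p \<noteq> n - 1" "p < n" using D C[of p] True by auto
      show False
      proof (cases "p < i")
        case True
        moreover have "i \<noteq> Suc p" "i < n" "n \<noteq> Suc i" using p evi i_less by auto
        ultimately show False
          using spread[of p i n] i i_less D p evi eq by (auto simp: adjacent_def)
      next
        case False
        then have "i < p" using \<open>p \<noteq> i\<close> by simp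
        moreover have "p \<noteq> Suc i" using p evi by auto
        ultimately show False
          using spread[of i p n] i i_less D p evi eq pn \<open>q = n\<close> by (auto simp: adjacent_def)
      qed
    next
      case False
      then have q: "q < n - 1" using D q1 by linarith
      then have "even q" using evens[of q] D by auto
      then have "q \<noteq> n - 2" using n by auto
      then show False
        using spread[of p q "n - 1"] D p q nn eq by (auto simp: adjacent_def near_def)
    qed
  qed
  have unpaired: "q \<noteq> n" if "conflict p q" for p q
    using apart1[OF that] conflictD[OF that] i by auto
  interpret resolved n b f g
  proof unfold_locales
    show "b p \<noteq> b z" if "f z = TwoC" "conflict p q" for p q z
      using that C apart1 second_not_involved by auto
    show "f z \<noteq> TwoC" if c: "conflict p q" "p < z" "z < q" for p q z
    proof
      assume "f z = TwoC"
      then have "z = n - 1" using C c conflict_ge_2[OF c(1)] by auto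
      then show False using c conflictD(3)[OF c(1)] unpaired[OF c(1)] by linarith
    qed
  qed (rule res)
  have gn: "g n \<noteq> TwoC" using kept_last[OF unpaired] cols by simp
  have g4: "g 4 \<noteq> TwoC" using fourth_not_TwoC C n by auto
  have even_new: "even j" if "g j = TwoC" "1 \<le> j" "j < n" for j
    using evens TwoC_was_two that by simp
  have gn3: "g (n - 3) \<noteq> TwoC"
  proof
    assume g: "g (n - 3) = TwoC"
    have "1 \<le> n - 3" "n - 3 \<le> n" using n by auto
    then show False using g
    proof (cases rule: TwoC_cases)
      case 1
      then show False using C n by auto
    next
      case (lower q)
      note D = conflictD[OF lower(1)]
      have "q \<noteq> n - 1" using D C by auto
      moreover have "q \<noteq> n - 2" using evens[of q] D n by auto
      ultimately show False using unpaired[OF lower(1)] D by linarith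
    next
      case (upper l)
      note D = conflictD[OF upper(1)]
      have ne: "b l \<noteq> b i" using apart1[OF upper(1)] i by simp
      have "n - 3 < n - 1" "n - 1 \<le> n" using n by auto
      then have "\<not> l < i"
        using noncrossing[of l i "n - 3" "n - 1"] D(1,4) ne i(5) i_less by auto
      then have "i < l" using ne by (metis linorder_neqE_nat)
      moreover have ev: "even l" using conflict_even[OF upper(1)] .
      ultimately have l: "i \<le> l - 2" "2 < l" using i evi by (auto elim!: evenE)
      have "g (l - 2) \<noteq> TwoC"
      proof (rule nested_not_TwoC[of i "n - 1"])
        show "1 \<le> i" "even i" "n - 1 \<le> n" "b i = b (n - 1)" "even (l - 2)" "i \<le> l - 2" "l - 2 < n - 1"
          using i evi ev l D by auto
        have "g i = f i"
          using apart1 conflictD(4) i by (intro kept) fastforce+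
        then show "g i \<noteq> TwoC" using i by simp
        show "p = i \<and> q = n - 1" if "conflict p q" "b p = b i" for p q
          using apart1[OF that(1)] that i by simp
        show "f z \<noteq> TwoC" if "i < z" "z < n - 1" for z
          using C that i evi by (cases "i = 1") auto
        fix p q assume cc: "conflict p q" and pq: "i < p" "p \<le> l - 2" "l - 2 < q" "q < n - 1"
        have "n - 3 < q" using conflict_chain_end[OF upper(1) cc pq(2,3)] .
        then have "q = n - 2" using pq by linarith
        then show False using evens[of q] conflictD[OF cc] n by auto
      qed
      then show False using upper(2) l by (simp add: trigger_def)
    qed
  qed
  have apart: "b 2 \<noteq> b (n - 1)"
  proof
    assume eq: "b 2 = b (n - 1)"
    have "2 \<le> i" using i evi by (cases "i = 1") auto
    moreover have "i \<noteq> 2" using C[of i] i by auto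
    moreover have "i \<noteq> 3" using evi by auto
    ultimately show False
      using spread[of 2 i "n - 1"] eq i i_less n by (auto simp: adjacent_def)
  qed
  show ?thesis
  proof (rule separated)
    show "b u \<noteq> b v" if "1 \<le> u" "u < v" "v \<le> n" "f u = TwoC" "f v = TwoC" for u v
      using that C apart n by auto
    show "f z \<noteq> TwoC" if "f 2 \<noteq> TwoC" for z
      using that C by simp
    fix u v assume uv: "1 \<le> u" "u < v" "v \<le> n" "near n u v" "g u = TwoC" "g v = TwoC"
    have v: "v < n" using uv gn by (metis le_neq_implies_less)
    then have ev: "even u" "even v" using even_new uv by auto
    then have "2 \<le> u" using uv by (cases "u = 1") auto
    then have "v = u + 2" using ev uv v by (auto simp: near_def elim!: evenE)
    have "u \<noteq> 2" using g4 uv \<open>v = u + 2\<close> by auto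
    moreover have "u \<noteq> n - 1" "v \<noteq> 2" using uv v \<open>v = u + 2\<close> by linarith+
    moreover have "v \<noteq> n - 1"
    proof
      assume "v = n - 1"
      then have "u = n - 3" using \<open>v = u + 2\<close> by linarith
      then show False using gn3 uv by simp
    qed
    ultimately show "f u = TwoC \<longleftrightarrow> f v = TwoC"
      using C[of u] C[of v] by blast
  qed
qed

text \<open>
  CASE-2 after modification (ii).  The last leaf has no sibling of its new color \<open>2\<^sub>a\<close>, so it is not in a
  conflict, and the leaves near 2 keep away from \<open>2\<^sub>c\<close>.
\<close>

lemma spaced_TwoC_second:
  assumes res: "resolves n b f g" and C: "\<And>z. f z = TwoC \<longleftrightarrow> z = 2"
    and evens: "\<And>k. 1 \<le> k \<Longrightarrow> k < n \<Longrightarrow> is_two (f k) \<Longrightarrow> even k"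
    and n: "6 \<le> n" and cols: "f n = TwoA"
    and alone: "\<And>i. 1 \<le> i \<Longrightarrow> i < n \<Longrightarrow> f i = TwoA \<Longrightarrow> b i \<noteq> b n"
  shows "spaced n b g"
proof -
  have unpaired: "q \<noteq> n" if "conflict p q" for p q
    using conflictD[OF that] alone[of p] cols by auto
  interpret resolved n b f g
  proof unfold_locales
    show "b p \<noteq> b z" if "f z = TwoC" "conflict p q" for p q z
      using that C second_not_involved by auto
    show "f z \<noteq> TwoC" if c: "conflict p q" "p < z" "z < q" for p q z
      using C c conflict_ge_2[OF c(1)] by auto
  qed (rule res)
  have gn: "g n \<noteq> TwoC" using kept_last[OF unpaired] cols by simp
  have g4: "g 4 \<noteq> TwoC" using fourth_not_TwoC C n by auto
  have even_new: "even j" if "g j = TwoC" "1 \<le> j" "j < n" for j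
    using evens TwoC_was_two that by simp
  show ?thesis
  proof (rule separated)
    show "b u \<noteq> b v" if "1 \<le> u" "u < v" "v \<le> n" "f u = TwoC" "f v = TwoC" for u v
      using that C by auto
    show "f z \<noteq> TwoC" if "f 2 \<noteq> TwoC" for z
      using that C by simp
    fix u v assume uv: "1 \<le> u" "u < v" "v \<le> n" "near n u v" "g u = TwoC" "g v = TwoC"
    have v: "v < n" using uv gn by (metis le_neq_implies_less)
    then have ev: "even u" "even v" using even_new uv by auto
    then have "2 \<le> u" using uv by (cases "u = 1") auto
    then have "v = u + 2" using ev uv v by (auto simp: near_def elim!: evenE)
    then show "f u = TwoC \<longleftrightarrow> f v = TwoC"
      using C uv g4 n v by auto
  qed
qed

end

section \<open>The recoloring patterns\<close>

text \<open>
  The colors of the blocks of four leaves; \<open>c k\<close> is the class of the parent of the leaf \<open>k\<close>.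
\<close>

definition alternating :: "(nat \<Rightarrow> color) \<Rightarrow> nat \<Rightarrow> color" where
  "alternating c k = (if odd k then other (c k) else if k mod 4 = 2 then TwoA else TwoB)"

text \<open>
  The coloring after CASE-1.  The exceptional last leaves in the cases \<open>n mod 4 = 1\<close> and \<open>n mod 4 = 3\<close>
  happen to follow the alternating pattern.
\<close>

definition pattern_1 :: "(nat \<Rightarrow> color) \<Rightarrow> nat \<Rightarrow> nat \<Rightarrow> color" where
  "pattern_1 c n k =
     (if n mod 4 = 2 \<and> k = n - 1 then TwoA
      else if n mod 4 = 2 \<and> k = n then other (c n)
      else alternating c k)"

text \<open>
  The coloring after CASE-2, before the modifications.
\<close>

definition pattern_2 :: "(nat \<Rightarrow> color) \<Rightarrow> nat \<Rightarrow> nat \<Rightarrow> color" where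
  "pattern_2 c n k =
     (if (n mod 4 = 1 \<or> n mod 4 = 2) \<and> k = n then TwoC
      else if n mod 4 = 3 \<and> k = n - 2 then TwoA
      else if n mod 4 = 3 \<and> k = n - 1 then other (c k)
      else if n mod 4 = 3 \<and> k = n then TwoB
      else alternating c k)"

lemma other_neq [simp]: "other x \<noteq> TwoA" "other x \<noteq> TwoB" "other x \<noteq> TwoC"
  "TwoA \<noteq> other x" "TwoB \<noteq> other x" "TwoC \<noteq> other x"
  by (auto simp: other_def)

lemma alternating_colors:
  "alternating c k = TwoA \<longleftrightarrow> k mod 4 = 2"
  "alternating c k = TwoB \<longleftrightarrow> k mod 4 = 0"
  "alternating c k \<noteq> TwoC"
proof -
  have "even k \<Longrightarrow> k mod 4 \<noteq> 2 \<longleftrightarrow> k mod 4 = 0" "k mod 4 = 2 \<Longrightarrow> even k" "k mod 4 = 0 \<Longrightarrow> even k"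
    by presburger+
  then show "alternating c k = TwoA \<longleftrightarrow> k mod 4 = 2" "alternating c k = TwoB \<longleftrightarrow> k mod 4 = 0"
    "alternating c k \<noteq> TwoC"
    by (auto simp: alternating_def)
qed

lemma pattern_1_colors:
  "pattern_1 c n k = TwoA \<longleftrightarrow>
     (if n mod 4 = 2 \<and> k = n - 1 then True else if n mod 4 = 2 \<and> k = n then False else k mod 4 = 2)"
  "pattern_1 c n k = TwoB \<longleftrightarrow>
     (if n mod 4 = 2 \<and> k = n - 1 then False else if n mod 4 = 2 \<and> k = n then False else k mod 4 = 0)"
  "pattern_1 c n k \<noteq> TwoC"
  by (simp_all add: pattern_1_def alternating_colors)

lemma pattern_2_colors:
  "pattern_2 c n k = TwoA \<longleftrightarrow>
     (if (n mod 4 = 1 \<or> n mod 4 = 2) \<and> k = n then False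
      else if n mod 4 = 3 \<and> k = n - 2 then True
      else if n mod 4 = 3 \<and> k = n - 1 then False
      else if n mod 4 = 3 \<and> k = n then False else k mod 4 = 2)"
  "pattern_2 c n k = TwoB \<longleftrightarrow>
     (if (n mod 4 = 1 \<or> n mod 4 = 2) \<and> k = n then False
      else if n mod 4 = 3 \<and> k = n - 2 then False
      else if n mod 4 = 3 \<and> k = n - 1 then False
      else if n mod 4 = 3 \<and> k = n then True else k mod 4 = 0)"
  "pattern_2 c n k = TwoC \<longleftrightarrow> (n mod 4 = 1 \<or> n mod 4 = 2) \<and> k = n"
  by (auto simp add: pattern_2_def alternating_colors)

lemma near_cases:
  assumes "near n i j" "1 \<le> i" "i < j" "j \<le> n"
  obtains "j = i + 1" | "j = i + 2" | "i = 2" "j = n" | "i = 1" "j = n" | "i = 1" "j = n - 1"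
  using assms unfolding near_def by linarith


lemma size_cases: 
  assumes "3 \<le> (n::nat)" obtains m where "n = Suc (Suc (Suc m))"
  using assms that[of "n - 3"] by linarith

lemma mod_4_cases: "(m::nat) mod 4 = 0 \<or> m mod 4 = 1 \<or> m mod 4 = 2 \<or> m mod 4 = 3"
  by presburger

lemma pattern_1_odd:
  assumes "1 \<le> i" "i \<le> n" "odd i" "is_two (pattern_1 c n i)"
  shows "n mod 4 = 2 \<and> i = n - 1"
proof -
  have "i mod 4 \<noteq> 2" "i mod 4 \<noteq> 0" using assms(3) by presburger+
  then show ?thesis using assms(4) by (auto simp: is_two_iff pattern_1_colors split: if_splits)
qed

text \<open>
  Odd positions of class \<open>2\<close> are so close to the end of the cycle that the conditions on them can be
  checked one by one.
\<close>

lemma (in leaf_blocks) recoloredI: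
  assumes far: "\<And>i j. \<lbrakk>near n i j; 1 \<le> i; i < j; j \<le> n; is_two (f i)\<rbrakk> \<Longrightarrow> f i \<noteq> f j"
    and odd: "\<And>i. \<lbrakk>1 \<le> i; i \<le> n; odd i; is_two (f i)\<rbrakk> \<Longrightarrow>
      i = n \<or> i = n - 1 \<and> \<not> is_two (f n) \<or> i = n - 2 \<and> \<not> is_two (f (n - 1)) \<and> f n \<noteq> f (n - 2)"
    and contact: "\<And>i j. \<lbrakk>1 \<le> i; i \<le> n; 1 \<le> j; j \<le> n; adjacent n i j; f i = TwoA; f j = TwoB\<rbrakk>
      \<Longrightarrow> j = j0"
  shows "recolored n b f"
proof unfold_locales
  fix i j assume *: "1 \<le> i" "i < j" "j \<le> n"
  show "f i \<noteq> f j" if "near n i j" "is_two (f i)"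
    using far[OF that(1) * that(2)] .
  have last: "i = n - 1 \<and> j = n \<and> \<not> is_two (f n) \<or>
      i = n - 2 \<and> (j = n - 1 \<or> j = n) \<and> \<not> is_two (f (n - 1)) \<and> f n \<noteq> f (n - 2)"
    if "odd i" "is_two (f i)"
    using odd[of i] that * by linarith
  show "f i \<noteq> f j" if "odd i" "is_two (f i)"
    using last[OF that] that by auto
  show "\<not> is_two (f j)" if "odd i" "even j" "is_two (f i)"
    using last[OF that(1,3)] that * by auto
next
  fix i j i' j' assume "i \<in> {1..n}" "j \<in> {1..n}" "i' \<in> {1..n}" "j' \<in> {1..n}"
    "adjacent n i j" "adjacent n i' j'" "f i = TwoA" "f i' = TwoA" "f j = TwoB" "f j' = TwoB"
  then show "j = j'" using contact[of i j] contact[of i' j'] by simp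
next
  fix i assume *: "1 \<le> i" "i + 2 \<le> n" "is_two (f i)" "is_two (f (i + 1))"
  show "\<not> is_two (f (i + 2))"
  proof (cases "odd i")
    case True
    then consider "i = n - 2" "\<not> is_two (f (n - 1))" using odd[of i] * by linarith
    then show ?thesis using * by cases (simp add: Suc_diff_Suc numeral_2_eq_2)
  next
    case False
    then have "i + 1 = n - 1 \<and> \<not> is_two (f n) \<or> i + 1 = n - 2 \<and> \<not> is_two (f (n - 1))"
      using odd[of "i + 1"] * by auto
    moreover have "i + 2 = n" if "i + 1 = n - 1" using that * by linarith
    moreover have "i + 2 = n - 1" if "i + 1 = n - 2" using that * by linarith
    ultimately show ?thesis by metis
  qed
qed

lemma (in leaf_blocks) recolored_pattern_1: "recolored n b (pattern_1 c n)"
proof -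
  obtain m where n: "n = Suc (Suc (Suc m))" using n_ge_3 by (rule size_cases)
  show ?thesis
  proof (rule recoloredI)
    show "pattern_1 c n i \<noteq> pattern_1 c n j"
      if *: "near n i j" "1 \<le> i" "i < j" "j \<le> n" "is_two (pattern_1 c n i)" for i j
    proof -
      have "\<not> (pattern_1 c n i = TwoA \<and> pattern_1 c n j = TwoA)"
        "\<not> (pattern_1 c n i = TwoB \<and> pattern_1 c n j = TwoB)"
        using *(1-4)
        by (cases rule: near_cases; use *(3,4) n in \<open>auto simp: pattern_1_colors mod_Suc split: if_splits\<close>)+
      then show ?thesis using *(5) pattern_1_colors(3) by (metis is_two_iff)
    qed
    show "i = n \<or> i = n - 1 \<and> \<not> is_two (pattern_1 c n n) \<or>
        i = n - 2 \<and> \<not> is_two (pattern_1 c n (n - 1)) \<and> pattern_1 c n n \<noteq> pattern_1 c n (n - 2)"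
      if "1 \<le> i" "i \<le> n" "odd i" "is_two (pattern_1 c n i)" for i
      using pattern_1_odd[OF that] n_ge_3 by (simp add: pattern_1_def is_two_iff)
    show "j = n - 2"
      if "1 \<le> i" "i \<le> n" "1 \<le> j" "j \<le> n" "adjacent n i j"
        "pattern_1 c n i = TwoA" "pattern_1 c n j = TwoB" for i j
      using that unfolding adjacent_def n
      by (auto simp: pattern_1_colors mod_Suc split: if_splits del: mod_0_imp_dvd)
  qed
qed

lemma odd_mod_4: "odd i \<Longrightarrow> i mod 4 \<noteq> 2 \<and> i mod 4 \<noteq> (0::nat)"
  by presburger

lemma pattern_2_odd:
  assumes "1 \<le> i" "i \<le> n" "odd i" "is_two (pattern_2 c n i)"
  shows "i = n \<or> n mod 4 = 3 \<and> i = n - 2"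
  using odd_mod_4[OF assms(3)] assms(4) by (auto simp: is_two_iff pattern_2_colors split: if_splits)

lemma (in leaf_blocks) recolored_pattern_2: "recolored n b (pattern_2 c n)"
proof -
  obtain m where n: "n = Suc (Suc (Suc m))" using n_ge_3 by (rule size_cases)
  show ?thesis
  proof (rule recoloredI)
    show "pattern_2 c n i \<noteq> pattern_2 c n j"
      if *: "near n i j" "1 \<le> i" "i < j" "j \<le> n" "is_two (pattern_2 c n i)" for i j
    proof -
      have "\<not> (pattern_2 c n i = TwoA \<and> pattern_2 c n j = TwoA)"
        "\<not> (pattern_2 c n i = TwoB \<and> pattern_2 c n j = TwoB)"
        "\<not> (pattern_2 c n i = TwoC \<and> pattern_2 c n j = TwoC)"
        using *(1-4)
        by (cases rule: near_cases; use mod_4_cases[of m] in \<open>elim disjE\<close>; use *(3,4) n in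
          \<open>auto simp: pattern_2_colors mod_Suc split: if_splits del: mod_0_imp_dvd\<close>)+
      then show ?thesis using *(5) by (metis is_two_iff)
    qed
    show "i = n \<or> i = n - 1 \<and> \<not> is_two (pattern_2 c n n) \<or>
        i = n - 2 \<and> \<not> is_two (pattern_2 c n (n - 1)) \<and> pattern_2 c n n \<noteq> pattern_2 c n (n - 2)"
      if i: "1 \<le> i" "i \<le> n" "odd i" "is_two (pattern_2 c n i)" for i
    proof -
      consider "i = n" | "n mod 4 = 3" "i = n - 2" using pattern_2_odd[OF i] by blast
      then show ?thesis by cases (simp_all add: n pattern_2_def is_two_iff)
    qed
    show "j = (if n = 3 then 3 else n - 3)"
      if *: "1 \<le> i" "i \<le> n" "1 \<le> j" "j \<le> n" "adjacent n i j"
        "pattern_2 c n i = TwoA" "pattern_2 c n j = TwoB" for i j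
      using *(5) mod_4_cases[of m] unfolding adjacent_def n
      by (elim disjE; use *(1-4,6,7) in
        \<open>auto simp: n pattern_2_colors mod_Suc split: if_splits del: mod_0_imp_dvd\<close>)
  qed
qed

text \<open>
  The colorings after the modifications (i) and (ii).
\<close>

definition pattern_2_i :: "(nat \<Rightarrow> color) \<Rightarrow> nat \<Rightarrow> nat \<Rightarrow> color" where
  "pattern_2_i c n = (pattern_2 c n)(2 := TwoC, n - 1 := TwoC, n := TwoA)"

definition pattern_2_ii :: "(nat \<Rightarrow> color) \<Rightarrow> nat \<Rightarrow> nat \<Rightarrow> color" where
  "pattern_2_ii c n = (pattern_2 c n)(2 := TwoC, n := TwoA)"

lemma pattern_2_i_colors:
  assumes "n mod 4 = 1" "9 \<le> n"
  shows "pattern_2_i c n k = TwoA \<longleftrightarrow> k = n \<or> k mod 4 = 2 \<and> k \<noteq> 2"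
    "pattern_2_i c n k = TwoB \<longleftrightarrow> k mod 4 = 0 \<and> k \<noteq> n - 1"
    "pattern_2_i c n k = TwoC \<longleftrightarrow> k = 2 \<or> k = n - 1"
proof -
  have "n = 4 * (n div 4) + 1" using assms(1) by (metis mult_div_mod_eq)
  then have "(n - 1) mod 4 = 0" by (metis add_diff_cancel_right' mod_mult_self1_is_0)
  then show "pattern_2_i c n k = TwoA \<longleftrightarrow> k = n \<or> k mod 4 = 2 \<and> k \<noteq> 2"
    "pattern_2_i c n k = TwoB \<longleftrightarrow> k mod 4 = 0 \<and> k \<noteq> n - 1"
    "pattern_2_i c n k = TwoC \<longleftrightarrow> k = 2 \<or> k = n - 1"
    using assms by (auto simp: pattern_2_i_def pattern_2_colors)
qed

lemma pattern_2_ii_colors: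
  assumes "n mod 4 = 1 \<or> n mod 4 = 2" "6 \<le> n"
  shows "pattern_2_ii c n k = TwoA \<longleftrightarrow> k = n \<or> k mod 4 = 2 \<and> k \<noteq> 2"
    "pattern_2_ii c n k = TwoB \<longleftrightarrow> k mod 4 = 0"
    "pattern_2_ii c n k = TwoC \<longleftrightarrow> k = 2"
  using assms by (auto simp: pattern_2_ii_def pattern_2_colors)

lemma (in leaf_blocks) recolored_pattern_2_i:
  assumes n4: "n mod 4 = 1" and n9: "9 \<le> n"
  shows "recolored n b (pattern_2_i c n)"
proof (rule recoloredI)
  let ?f = "pattern_2_i c n"
  note colors = pattern_2_i_colors[OF assms]
  have "odd n" using n4 by presburger
  show "?f i \<noteq> ?f j" if "near n i j" "1 \<le> i" "i < j" "j \<le> n" "is_two (?f i)" for i j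
  proof -
    have "False" if "?f i = TwoA" "?f j = TwoA"
    proof -
      have i: "i mod 4 = 2" "i \<noteq> 2" "j = n \<or> j mod 4 = 2"
        using that \<open>i < j\<close> \<open>j \<le> n\<close> unfolding colors by auto
      show False
        using \<open>near n i j\<close> \<open>1 \<le> i\<close> \<open>i < j\<close> \<open>j \<le> n\<close>
        by (cases rule: near_cases; use i n4 in \<open>auto simp: mod_Suc\<close>)
    qed
    moreover have "False" if "?f i = TwoB" "?f j = TwoB"
    proof -
      have i: "i mod 4 = 0" "j mod 4 = 0"
        using that unfolding colors by auto
      show False
        using \<open>near n i j\<close> \<open>1 \<le> i\<close> \<open>i < j\<close> \<open>j \<le> n\<close>
        by (cases rule: near_cases; use i in \<open>auto simp: mod_Suc del: mod_0_imp_dvd\<close>)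
    qed
    moreover have "False" if "?f i = TwoC" "?f j = TwoC"
      using that \<open>near n i j\<close> \<open>i < j\<close> \<open>j \<le> n\<close> n9 unfolding colors near_def by auto
    ultimately show ?thesis using that(5) by (metis is_two_iff)
  qed
  show "i = n \<or> i = n - 1 \<and> \<not> is_two (?f n) \<or> i = n - 2 \<and> \<not> is_two (?f (n - 1)) \<and> ?f n \<noteq> ?f (n - 2)"
    if "1 \<le> i" "i \<le> n" "odd i" "is_two (?f i)" for i
    using that(4) odd_mod_4[OF that(3)] that(3) \<open>odd n\<close> n9 unfolding is_two_iff colors by auto
  show "j = 0"
    if "1 \<le> i" "i \<le> n" "1 \<le> j" "j \<le> n" "adjacent n i j" "?f i = TwoA" "?f j = TwoB" for i j
  proof -
    have "even j" "j \<noteq> n - 1" using that(7) unfolding colors by presburger+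
    moreover have "even i \<or> i = n" using that(6) unfolding colors by presburger
    ultimately show ?thesis
      using that(5) \<open>odd n\<close> that(1-4) by (auto simp: adjacent_def)
  qed
qed

lemma (in leaf_blocks) recolored_pattern_2_ii:
  assumes n4: "n mod 4 = 1 \<or> n mod 4 = 2" and n6: "6 \<le> n"
  shows "recolored n b (pattern_2_ii c n)"
proof (rule recoloredI)
  let ?f = "pattern_2_ii c n"
  note colors = pattern_2_ii_colors[OF assms]
  show "?f i \<noteq> ?f j" if "near n i j" "1 \<le> i" "i < j" "j \<le> n" "is_two (?f i)" for i j
  proof -
    have "False" if "?f i = TwoA" "?f j = TwoA"
    proof -
      have i: "i mod 4 = 2" "i \<noteq> 2" "j = n \<or> j mod 4 = 2"
        using that \<open>i < j\<close> \<open>j \<le> n\<close> unfolding colors by auto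
      show False
        using \<open>near n i j\<close> \<open>1 \<le> i\<close> \<open>i < j\<close> \<open>j \<le> n\<close>
        by (cases rule: near_cases; use i n4 in \<open>auto simp: mod_Suc\<close>)
    qed
    moreover have "False" if "?f i = TwoB" "?f j = TwoB"
    proof -
      have i: "i mod 4 = 0" "j mod 4 = 0"
        using that unfolding colors by auto
      show False
        using \<open>near n i j\<close> \<open>1 \<le> i\<close> \<open>i < j\<close> \<open>j \<le> n\<close>
        by (cases rule: near_cases; use i in \<open>auto simp: mod_Suc del: mod_0_imp_dvd\<close>)
    qed
    moreover have "False" if "?f i = TwoC" "?f j = TwoC"
      using that \<open>near n i j\<close> \<open>i < j\<close> \<open>j \<le> n\<close> n6 unfolding colors near_def by auto
    ultimately show ?thesis using that(5) by (metis is_two_iff)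
  qed
  show "i = n \<or> i = n - 1 \<and> \<not> is_two (?f n) \<or> i = n - 2 \<and> \<not> is_two (?f (n - 1)) \<and> ?f n \<noteq> ?f (n - 2)"
    if "1 \<le> i" "i \<le> n" "odd i" "is_two (?f i)" for i
    using that(4) odd_mod_4[OF that(3)] that(3) unfolding is_two_iff colors by auto
  show "j = n - 1"
    if "1 \<le> i" "i \<le> n" "1 \<le> j" "j \<le> n" "adjacent n i j" "?f i = TwoA" "?f j = TwoB" for i j
  proof -
    have "even j" "j \<noteq> n" using that(7) n4 unfolding colors by auto
    moreover have "even i \<or> i = n" using that(6) unfolding colors by presburger
    ultimately show ?thesis
      using that(5) that(1-4) by (auto simp: adjacent_def)
  qed
qed


text \<open>
  The final coloring restricted to the leaves: classes \<open>2\<close> are spaced, and the other leaves have the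
  class that their parent does not have, which differs for adjacent leaves.
\<close>

definition proper_around :: "nat \<Rightarrow> (nat \<Rightarrow> 'v) \<Rightarrow> (nat \<Rightarrow> color) \<Rightarrow> (nat \<Rightarrow> color) \<Rightarrow> bool" where
  "proper_around n b c g \<longleftrightarrow> spaced n b g \<and>
     (\<forall>k. 1 \<le> k \<longrightarrow> k \<le> n \<longrightarrow> \<not> is_two (g k) \<longrightarrow> g k = other (c k)) \<and>
     (\<forall>i j. 1 \<le> i \<longrightarrow> i < j \<longrightarrow> j \<le> n \<longrightarrow> adjacent n i j \<longrightarrow> \<not> is_two (g i) \<longrightarrow> \<not> is_two (g j) \<longrightarrow> c i \<noteq> c j)"

text \<open>
  The conditions under which the modifications (i) and (ii) are made.
\<close>

definition swap_last :: "nat \<Rightarrow> (nat \<Rightarrow> 'v) \<Rightarrow> (nat \<Rightarrow> color) \<Rightarrow> bool" where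
  "swap_last n b f \<longleftrightarrow> f n = TwoC \<and>
     (\<exists>i \<in> {1..<n - 1}. f (n - 1) = TwoB \<and> f i = TwoB \<and> b n = b (n - 1) \<and> b (n - 1) = b i)"

definition swap_second :: "nat \<Rightarrow> (nat \<Rightarrow> 'v) \<Rightarrow> (nat \<Rightarrow> color) \<Rightarrow> bool" where
  "swap_second n b f \<longleftrightarrow> f n = TwoC \<and>
     (\<forall>i \<in> {1..<n}. \<not> ((f i = TwoA \<or> f i = TwoB) \<and> b i = b n)) \<and>
     (\<exists>i \<in> {4..<n}. f i = TwoA \<and> b i = b 2)"

definition case_2_pattern :: "nat \<Rightarrow> (nat \<Rightarrow> 'v) \<Rightarrow> (nat \<Rightarrow> color) \<Rightarrow> nat \<Rightarrow> color" where
  "case_2_pattern n b c =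
    (if swap_last n b (pattern_2 c n) then pattern_2_i c n
     else if swap_second n b (pattern_2 c n) then pattern_2_ii c n
     else pattern_2 c n)"

lemma resolves_keeps_ones:
  assumes "resolves n b f g" "1 \<le> k" "k \<le> n" "\<not> is_two (g k)"
  shows "g k = f k"
proof -
  have "f k = TwoA \<or> f k = TwoB \<or> g k = f k"
    using assms unfolding resolves_def sibling_conflict_def by metis
  moreover have "g k = f k \<or> g k = TwoC"
    using assms unfolding resolves_def by metis
  ultimately show ?thesis using assms(4) by (auto simp: is_two_iff)
qed

lemma pattern_1_one:
  assumes "\<not> is_two (pattern_1 c n k)"
  shows "pattern_1 c n k = other (c k)" "even k \<Longrightarrow> n mod 4 = 2 \<and> k = n" "\<not> (n mod 4 = 2 \<and> k = n - 1)"
  using assms by (auto simp: is_two_iff pattern_1_def alternating_def split: if_splits)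

lemma pattern_2_one:
  assumes "\<not> is_two (pattern_2 c n k)"
  shows "pattern_2 c n k = other (c k)" "even k \<Longrightarrow> n mod 4 = 3 \<and> k = n - 1"
    "n mod 4 = 3 \<Longrightarrow> k \<noteq> n - 2" "k \<noteq> n"
proof -
  have 1: "even n \<Longrightarrow> pattern_2 c n n = other (c n) \<Longrightarrow> False"
    by (auto simp: pattern_2_def alternating_def split: if_splits)
  have 2: "odd n \<Longrightarrow> n mod 4 = 1 \<or> n mod 4 = 3" by presburger
  show "pattern_2 c n k = other (c k)" "even k \<Longrightarrow> n mod 4 = 3 \<and> k = n - 1"
    "n mod 4 = 3 \<Longrightarrow> k \<noteq> n - 2"
    using assms by (auto simp: is_two_iff pattern_2_def alternating_def split: if_splits)
  moreover have "n mod 4 = 3 \<Longrightarrow> n \<noteq> n - 1" by (cases n) auto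
  ultimately show "k \<noteq> n"
    using assms 1 2 by (cases "even n") (auto simp: is_two_iff pattern_2_def)
qed

context leaf_blocks
begin

text \<open>
  Only the first and the last leaf can be adjacent without a class \<open>2\<close> color; CASE-1 starts the numbering
  where their parents have different classes.
\<close>

lemma proper_around_pattern_1:
  assumes res: "resolves n b (pattern_1 c n) g" and c: "c 1 \<noteq> c n"
  shows "proper_around n b c g"
  unfolding proper_around_def
proof (intro conjI allI impI)
  interpret recolored n b "pattern_1 c n" by (rule recolored_pattern_1)
  show "spaced n b g"
    by (rule spaced_without_TwoC[OF res]) (rule pattern_1_colors)
  have one: "\<not> is_two (pattern_1 c n k)" if "1 \<le> k" "k \<le> n" "\<not> is_two (g k)" for k
    using resolves_keeps_ones[OF res that] that by simp
  show "g k = other (c k)" if "1 \<le> k" "k \<le> n" "\<not> is_two (g k)" for k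
    using resolves_keeps_ones[OF res that] pattern_1_one(1)[OF one[OF that]] by simp
  fix i j assume ij: "1 \<le> i" "i < j" "j \<le> n" "adjacent n i j" "\<not> is_two (g i)" "\<not> is_two (g j)"
  then have ones: "\<not> is_two (pattern_1 c n i)" "\<not> is_two (pattern_1 c n j)" using one by auto
  show "c i \<noteq> c j"
  proof (cases "i = 1 \<and> j = n")
    case False
    then have j: "j = Suc i" using ij by (auto simp: adjacent_def)
    then have "n mod 4 = 2 \<and> i = n \<or> n mod 4 = 2 \<and> j = n"
      using pattern_1_one(2)[OF ones(1)] pattern_1_one(2)[OF ones(2)] by (cases "even i") auto
    then have "n mod 4 = 2 \<and> i = n - 1" using j ij by auto
    then show ?thesis using pattern_1_one(3)[OF ones(1)] by simp
  qed (use c in simp)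
qed

text \<open>
  In CASE-2 no two adjacent leaves are without a class \<open>2\<close> color, so the equal classes of all parents do
  no harm.
\<close>

lemma proper_around_pattern_2I:
  assumes res: "resolves n b f g" and sp: "spaced n b g"
    and f: "\<And>k. \<not> is_two (f k) \<Longrightarrow> f k = pattern_2 c n k"
  shows "proper_around n b c g"
  unfolding proper_around_def
proof (intro conjI allI impI)
  have one: "\<not> is_two (pattern_2 c n k)" "g k = pattern_2 c n k" if "1 \<le> k" "k \<le> n" "\<not> is_two (g k)" for k
    using resolves_keeps_ones[OF res that] that f[of k] by auto
  show "g k = other (c k)" if "1 \<le> k" "k \<le> n" "\<not> is_two (g k)" for k
    using one[OF that] pattern_2_one(1) by metis
  fix i j assume ij: "1 \<le> i" "i < j" "j \<le> n" "adjacent n i j" "\<not> is_two (g i)" "\<not> is_two (g j)"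
  then have ones: "\<not> is_two (pattern_2 c n i)" "\<not> is_two (pattern_2 c n j)" using one by auto
  have "j \<noteq> n" using pattern_2_one(4)[OF ones(2)] .
  then have j: "j = Suc i" using ij by (auto simp: adjacent_def)
  then have "n mod 4 = 3 \<and> (i = n - 1 \<or> j = n - 1)"
    using pattern_2_one(2)[OF ones(1)] pattern_2_one(2)[OF ones(2)] by (cases "even i") auto
  then have "n mod 4 = 3" "i = n - 2" using j ij \<open>j \<noteq> n\<close> by auto
  then show "c i \<noteq> c j" using pattern_2_one(3)[OF ones(1)] by simp
qed (rule sp)

text \<open>
  The witness \<open>i\<close> and \<open>n - 1\<close> have color \<open>2\<^sub>b\<close>, so both are multiples of 4.
\<close>

lemma swap_last_size:
  assumes "swap_last n b (pattern_2 c n)"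
  shows "n mod 4 = 1" "9 \<le> n"
proof -
  let ?p = "pattern_2 c n"
  obtain i where i: "1 \<le> i" "i < n - 1" "?p (n - 1) = TwoB" "?p i = TwoB" and "?p n = TwoC"
    using assms by (auto simp: swap_last_def)
  have r: "n mod 4 = 1 \<or> n mod 4 = 2" using \<open>?p n = TwoC\<close> by (simp add: pattern_2_colors)
  have "(n - 1) mod 4 = 0" "i mod 4 = 0"
    using i(3,4) i(2) r n_ge_3 by (auto simp: pattern_2_colors split: if_splits)
  then have "4 dvd n - 1" "4 dvd i" by auto
  then obtain p q where pq: "n - 1 = 4 * p" "i = 4 * q" by (auto elim!: dvdE)
  moreover have "1 \<le> q" "q < p" using i(1,2) pq by auto
  ultimately have "n = 4 * p + 1" "2 \<le> p" using n_ge_3 by linarith+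
  then show "n mod 4 = 1" "9 \<le> n" by auto
qed

lemma swap_second_size:
  assumes "swap_second n b (pattern_2 c n)"
  shows "n mod 4 = 1 \<or> n mod 4 = 2" "6 \<le> n"
proof -
  let ?p = "pattern_2 c n"
  obtain i where i: "4 \<le> i" "i < n" "?p i = TwoA" and "?p n = TwoC"
    using assms by (auto simp: swap_second_def)
  show r: "n mod 4 = 1 \<or> n mod 4 = 2" using \<open>?p n = TwoC\<close> by (simp add: pattern_2_colors)
  have "i mod 4 = 2" using i r by (auto simp: pattern_2_colors split: if_splits)
  then have "i \<noteq> 4" "i \<noteq> 5" by auto
  then show "6 \<le> n" using i by linarith
qed

lemma recolored_case_2: "recolored n b (case_2_pattern n b c)"
  unfolding case_2_pattern_def
  using recolored_pattern_2_i[OF swap_last_size] recolored_pattern_2_ii[OF swap_second_size]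
    recolored_pattern_2 by simp

lemma proper_around_pattern_2:
  assumes res: "resolves n b (case_2_pattern n b c) g" (is "resolves n b ?f g")
  shows "proper_around n b c g"
proof (rule proper_around_pattern_2I[OF res])
  let ?p = "pattern_2 c n"
  show "?f k = ?p k" if "\<not> is_two (?f k)" for k
    using that by (auto simp: case_2_pattern_def pattern_2_i_def pattern_2_ii_def is_two_iff split: if_splits)
  show "spaced n b g"
  proof (cases "swap_last n b ?p")
    case True
    then obtain i where i: "1 \<le> i" "i < n - 1" "?p i = TwoB" "b n = b (n - 1)" "b (n - 1) = b i"
      by (auto simp: swap_last_def)
    note n = swap_last_size[OF True]
    obtain p where p: "n = 4 * p + 1" using n(1) by (metis mult_div_mod_eq)
    have "odd n" "even (n - 1)" using p by auto
    have "i mod 4 = 0" using i(2,3) n(1) by (auto simp: pattern_2_colors split: if_splits)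
    note colors = pattern_2_i_colors[OF n(1,2)]
    interpret recolored n b "pattern_2_i c n" by (rule recolored_pattern_2_i[OF n(1,2)])
    show ?thesis
    proof (rule spaced_TwoC_second_and_last_but_one[where i = i])
      show "resolves n b (pattern_2_i c n) g" using res True by (simp add: case_2_pattern_def)
      show "pattern_2_i c n z = TwoC \<longleftrightarrow> z = 2 \<or> z = n - 1" for z by (rule colors)
      show "even k" if "1 \<le> k" "k < n" "is_two (pattern_2_i c n k)" for k
        using that(2,3) odd_mod_4[of k] \<open>even (n - 1)\<close> unfolding is_two_iff colors by auto
      show "pattern_2_i c n n = TwoA" unfolding colors by simp
      have "n - 3 = 4 * (p - 1) + 2" using p n(2) by linarith
      then have "(n - 3) mod 4 = 2" by (simp add: mod_Suc)
      then show "pattern_2_i c n (n - 3) \<noteq> TwoB" unfolding colors by simp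
      show "pattern_2_i c n i = TwoB" unfolding colors using i(2) \<open>i mod 4 = 0\<close> by auto
    qed (use i n \<open>odd n\<close> in auto)
  next
    case nl: False
    show ?thesis
    proof (cases "swap_second n b ?p")
      case True
      have alone: "b i \<noteq> b n" if "1 \<le> i" "i < n" "?p i = TwoA" for i
        using True that by (auto simp: swap_second_def)
      note r = swap_second_size(1)[OF True] and n = swap_second_size(2)[OF True]
      note colors = pattern_2_ii_colors[OF r n]
      interpret recolored n b "pattern_2_ii c n" by (rule recolored_pattern_2_ii[OF r n])
      show ?thesis
      proof (rule spaced_TwoC_second)
        show "resolves n b (pattern_2_ii c n) g" using res True nl by (simp add: case_2_pattern_def)
        show "pattern_2_ii c n z = TwoC \<longleftrightarrow> z = 2" for z by (rule colors)
        show "even k" if "1 \<le> k" "k < n" "is_two (pattern_2_ii c n k)" for k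
          using that(2,3) odd_mod_4[of k] unfolding is_two_iff colors by auto
        show "pattern_2_ii c n n = TwoA" unfolding colors by simp
        show "b i \<noteq> b n" if "1 \<le> i" "i < n" "pattern_2_ii c n i = TwoA" for i
        proof (rule alone)
          show "?p i = TwoA"
            using that r unfolding colors by (auto simp: pattern_2_colors)
        qed (use that in auto)
      qed (use n in auto)
    next
      case False
      then have res: "resolves n b ?p g" using res nl by (simp add: case_2_pattern_def)
      interpret recolored n b ?p by (rule recolored_pattern_2)
      show ?thesis
      proof (cases "?p n = TwoC")
        case True
        then have r: "n mod 4 = 1 \<or> n mod 4 = 2" by (simp add: pattern_2_colors)
        show ?thesis
        proof (rule spaced_TwoC_last[OF res])
          show "?p z = TwoC \<longleftrightarrow> z = n" for z using r by (auto simp: pattern_2_colors)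
          show "even k" if "1 \<le> k" "k < n" "is_two (?p k)" for k
          proof (rule ccontr)
            assume "odd k"
            then show False using pattern_2_odd[of k n c] that r by auto
          qed
          have "(n - 1) mod 4 \<noteq> 2"
          proof
            assume "(n - 1) mod 4 = 2"
            moreover obtain m where "n = Suc m" using n_ge_3 by (cases n) auto
            ultimately have "n mod 4 = 3" by (simp add: mod_Suc)
            then show False using r by simp
          qed
          then show "?p (n - 1) \<noteq> TwoA" using r n_ge_3 by (auto simp: pattern_2_colors)
          show "?p 2 \<noteq> TwoB" using r by (auto simp: pattern_2_colors)
          show "\<not> (\<exists>i \<in> {1..<n - 1}. ?p (n - 1) = TwoB \<and> ?p i = TwoB \<and> b n = b (n - 1) \<and> b (n - 1) = b i)"
            using nl True by (auto simp: swap_last_def)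
          show "\<not> ((\<forall>i \<in> {1..<n}. \<not> ((?p i = TwoA \<or> ?p i = TwoB) \<and> b i = b n)) \<and>
                 (\<exists>i \<in> {4..<n}. ?p i = TwoA \<and> b i = b 2))"
            using False True by (auto simp: swap_second_def)
        qed
      next
        case False
        then have "?p z \<noteq> TwoC" for z by (auto simp: pattern_2_colors)
        then show ?thesis by (rule spaced_without_TwoC[OF res])
      qed
    qed
  qed
qed

end

section \<open>Results and costs of computations\<close>

text \<open>
  A Hoare triple with a time bound: the result satisfies \<open>Q\<close> and at most \<open>c\<close> steps are made.
\<close>

definition runs :: "'a tm \<Rightarrow> nat \<Rightarrow> ('a \<Rightarrow> bool) \<Rightarrow> bool" where
  "runs m c Q \<longleftrightarrow> Q (fst m) \<and> snd m \<le> c"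

lemma tm_simps [simp]:
  "fst (return x) = x" "snd (return x) = 0"
  "fst (op x) = x" "snd (op x) = 1"
  "fst (rd A i) = A i" "snd (rd A i) = 1"
  "fst (wr A i x) = A(i := x)" "snd (wr A i x) = 1"
  "fst (new_array k x) = (\<lambda>_. x)" "snd (new_array k x) = k + 1"
  "fst (bind_tm m f) = fst (f (fst m))" "snd (bind_tm m f) = snd m + snd (f (fst m))"
  by (simp_all add: return_def op_def rd_def wr_def new_array_def bind_tm_def split: prod.splits)

lemma test_simps [simp]:
  "fst (test c m m') = (if c then fst m else fst m')"
  "snd (test c m m') = Suc (if c then snd m else snd m')"
  by (simp_all add: test_def)

lemma runsI: "Q (fst m) \<Longrightarrow> snd m \<le> c \<Longrightarrow> runs m c Q"
  by (simp add: runs_def)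

lemma runs_bind:
  assumes "runs m c P" "\<And>x. P x \<Longrightarrow> runs (f x) d Q" "c + d \<le> e"
  shows "runs (bind_tm m f) e Q"
proof -
  have "runs (f (fst m)) d Q" "snd m \<le> c" using assms by (simp_all add: runs_def)
  then show ?thesis using assms(3) by (auto simp: runs_def)
qed

lemma runs_step:
  "snd m \<le> c \<Longrightarrow> runs (f (fst m)) d Q \<Longrightarrow> c + d \<le> e \<Longrightarrow> runs (bind_tm m f) e Q"
  by (auto simp: runs_def)

lemma runs_test:
  assumes "b \<Longrightarrow> runs m c Q" "\<not> b \<Longrightarrow> runs m' c Q" "c + 1 \<le> e"
  shows "runs (test b m m') e Q"
  using assms by (auto simp: runs_def)

lemma runs_weaken: "runs m c P \<Longrightarrow> (\<And>x. P x \<Longrightarrow> Q x) \<Longrightarrow> c \<le> d \<Longrightarrow> runs m d Q"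
  by (auto simp: runs_def)

text \<open>
  The invariant refers to the part of the list that has been processed.
\<close>

lemma runs_for_each:
  assumes "I [] s"
    and "\<And>xs x ys s. zs = xs @ x # ys \<Longrightarrow> I xs s \<Longrightarrow> runs (f x s) c (I (xs @ [x]))"
  shows "runs (for_each zs f s) ((c + 1) * length zs + 1) (I zs)"
proof -
  have "runs (for_each ys f s) ((c + 1) * length ys + 1) (I zs)" if "zs = xs @ ys" "I xs s" for xs ys s
    using that
  proof (induction ys arbitrary: xs s)
    case (Cons y ys)
    have "runs (f y s) c (I (xs @ [y]))" using assms(2) Cons.prems by blast
    then have "runs (for_each ys f (fst (f y s))) ((c + 1) * length ys + 1) (I zs)" "snd (f y s) \<le> c"
      using Cons.IH[of "xs @ [y]"] Cons.prems by (simp_all add: runs_def)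
    then show ?case by (simp add: runs_def)
  qed (simp add: runs_def)
  from this[of "[]" zs s] show ?thesis using assms(1) by simp
qed

lemma runs_for_each_upt:
  assumes "I l s" "l \<le> u"
    and "\<And>k s. l \<le> k \<Longrightarrow> k < u \<Longrightarrow> I k s \<Longrightarrow> runs (f k s) c (I (Suc k))"
  shows "runs (for_each [l..<u] f s) ((c + 1) * (u - l) + 1) (I u)"
proof -
  have "runs (for_each [l..<u] f s) ((c + 1) * length [l..<u] + 1) ((\<lambda>xs. I (l + length xs)) [l..<u])"
  proof (rule runs_for_each)
    fix xs x ys s assume eq: "[l..<u] = xs @ x # ys" and I: "I (l + length xs) s"
    have "length xs < u - l"
      using arg_cong[OF eq, of length] by simp
    moreover have "[l..<u] ! length xs = x" by (simp only: eq nth_append_length)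
    ultimately have "x = l + length xs" "x < u" by auto
    then show "runs (f x s) c (\<lambda>s. I (l + length (xs @ [x])) s)"
      using assms(3)[of x s] I by simp
  qed (use assms in simp)
  then show ?thesis using assms(2) by simp
qed

lemma first_such_find:
  "(\<And>x. x \<in> set xs \<Longrightarrow> fst (p x) = P x) \<Longrightarrow> fst (first_such xs p) = find P xs"
  by (induction xs) auto

lemma snd_first_such:
  "(\<And>x. x \<in> set xs \<Longrightarrow> snd (p x) \<le> c) \<Longrightarrow> snd (first_such xs p) \<le> (c + 1) * length xs + 1"
proof (induction xs)
  case (Cons x xs)
  have "snd (p x) \<le> c" "snd (first_such xs p) \<le> (c + 1) * length xs + 1"
    using Cons by auto
  then show ?case by auto
qed auto

lemma runs_first_such:
  assumes "\<And>x. x \<in> set xs \<Longrightarrow> fst (p x) = P x" "\<And>x. x \<in> set xs \<Longrightarrow> snd (p x) \<le> c"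
    "(c + 1) * length xs + 1 \<le> d"
  shows "runs (first_such xs p) d (\<lambda>res. res = find P xs)"
proof (rule runsI)
  show "fst (first_such xs p) = find P xs" by (rule first_such_find) (rule assms(1))
  have "snd (first_such xs p) \<le> (c + 1) * length xs + 1" by (rule snd_first_such) (rule assms(2))
  then show "snd (first_such xs p) \<le> d" using assms(3) by simp
qed

lemma find_None_upt: "find P [l..<u] = None \<longleftrightarrow> \<not> (\<exists>i \<in> {l..<u}. P i)"
  by (auto simp: find_None_iff)

lemma find_SomeD: "find P xs = Some x \<Longrightarrow> x \<in> set xs \<and> P x"
  by (induction xs) (auto split: if_splits)

lemma color_of_simps [simp]:
  "fst (color_of a \<phi> k) = the (\<phi> (a k))" "snd (color_of a \<phi> k) = 3"
  by (simp_all add: color_of_def)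

lemma paint_simps [simp]:
  "fst (paint a k x \<phi>) = \<phi>(a k := Some x)" "snd (paint a k x \<phi>) = 2"
  by (simp_all add: paint_def)

lemma paint_one_simps [simp]:
  "fst (paint_one a b k \<phi>) = \<phi>(a k := Some (other (the (\<phi> (b k)))))" "snd (paint_one a b k \<phi>) = 6"
  by (simp_all add: paint_one_def)

lemma runs_load:
  "runs (load T as n) (8 * n + 5) (\<lambda>(a, b). \<forall>k. 1 \<le> k \<longrightarrow> k \<le> n \<longrightarrow>
    a k = as ! (k - 1) \<and> b k = hd (rot T (as ! (k - 1))))"
proof -
  let ?I = "\<lambda>k (a, b). \<forall>j. 1 \<le> j \<longrightarrow> j < k \<longrightarrow> a j = as ! (j - 1) \<and> b j = hd (rot T (as ! (j - 1)))"
  have loop: "runs (for_each [1..<n + 1] (\<lambda>k (a, b). do {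
       v \<leftarrow> rd ((!) as) (k - 1);
       a \<leftarrow> wr a k v;
       ws \<leftarrow> rd (rot T) v;
       w \<leftarrow> op (hd ws);
       b \<leftarrow> wr b k w;
       return (a, b) }) (a, b)) ((5 + 1) * (n + 1 - 1) + 1) (?I (n + 1))" for a b :: "nat \<Rightarrow> 'a"
    by (rule runs_for_each_upt) (auto intro!: runsI simp: less_Suc_eq split: prod.split)
  show ?thesis
    unfolding load_def
    by (rule runs_step, rule order_refl, rule runs_step, rule order_refl, rule runs_weaken[OF loop])
      (auto simp: less_Suc_eq_le)
qed

lemma runs_relabel:
  "runs (relabel n i x) (7 * n + 5) (\<lambda>y. \<forall>k. 1 \<le> k \<longrightarrow> k \<le> n \<longrightarrow>
    y k = x (if i + k - 1 \<le> n then i + k - 1 else i + k - 1 - n))"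
proof -
  let ?I = "\<lambda>k y. \<forall>j. 1 \<le> j \<longrightarrow> j < k \<longrightarrow> y j = x (if i + j - 1 \<le> n then i + j - 1 else i + j - 1 - n)"
  have loop: "runs (for_each [1..<n + 1] (\<lambda>k y. do {
       l \<leftarrow> op (i + k - 1);
       l \<leftarrow> test (l \<le> n) (return l) (op (l - n));
       v \<leftarrow> rd x l;
       wr y k v }) y) ((5 + 1) * (n + 1 - 1) + 1) (?I (n + 1))" for y
    by (rule runs_for_each_upt) (auto intro!: runsI simp: less_Suc_eq)
  show ?thesis
    unfolding relabel_def
    by (rule runs_step, rule order_refl, rule runs_step, rule order_refl, rule runs_weaken[OF loop])
      (auto simp: less_Suc_eq_le)
qed

section \<open>Recoloring the leaves\<close>

text \<open>
  The arrays \<open>a\<close> of leaves and \<open>b\<close> of parents, and the coloring \<open>\<phi>0\<close> found by the search.  As parents are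
  not leaves, their classes never change.
\<close>

locale labelled =
  fixes n :: nat and a b :: "nat \<Rightarrow> 'v" and \<phi>0 :: "'v coloring"
  assumes n_ge_3: "3 \<le> n"
    and inj_a: "inj_on a {1..n}"
    and b_notin_a: "1 \<le> k \<Longrightarrow> k \<le> n \<Longrightarrow> b k \<notin> a ` {1..n}"
begin

text \<open>
  The class of the parent of a leaf; the search gives the leaf the other class.
\<close>

definition c :: "nat \<Rightarrow> color" where
  "c k = the (\<phi>0 (b k))"

text \<open>
  Throughout the algorithm, only leaves are recolored.  So the current coloring is described by the
  colors \<open>g\<close> of the positions.
\<close>

definition leaves_colored :: "(nat \<Rightarrow> color) \<Rightarrow> 'v coloring \<Rightarrow> bool" where
  "leaves_colored g \<phi> \<longleftrightarrow>
     (\<forall>k. 1 \<le> k \<longrightarrow> k \<le> n \<longrightarrow> \<phi> (a k) = Some (g k)) \<and>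
     (\<forall>v. v \<notin> a ` {1..n} \<longrightarrow> \<phi> v = \<phi>0 v)"

lemma leaf_color: "leaves_colored g \<phi> \<Longrightarrow> 1 \<le> k \<Longrightarrow> k \<le> n \<Longrightarrow> \<phi> (a k) = Some (g k)"
  by (simp add: leaves_colored_def)

lemma parent_color: "leaves_colored g \<phi> \<Longrightarrow> 1 \<le> k \<Longrightarrow> k \<le> n \<Longrightarrow> the (\<phi> (b k)) = c k"
  using b_notin_a by (simp add: leaves_colored_def c_def)

lemma leaves_colored_cong:
  "leaves_colored g \<phi> \<Longrightarrow> (\<And>k. 1 \<le> k \<Longrightarrow> k \<le> n \<Longrightarrow> g k = g' k) \<Longrightarrow> leaves_colored g' \<phi>"
  by (simp add: leaves_colored_def)

lemma leaves_colored_upd: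
  assumes "leaves_colored g \<phi>" "1 \<le> k" "k \<le> n"
  shows "leaves_colored (g(k := x)) (\<phi>(a k := Some x))"
  using assms inj_onD[OF inj_a] by (auto simp: leaves_colored_def)

lemma painted:
  "leaves_colored g \<phi> \<Longrightarrow> 1 \<le> k \<Longrightarrow> k \<le> n \<Longrightarrow> leaves_colored (g(k := x)) (fst (paint a k x \<phi>))"
  using leaves_colored_upd by simp

lemma painted_one:
  "leaves_colored g \<phi> \<Longrightarrow> 1 \<le> k \<Longrightarrow> k \<le> n \<Longrightarrow>
    leaves_colored (g(k := other (c k))) (fst (paint_one a b k \<phi>))"
  using leaves_colored_upd parent_color by simp

lemma runs_recolor_blocks:
  assumes "leaves_colored g \<phi>" "m \<le> n"
  shows "runs (recolor_blocks a b m \<phi>) (9 * m + 1)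
    (leaves_colored (\<lambda>k. if k \<le> m then alternating c k else g k))"
proof -
  let ?I = "\<lambda>k. leaves_colored (\<lambda>j. if j < k then alternating c j else g j)"
  have "runs (recolor_blocks a b m \<phi>) ((8 + 1) * (m + 1 - 1) + 1) (?I (m + 1))"
    unfolding recolor_blocks_def
  proof (rule runs_for_each_upt)
    show "?I 1 \<phi>" by (rule leaves_colored_cong[OF assms(1)]) auto
    fix k \<psi> assume k: "1 \<le> k" "k < m + 1" and I: "?I k \<psi>"
    let ?g = "\<lambda>j. if j < k then alternating c j else g j"
    have upd: "?I (Suc k) (\<psi>(a k := Some x))" if "x = alternating c k" for x
    proof (rule leaves_colored_cong)
      show "leaves_colored (?g(k := x)) (\<psi>(a k := Some x))"
        using leaves_colored_upd[OF I] k assms(2) by simp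
    qed (auto simp: that less_Suc_eq)
    have "the (\<psi> (b k)) = c k" using parent_color[OF I] k assms(2) by simp
    then show "runs (test (odd k) (paint_one a b k \<psi>)
       (test (k mod 4 = 2) (paint a k TwoA \<psi>) (paint a k TwoB \<psi>))) 8 (?I (Suc k))"
      by (auto intro!: runsI upd simp: alternating_def)
  qed simp
  then show ?thesis
    by (rule runs_weaken) (auto simp: less_Suc_eq_le)
qed

lemma runs_case_1_rest:
  assumes m: "m = 4 * (n div 4)"
    and \<phi>: "leaves_colored (\<lambda>k. if k \<le> m then alternating c k else g k) \<phi>"
  shows "runs (case_1_rest a b n m \<phi>) 20 (leaves_colored (pattern_1 c n))"
proof -
  let ?g = "\<lambda>k. if k \<le> m then alternating c k else g k"
  define q where "q = n div 4"
  have mq: "m = 4 * q" using m by (simp add: q_def)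
  have "n = m + n mod 4" using m by simp
  then have nm: "n = m + n mod 4" "n - m = n mod 4" by linarith+
  have low: "pattern_1 c n k = alternating c k" if "k \<le> m" for k
    using that nm by (auto simp: pattern_1_def)
  consider "n mod 4 = 0" | "n mod 4 = 1" | "n mod 4 = 2" | "n mod 4 = 3" by linarith
  then show ?thesis
  proof cases
    case 1
    have "leaves_colored (pattern_1 c n) \<phi>"
      by (rule leaves_colored_cong[OF \<phi>]) (use low nm 1 in auto)
    then show ?thesis using nm 1 by (auto intro!: runsI simp: case_1_rest_def)
  next
    case 2
    have n: "n = 4 * q + 1" using nm(1) mq 2 by simp
    have "leaves_colored (?g(n := other (c n))) (fst (paint_one a b n \<phi>))"
      by (intro painted painted_one \<phi>) (use n_ge_3 in auto)
    then have "leaves_colored (pattern_1 c n) (fst (paint_one a b n \<phi>))"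
      by (rule leaves_colored_cong) (auto simp: low n mq pattern_1_def alternating_def)
    then show ?thesis using nm 2 by (auto intro!: runsI simp: case_1_rest_def)
  next
    case 3
    have n: "n = 4 * q + 2" using nm(1) mq 3 by simp
    let ?\<phi>1 = "fst (paint a (n - 1) TwoA \<phi>)"
    have "leaves_colored ((?g(n - 1 := TwoA))(n := other (c n))) (fst (paint_one a b n ?\<phi>1))"
      by (intro painted painted_one \<phi>) (use n_ge_3 in auto)
    then have "leaves_colored (pattern_1 c n) (fst (paint_one a b n ?\<phi>1))"
      by (rule leaves_colored_cong) (auto simp: low n mq pattern_1_def alternating_def mod_Suc)
    then show ?thesis using nm 3 by (auto intro!: runsI simp: case_1_rest_def)
  next
    case 4
    have n: "n = 4 * q + 3" using nm(1) mq 4 by simp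
    let ?\<phi>1 = "fst (paint_one a b (n - 2) \<phi>)"
    let ?\<phi>2 = "fst (paint a (n - 1) TwoA ?\<phi>1)"
    have "leaves_colored ((?g(n - 2 := other (c (n - 2))))(n - 1 := TwoA, n := other (c n))) (fst (paint_one a b n ?\<phi>2))"
      by (intro painted painted_one \<phi>) (use n_ge_3 in auto)
    then have "leaves_colored (pattern_1 c n) (fst (paint_one a b n ?\<phi>2))"
      by (rule leaves_colored_cong) (auto simp: low n mq pattern_1_def alternating_def mod_Suc)
    then show ?thesis using nm 4 by (auto intro!: runsI simp: case_1_rest_def)
  qed
qed

lemma runs_case_2_rest:
  assumes m: "m = 4 * (n div 4)"
    and \<phi>: "leaves_colored (\<lambda>k. if k \<le> m then alternating c k else g k) \<phi>"
  shows "runs (case_2_rest a b n m \<phi>) 20 (leaves_colored (pattern_2 c n))"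
proof -
  let ?g = "\<lambda>k. if k \<le> m then alternating c k else g k"
  define q where "q = n div 4"
  have mq: "m = 4 * q" using m by (simp add: q_def)
  have "n = m + n mod 4" using m by simp
  then have nm: "n = m + n mod 4" "n - m = n mod 4" by linarith+
  have low: "pattern_2 c n k = alternating c k" if "k \<le> m" for k
    using that nm by (auto simp: pattern_2_def)
  consider "n mod 4 = 0" | "n mod 4 = 1" | "n mod 4 = 2" | "n mod 4 = 3" by linarith
  then show ?thesis
  proof cases
    case 1
    have "leaves_colored (pattern_2 c n) \<phi>"
      by (rule leaves_colored_cong[OF \<phi>]) (use low nm 1 in auto)
    then show ?thesis using nm 1 by (auto intro!: runsI simp: case_2_rest_def)
  next
    case 2
    have n: "n = 4 * q + 1" using nm(1) mq 2 by simp
    have "leaves_colored (?g(n := TwoC)) (fst (paint a n TwoC \<phi>))"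
      by (intro painted painted_one \<phi>) (use n_ge_3 in auto)
    then have "leaves_colored (pattern_2 c n) (fst (paint a n TwoC \<phi>))"
      by (rule leaves_colored_cong) (auto simp: low n mq pattern_2_def alternating_def)
    then show ?thesis using nm 2 by (auto intro!: runsI simp: case_2_rest_def)
  next
    case 3
    have n: "n = 4 * q + 2" using nm(1) mq 3 by simp
    let ?\<phi>1 = "fst (paint_one a b (n - 1) \<phi>)"
    have "leaves_colored ((?g(n - 1 := other (c (n - 1))))(n := TwoC)) (fst (paint a n TwoC ?\<phi>1))"
      by (intro painted painted_one \<phi>) (use n_ge_3 in auto)
    then have "leaves_colored (pattern_2 c n) (fst (paint a n TwoC ?\<phi>1))"
      by (rule leaves_colored_cong) (auto simp: low n mq pattern_2_def alternating_def mod_Suc)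
    then show ?thesis using nm 3 by (auto intro!: runsI simp: case_2_rest_def)
  next
    case 4
    have n: "n = 4 * q + 3" using nm(1) mq 4 by simp
    let ?\<phi>1 = "fst (paint a (n - 2) TwoA \<phi>)"
    let ?\<phi>2 = "fst (paint_one a b (n - 1) ?\<phi>1)"
    have "leaves_colored ((?g(n - 2 := TwoA))(n - 1 := other (c (n - 1)), n := TwoB)) (fst (paint a n TwoB ?\<phi>2))"
      by (intro painted painted_one \<phi>) (use n_ge_3 in auto)
    then have "leaves_colored (pattern_2 c n) (fst (paint a n TwoB ?\<phi>2))"
      by (rule leaves_colored_cong) (auto simp: low n mq pattern_2_def alternating_def mod_Suc)
    then show ?thesis using nm 4 by (auto intro!: runsI simp: case_2_rest_def)
  qed
qed

lemma runs_modification_i: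
  assumes \<phi>: "leaves_colored g \<phi>"
  shows "runs (modification_i a b n \<phi>) (11 * n + 15)
    (leaves_colored (if swap_last n b g then g(2 := TwoC, n - 1 := TwoC, n := TwoA) else g))"
proof -
  let ?P = "\<lambda>i. g (n - 1) = TwoB \<and> g i = TwoB \<and> b n = b (n - 1) \<and> b (n - 1) = b i"
  have g: "the (\<phi> (a k)) = g k" if "1 \<le> k" "k \<le> n" for k
    using leaf_color[OF \<phi> that] by simp
  have search: "runs (first_such [1..<n - 1] (\<lambda>i. do {
           c \<leftarrow> color_of a \<phi> (n - 1);
           ci \<leftarrow> color_of a \<phi> i;
           bn \<leftarrow> rd b n;
           bn1 \<leftarrow> rd b (n - 1);
           bi \<leftarrow> rd b i;
           op (c = TwoB \<and> ci = TwoB \<and> bn = bn1 \<and> bn1 = bi) })) (11 * n) (\<lambda>res. res = find ?P [1..<n - 1])"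
    by (rule runs_first_such[where c = 10]) (use g n_ge_3 in auto)
  have swap: "swap_last n b g \<longleftrightarrow> g n = TwoC \<and> find ?P [1..<n - 1] \<noteq> None"
    by (simp only: swap_last_def find_None_upt not_not)
  have upd: "leaves_colored (g(2 := TwoC, n - 1 := TwoC, n := TwoA))
      (\<phi>(a 2 := Some TwoC, a (n - 1) := Some TwoC, a n := Some TwoA))"
    by (intro leaves_colored_upd \<phi>) (use n_ge_3 in auto)
  let ?Q = "leaves_colored (if swap_last n b g then g(2 := TwoC, n - 1 := TwoC, n := TwoA) else g)"
  have swapping: "runs (test (x \<noteq> None)
           (do {
             \<phi> \<leftarrow> paint a 2 TwoC \<phi>;
             \<phi> \<leftarrow> paint a (n - 1) TwoC \<phi>;
             paint a n TwoA \<phi> })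
           (return \<phi>)) 9 ?Q" if "g n = TwoC" "x = find ?P [1..<n - 1]" for x
    using that upd \<phi> by (intro runsI) (simp_all add: swap del: One_nat_def)
  show ?thesis
    unfolding modification_i_def
    by (rule runs_step[OF order_refl, where d = "11 * n + 10"], rule runs_test[where c = "11 * n + 9"],
        rule runs_bind[OF search, where d = 9], rule swapping, use g n_ge_3 in simp, assumption)
      (use g n_ge_3 \<phi> in \<open>auto intro!: runsI simp: swap\<close>)
qed

lemma runs_modification_ii:
  assumes \<phi>: "leaves_colored g \<phi>"
  shows "runs (modification_ii a b n \<phi>) (14 * n + 15)
    (leaves_colored (if swap_second n b g then g(2 := TwoC, n := TwoA) else g))"
proof -
  let ?P = "\<lambda>i. (g i = TwoA \<or> g i = TwoB) \<and> b i = b n"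
  let ?P' = "\<lambda>i. g i = TwoA \<and> b i = b 2"
  have g: "the (\<phi> (a k)) = g k" if "1 \<le> k" "k \<le> n" for k
    using leaf_color[OF \<phi> that] by simp
  have search: "runs (first_such [1..<n] (\<lambda>i. do {
           ci \<leftarrow> color_of a \<phi> i;
           bi \<leftarrow> rd b i;
           bn \<leftarrow> rd b n;
           op ((ci = TwoA \<or> ci = TwoB) \<and> bi = bn) })) (7 * n) (\<lambda>res. res = find ?P [1..<n])"
    by (rule runs_first_such[where c = 6]) (use g n_ge_3 in auto)
  have search': "runs (first_such [4..<n] (\<lambda>i. do {
           ci \<leftarrow> color_of a \<phi> i;
           bi \<leftarrow> rd b i;
           b2 \<leftarrow> rd b 2;
           op (ci = TwoA \<and> bi = b2) })) (7 * n) (\<lambda>res. res = find ?P' [4..<n])"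
    by (rule runs_first_such[where c = 6]) (use g n_ge_3 in auto)
  have swap: "swap_second n b g \<longleftrightarrow>
      g n = TwoC \<and> find ?P [1..<n] = None \<and> find ?P' [4..<n] \<noteq> None"
    by (simp only: swap_second_def find_None_upt not_not) blast
  have upd: "leaves_colored (g(2 := TwoC, n := TwoA)) (\<phi>(a 2 := Some TwoC, a n := Some TwoA))"
    by (intro leaves_colored_upd \<phi>) (use n_ge_3 in auto)
  let ?Q = "leaves_colored (if swap_second n b g then g(2 := TwoC, n := TwoA) else g)"
  have swapping: "runs (test (x = None \<and> y \<noteq> None)
           (do { \<phi> \<leftarrow> paint a 2 TwoC \<phi>; paint a n TwoA \<phi> })
           (return \<phi>)) 9 ?Q"
    if "g n = TwoC" "x = find ?P [1..<n]" "y = find ?P' [4..<n]" for x y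
    using that upd \<phi> by (intro runsI) (simp_all add: swap)
  show ?thesis
    unfolding modification_ii_def
    by (rule runs_step[OF order_refl, where d = "14 * n + 10"], rule runs_test[where c = "14 * n + 9"],
        rule runs_bind[OF search, where d = "7 * n + 9"], rule runs_bind[OF search', where d = 9],
        rule swapping, use g n_ge_3 in simp, assumption, assumption)
      (use g n_ge_3 \<phi> in \<open>auto intro!: runsI simp: swap\<close>)
qed

text \<open>
  The colorings in which RECOLORING can end.
\<close>

definition recolored_by :: "(nat \<Rightarrow> color) \<Rightarrow> bool" where
  "recolored_by f \<longleftrightarrow> c 1 \<noteq> c n \<and> f = pattern_1 c n \<or>
     f = case_2_pattern n b c"

lemma runs_run_case_1:
  assumes "leaves_colored g \<phi>" "c 1 \<noteq> c n"
  shows "runs (run_case_1 a b n \<phi>) (9 * n + 30) (\<lambda>\<phi>. \<exists>f. recolored_by f \<and> leaves_colored f \<phi>)"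
  unfolding run_case_1_def
proof (rule runs_step[OF order_refl, where d = "9 * n + 29"])
  have m: "fst (op (4 * (n div 4))) = 4 * (n div 4)" "4 * (n div 4) \<le> n" by simp_all
  show "runs (recolor_blocks a b (fst (op (4 * (n div 4)))) \<phi> \<bind> case_1_rest a b n (fst (op (4 * (n div 4)))))
      (9 * n + 29) (\<lambda>\<phi>. \<exists>f. recolored_by f \<and> leaves_colored f \<phi>)"
    unfolding m(1)
  proof (rule runs_bind[OF runs_recolor_blocks[OF assms(1) m(2)] runs_weaken[OF runs_case_1_rest[OF refl]]])
    show "\<exists>f. recolored_by f \<and> leaves_colored f \<psi>" if "leaves_colored (pattern_1 c n) \<psi>" for \<psi>
      using that assms(2) by (auto simp: recolored_by_def)
  qed (use m(2) in auto)
qed auto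

lemma runs_run_case_2:
  assumes "leaves_colored g \<phi>"
  shows "runs (run_case_2 a b n \<phi>) (34 * n + 60) (\<lambda>\<phi>. \<exists>f. recolored_by f \<and> leaves_colored f \<phi>)"
  unfolding run_case_2_def
proof (rule runs_step[OF order_refl, where d = "34 * n + 59"])
  have m: "fst (op (4 * (n div 4))) = 4 * (n div 4)" "4 * (n div 4) \<le> n" by simp_all
  let ?p = "pattern_2 c n"
  let ?p1 = "if swap_last n b ?p then ?p(2 := TwoC, n - 1 := TwoC, n := TwoA) else ?p"
  let ?p2 = "if swap_second n b ?p1 then ?p1(2 := TwoC, n := TwoA) else ?p1"
  have rec: "recolored_by ?p2"
    by (auto simp: recolored_by_def case_2_pattern_def pattern_2_i_def pattern_2_ii_def swap_second_def)
  show "runs (recolor_blocks a b (fst (op (4 * (n div 4)))) \<phi> \<bind>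
       (\<lambda>\<phi>. case_2_rest a b n (fst (op (4 * (n div 4)))) \<phi> \<bind>
       (\<lambda>\<phi>. modification_i a b n \<phi> \<bind> modification_ii a b n)))
      (34 * n + 59) (\<lambda>\<phi>. \<exists>f. recolored_by f \<and> leaves_colored f \<phi>)"
    unfolding m(1)
  proof (rule runs_bind[OF runs_recolor_blocks[OF assms m(2)]],
      rule runs_bind[OF runs_case_2_rest[OF refl]], assumption,
      rule runs_bind[OF runs_modification_i], assumption)
    show "runs (modification_ii a b n \<psi>) (14 * n + 15) (\<lambda>\<phi>. \<exists>f. recolored_by f \<and> leaves_colored f \<phi>)"
      if "leaves_colored ?p1 \<psi>" for \<psi>
      by (rule runs_weaken[OF runs_modification_ii[OF that]]) (use rec in blast)+
  qed (use m(2) in auto)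
qed auto

end

text \<open>
  The position in the old numbering of the leaf \<open>k\<close> in the numbering that starts after the leaf \<open>d\<close>.
\<close>

definition shift :: "nat \<Rightarrow> nat \<Rightarrow> nat \<Rightarrow> nat" where
  "shift n d k = (if d + k \<le> n then d + k else d + k - n)"

lemma shift_range: "d < n \<Longrightarrow> 1 \<le> k \<Longrightarrow> k \<le> n \<Longrightarrow> 1 \<le> shift n d k \<and> shift n d k \<le> n"
  by (auto simp: shift_def)

lemma (in labelled) labelled_shift:
  assumes "d < n" "\<And>k. 1 \<le> k \<Longrightarrow> k \<le> n \<Longrightarrow> a' k = a (shift n d k) \<and> b' k = b (shift n d k)"
  shows "labelled n a' b'"
proof
  show "inj_on a' {1..n}"
  proof (rule inj_onI)
    fix x y assume xy: "x \<in> {1..n}" "y \<in> {1..n}" "a' x = a' y"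
    then have "shift n d x = shift n d y"
      using assms shift_range[OF assms(1)] inj_onD[OF inj_a] by auto
    then show "x = y" using xy assms(1) by (auto simp: shift_def split: if_splits)
  qed
  show "b' k \<notin> a' ` {1..n}" if "1 \<le> k" "k \<le> n" for k
  proof -
    have "a' ` {1..n} \<subseteq> a ` {1..n}"
      using assms shift_range[OF assms(1)] by auto
    then show ?thesis
      using b_notin_a[of "shift n d k"] shift_range[OF assms(1) that] assms(2)[OF that] by auto
  qed
qed (rule n_ge_3)

text \<open>
  If the numbering is changed, it starts at a leaf whose predecessor has a parent of the other class, and
  this predecessor becomes the last leaf, as CASE-1 requires.
\<close>

lemma (in labelled) runs_recoloring:
  assumes \<phi>: "\<And>k. 1 \<le> k \<Longrightarrow> k \<le> n \<Longrightarrow> \<phi>0 (a k) = Some (other (c k)) \<and> (c k = One \<or> c k = One')"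
  shows "runs (recoloring a b n \<phi>0) (60 * n + 100) (\<lambda>(a', b', \<phi>).
    \<exists>d < n. (\<forall>k. 1 \<le> k \<longrightarrow> k \<le> n \<longrightarrow> a' k = a (shift n d k) \<and> b' k = b (shift n d k)) \<and>
      (\<exists>f. labelled.recolored_by n b' \<phi>0 f \<and> labelled.leaves_colored n a' \<phi>0 f \<phi>))"
proof -
  let ?Q = "\<lambda>(a', b', \<phi>). \<exists>d < n. (\<forall>k. 1 \<le> k \<longrightarrow> k \<le> n \<longrightarrow> a' k = a (shift n d k) \<and> b' k = b (shift n d k)) \<and>
      (\<exists>f. labelled.recolored_by n b' \<phi>0 f \<and> labelled.leaves_colored n a' \<phi>0 f \<phi>)"
  have init: "leaves_colored (\<lambda>k. other (c k)) \<phi>0"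
    using \<phi> by (simp add: leaves_colored_def)
  have col: "the (\<phi>0 (a i)) = the (\<phi>0 (a j)) \<longleftrightarrow> c i = c j"
    if "1 \<le> i" "i \<le> n" "1 \<le> j" "j \<le> n" for i j
    using \<phi>[OF that(1,2)] \<phi>[OF that(3,4)] by (auto simp: other_def)
  have plain: "?Q (a, b, \<phi>)" if "\<exists>f. recolored_by f \<and> leaves_colored f \<phi>" for \<phi>
  proof -
    have "0 < n \<and> (\<forall>k. 1 \<le> k \<longrightarrow> k \<le> n \<longrightarrow> a k = a (shift n 0 k) \<and> b k = b (shift n 0 k))"
      using n_ge_3 by (simp add: shift_def)
    then show ?thesis using that by blast
  qed
  let ?P = "\<lambda>i. c i \<noteq> c (i - 1)"
  have search: "runs (first_such [2..<n + 1] (\<lambda>i. do {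
           ci \<leftarrow> color_of a \<phi>0 i;
           cp \<leftarrow> color_of a \<phi>0 (i - 1);
           op (ci \<noteq> cp) })) (8 * n) (\<lambda>res. res = find ?P [2..<n + 1])"
    by (rule runs_first_such[where c = 7]) (use col n_ge_3 in auto)
  have case_1: "runs (do { \<phi> \<leftarrow> run_case_1 a b n \<phi>0; return (a, b, \<phi>) }) (60 * n + 92) ?Q"
    if "c 1 \<noteq> c n"
    by (rule runs_bind[OF runs_run_case_1[OF init that]], rule runsI) (use plain in auto)
  have case_2: "runs (do { \<phi> \<leftarrow> run_case_2 a b n \<phi>0; return (a, b, \<phi>) }) (50 * n + 80) ?Q"
    by (rule runs_bind[OF runs_run_case_2[OF init]], rule runsI) (use plain in auto)
  have case_shift: "runs (do {
             a \<leftarrow> relabel n (the x) a;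
             b \<leftarrow> relabel n (the x) b;
             \<phi> \<leftarrow> run_case_1 a b n \<phi>0;
             return (a, b, \<phi>) }) (50 * n + 80) ?Q"
    if x: "x = find ?P [2..<n + 1]" "x \<noteq> None" for x
  proof (rule runs_bind[OF runs_relabel], rule runs_bind[OF runs_relabel])
    obtain i where i: "x = Some i" using x(2) by blast
    then have ir: "2 \<le> i" "i \<le> n" "c i \<noteq> c (i - 1)"
      using find_SomeD[OF x(1)[symmetric, unfolded i]] by auto
    have eq: "the x + k - 1 = i - 1 + k" for k using ir i by simp
    fix a' b' :: "nat \<Rightarrow> 'v"
    assume ab: "\<forall>k. 1 \<le> k \<longrightarrow> k \<le> n \<longrightarrow> a' k = a (if the x + k - 1 \<le> n then the x + k - 1 else the x + k - 1 - n)"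
      "\<forall>k. 1 \<le> k \<longrightarrow> k \<le> n \<longrightarrow> b' k = b (if the x + k - 1 \<le> n then the x + k - 1 else the x + k - 1 - n)"
    then have ab': "a' k = a (shift n (i - 1) k) \<and> b' k = b (shift n (i - 1) k)" if "1 \<le> k" "k \<le> n" for k
      using that by (simp only: eq shift_def)
    have d: "i - 1 < n" using ir by simp
    interpret new: labelled n a' b' \<phi>0
      by (rule labelled_shift[OF d ab'])
    have sh: "shift n (i - 1) 1 = i" "shift n (i - 1) n = i - 1"
      using ir by (auto simp: shift_def)
    have "new.c k = c (shift n (i - 1) k)" if "1 \<le> k" "k \<le> n" for k
      using ab'[OF that] by (simp add: new.c_def c_def)
    then have "new.c 1 \<noteq> new.c n" using sh ir n_ge_3 by simp
    moreover have "new.leaves_colored (\<lambda>k. the (\<phi>0 (a' k))) \<phi>0"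
      using ab' \<phi> shift_range[OF d] by (simp add: new.leaves_colored_def)
    ultimately have run: "runs (run_case_1 a' b' n \<phi>0) (9 * n + 30) (\<lambda>\<phi>. \<exists>f. new.recolored_by f \<and> new.leaves_colored f \<phi>)"
      by (intro new.runs_run_case_1)
    show "runs (do { \<phi> \<leftarrow> run_case_1 a' b' n \<phi>0; return (a', b', \<phi>) }) (9 * n + 40) ?Q"
    proof (rule runs_bind[OF run, where d = 0])
      show "runs (return (a', b', \<psi>)) 0 ?Q" if "\<exists>f. new.recolored_by f \<and> new.leaves_colored f \<psi>" for \<psi>
        using that d ab' by (intro runsI) auto
    qed simp
  qed auto
  show ?thesis
    unfolding recoloring_def
    by (rule runs_step[OF order_refl, where d = "60 * n + 96"], rule runs_step[OF order_refl, where d = "60 * n + 93"],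
        rule runs_test[where c = "60 * n + 92"], rule case_1, use col n_ge_3 in simp,
        rule runs_bind[OF search, where d = "50 * n + 90"], rule runs_test[where c = "50 * n + 80"],
        rule case_shift, assumption, assumption, rule case_2) auto
qed


section \<open>The pass over the siblings\<close>

text \<open>
  The number of siblings of a leaf is at most the degree of their parent, so the inner loop of
  CONFLICTS-RESOLVING takes constant time.
\<close>

locale resolving = labelled n a b \<phi>0 + rec: recolored n b f
  for n and a b :: "nat \<Rightarrow> 'v" and \<phi>0 and f +
  assumes few_siblings: "1 \<le> k \<Longrightarrow> k \<le> n \<Longrightarrow> card {j \<in> {1..n}. b j = b k} \<le> 5"
begin

text \<open>
  The dictionary lists, for each parent, its children of class \<open>2\<close> in the order of their positions.
\<close>

lemma runs_build_dictionary:
  assumes \<phi>: "leaves_colored f \<phi>"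
  shows "runs (build_dictionary T a b n \<phi>) (12 * n + length (vlist T) + 3)
    (\<lambda>N. \<forall>k. 1 \<le> k \<longrightarrow> k \<le> n \<longrightarrow>
       N (b k) = Some (map a (filter (\<lambda>j. b j = b k \<and> is_two (f j)) [1..<n + 1])))"
proof -
  let ?entry = "\<lambda>k v. map a (filter (\<lambda>j. b j = v \<and> is_two (f j)) [1..<k])"
  let ?I = "\<lambda>k N. \<forall>v. N v = (if \<exists>j. 1 \<le> j \<and> j < k \<and> b j = v then Some (?entry k v) else None)"
  let ?body = "\<lambda>j \<N>. do {
       aj \<leftarrow> rd a j;
       bj \<leftarrow> rd b j;
       entry \<leftarrow> rd \<N> bj;
       \<N> \<leftarrow> test (entry = None) (wr \<N> bj (Some [])) (return \<N>);
       c \<leftarrow> rd \<phi> aj;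
       test (c \<notin> {Some One, Some One'})
         (do {
           entry \<leftarrow> rd \<N> bj;
           entry' \<leftarrow> op (the entry @ [aj]);
           wr \<N> bj (Some entry') })
         (return \<N>) }"
  have loop: "runs (for_each [1..<n + 1] ?body N) ((11 + 1) * (n + 1 - 1) + 1) (?I (n + 1))"
    if "N = (\<lambda>_. None)" for N
  proof (rule runs_for_each_upt)
    fix k N assume k: "1 \<le> k" "k < n + 1" and I: "?I k N"
    have is_two: "\<phi> (a k) \<notin> {Some One, Some One'} \<longleftrightarrow> is_two (f k)"
      using leaf_color[OF \<phi>, of k] k by (cases "f k") (auto simp: is_two_iff)
    have N: "(if N (b k) = None then N(b k := Some []) else N) (b k) = Some (?entry k (b k))"
    proof (cases "\<exists>j. 1 \<le> j \<and> j < k \<and> b j = b k")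
      case False
      then have "?entry k (b k) = []" by (auto simp: filter_empty_conv)
      then show ?thesis using I False by simp
    qed (use I in simp)
    have ex: "(\<exists>j. 1 \<le> j \<and> j < Suc k \<and> b j = v) \<longleftrightarrow> v = b k \<or> (\<exists>j. 1 \<le> j \<and> j < k \<and> b j = v)" for v
      using k by (auto simp: less_Suc_eq)
    have entry: "?entry (Suc k) v = ?entry k v @ (if v = b k \<and> is_two (f k) then [a k] else [])" for v
      using k by auto
    have res: "fst (?body k N) = (let N' = (if N (b k) = None then N(b k := Some []) else N) in
        if is_two (f k) then N'(b k := Some (the (N' (b k)) @ [a k])) else N')"
      by (simp only: tm_simps test_simps is_two[symmetric] Let_def split: if_split)
    show "runs (?body k N) 11 (?I (Suc k))"
    proof (rule runsI)
      show "?I (Suc k) (fst (?body k N))"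
      proof
        fix v
        show "fst (?body k N) v =
          (if \<exists>j. 1 \<le> j \<and> j < Suc k \<and> b j = v then Some (?entry (Suc k) v) else None)"
        proof (cases "v = b k")
          case True
          then show ?thesis unfolding res entry ex Let_def using N by simp
        next
          case False
          then show ?thesis unfolding res entry ex Let_def using I by auto
        qed
      qed
    qed simp
  qed (use that in auto)
  have all: "\<forall>k. 1 \<le> k \<longrightarrow> k \<le> n \<longrightarrow> N (b k) = Some (?entry (n + 1) (b k))" if N: "?I (n + 1) N" for N
  proof (intro allI impI)
    fix k assume "1 \<le> k" "k \<le> n"
    then have "\<exists>j. 1 \<le> j \<and> j < n + 1 \<and> b j = b k" by (intro exI[of _ k]) simp
    then show "N (b k) = Some (?entry (n + 1) (b k))" using N[rule_format, of "b k"] by simp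
  qed
  show ?thesis
    unfolding build_dictionary_def
    by (rule runs_step[OF order_refl, where d = "12 * n + 1"], rule runs_weaken[OF loop], simp, rule all, assumption)
      simp_all
qed

text \<open>
  The invariant of CONFLICTS-RESOLVING before step \<open>k\<close>: exactly the conflicts whose lower leaf is below
  \<open>k\<close> have been resolved.
\<close>

definition resolved_below :: "nat \<Rightarrow> (nat \<Rightarrow> color) \<Rightarrow> bool" where
  "resolved_below k g \<longleftrightarrow>
     (\<forall>j. 1 \<le> j \<longrightarrow> j \<le> n \<longrightarrow> (\<forall>x y. rec.conflict x y \<longrightarrow> x < k \<longrightarrow> j \<noteq> x \<and> j \<noteq> y) \<longrightarrow> g j = f j) \<and>
     (\<forall>x y. rec.conflict x y \<longrightarrow> x < k \<longrightarrow>
        (if (if x = 2 then f n else g (x - 2)) = TwoC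
         then g x = f x \<and> g y = TwoC
         else g x = TwoC \<and> g y = f y))"

lemma resolved_below_start: "resolved_below 1 f"
  using rec.conflictD(1) by (fastforce simp: resolved_below_def)

lemma resolved_below_end: "resolved_below (n + 1) g \<Longrightarrow> resolves n b f g"
proof -
  assume r: "resolved_below (n + 1) g"
  have "x < n + 1" if "rec.conflict x y" for x y using rec.conflictD(2,3)[OF that] by simp
  then show ?thesis using r unfolding resolved_below_def resolves_def by blast
qed

lemma resolved_below_changed:
  assumes "resolved_below k g" "1 \<le> j" "j \<le> n"
  shows "g j = f j \<or> g j = TwoC"
  using assms unfolding resolved_below_def by metis

lemma conflict_disjoint:
  assumes "rec.conflict k y" "rec.conflict x z" "x \<noteq> k"
  shows "x \<noteq> y" "z \<noteq> k" "z \<noteq> y"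
  using rec.one_conflict[OF assms(1,2)] rec.conflictD(4)[OF assms(1)] rec.conflictD(4)[OF assms(2)] assms(3)
  by auto

lemma resolved_below_skip:
  assumes "resolved_below k g" "\<And>y. \<not> rec.conflict k y"
  shows "resolved_below (Suc k) g"
proof -
  have "rec.conflict x y \<Longrightarrow> x < Suc k \<longleftrightarrow> x < k" for x y
    using assms(2) by (auto simp: less_Suc_eq)
  then show ?thesis using assms(1) by (simp add: resolved_below_def)
qed

lemma resolved_below_unchanged:
  assumes r: "resolved_below k g" and c: "rec.conflict k y"
  shows "g k = f k" "g y = f y" "k = 2 \<Longrightarrow> g n = f n"
proof -
  note D = rec.conflictD[OF c]
  have "k \<noteq> x \<and> k \<noteq> z" "y \<noteq> x \<and> y \<noteq> z" if "rec.conflict x z" "x < k" for x z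
    using conflict_disjoint[OF c that(1)] that(2) D(2) by auto
  then show "g k = f k" "g y = f y"
    using r D unfolding resolved_below_def by auto
  show "g n = f n" if "k = 2"
  proof -
    have "\<not> x < k" if "rec.conflict x z" for x z
      using rec.conflict_ge_2[OF that] \<open>k = 2\<close> by simp
    then show ?thesis using r n_ge_3 unfolding resolved_below_def by auto
  qed
qed

lemma resolved_below_step:
  assumes r: "resolved_below k g" and c: "rec.conflict k y"
  shows "resolved_below (Suc k) (if (if k = 2 then f n else g (k - 2)) = TwoC then g(y := TwoC) else g(k := TwoC))"
    (is "resolved_below _ ?g")
proof -
  note D = rec.conflictD[OF c]
  note same = resolved_below_unchanged[OF r c]
  have k2: "2 \<le> k" using rec.conflict_ge_2[OF c] .
  have others: "?g j = g j" if "j \<noteq> k" "j \<noteq> y" for j using that by auto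
  show ?thesis
    unfolding resolved_below_def
  proof (intro conjI allI impI)
    fix j assume j: "1 \<le> j" "j \<le> n" "\<forall>x z. rec.conflict x z \<longrightarrow> x < Suc k \<longrightarrow> j \<noteq> x \<and> j \<noteq> z"
    then have "j \<noteq> k" "j \<noteq> y" using c by auto
    then have "?g j = g j" by (rule others)
    also have "\<dots> = f j" using r j unfolding resolved_below_def by auto
    finally show "?g j = f j" .
  next
    fix x z assume cx: "rec.conflict x z" and "x < Suc k"
    show "if (if x = 2 then f n else ?g (x - 2)) = TwoC then ?g x = f x \<and> ?g z = TwoC
        else ?g x = TwoC \<and> ?g z = f z"
    proof (cases "x = k")
      case True
      then have "z = y" using rec.one_conflict[OF c cx] by simp
      have "k - 2 \<noteq> k" "k - 2 \<noteq> y" using D k2 by auto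
      then have "?g (k - 2) = g (k - 2)" by (rule others)
      then show ?thesis using True \<open>z = y\<close> same D by auto
    next
      case False
      then have x: "x < k" using \<open>x < Suc k\<close> by simp
      have "?g x = g x" "?g z = g z"
        using others conflict_disjoint[OF c cx False] False by auto
      moreover have "?g (x - 2) = g (x - 2)"
        using others x D by auto
      ultimately show ?thesis using r cx x unfolding resolved_below_def by auto
    qed
  qed
qed

text \<open>
  A sibling that has the current color of \<open>k\<close> was in conflict with \<open>k\<close> from the start; it is not below
  \<open>k\<close>, because such a conflict has been resolved already.  So the search in step \<open>k\<close> finds the partner in
  the conflict with lower leaf \<open>k\<close> if there is one, and nothing otherwise.
\<close>

lemma equal_sibling_conflict:
  assumes r: "resolved_below k g" and k: "1 \<le> k" "k \<le> n" and j: "1 \<le> j" "j \<le> n" "j \<noteq> k"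
    and eq: "b j = b k" "g j = g k" "g k \<noteq> TwoC" "is_two (f j)"
  shows "rec.conflict k j"
proof -
  have f: "f j = g j" "f k = g k"
    using resolved_below_changed[OF r k] resolved_below_changed[OF r j(1,2)] eq by auto
  then have col: "f k = f j" "f k = TwoA \<or> f k = TwoB" using eq by (auto simp: is_two_iff)
  have "\<not> j < k"
  proof
    assume "j < k"
    then have "rec.conflict j k" using k j eq col by (auto simp: sibling_conflict_def)
    then have "g j = TwoC \<or> g k = TwoC"
      using r \<open>j < k\<close> unfolding resolved_below_def by metis
    then show False using eq by auto
  qed
  then show ?thesis using k j eq col by (auto simp: sibling_conflict_def)
qed

lemma runs_resolve_conflicts:
  assumes \<phi>: "leaves_colored f \<phi>"
  shows "runs (resolve_conflicts T a b n \<phi>) (60 * n + length (vlist T) + 10)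
    (\<lambda>\<phi>. \<exists>g. resolves n b f g \<and> leaves_colored g \<phi>)"
proof -
  let ?L = "\<lambda>k. map a (filter (\<lambda>j. b j = b k \<and> is_two (f j)) [1..<n + 1])"
  let ?I = "\<lambda>k \<phi>. \<exists>g. resolved_below k g \<and> leaves_colored g \<phi>"
  let ?body = "\<lambda>a \<N> i \<phi>. test (even i)
         (do {
           ai \<leftarrow> rd a i;
           bi \<leftarrow> rd b i;
           Nb \<leftarrow> rd \<N> bi;
           conflict \<leftarrow> first_such (the Nb) (\<lambda>aj. do {
             cj \<leftarrow> rd \<phi> aj;
             ci \<leftarrow> rd \<phi> ai;
             op (aj \<noteq> ai \<and> cj = ci \<and> ci \<noteq> Some TwoC) });
           test (conflict \<noteq> None)
             (do {
               c \<leftarrow> color_of a \<phi> (i - 2);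
               test (c \<noteq> TwoC)
                 (wr \<phi> ai (Some TwoC))
                 (wr \<phi> (the conflict) (Some TwoC)) })
             (return \<phi>) })
         (return \<phi>)"
  have body: "runs (?body a' N k \<psi>) 45 (?I (Suc k))"
    if a': "a' = a(0 := a n)"
      and N: "\<forall>k. 1 \<le> k \<longrightarrow> k \<le> n \<longrightarrow> N (b k) = Some (?L k)"
      and k: "1 \<le> k" "k < n + 1" and I: "?I k \<psi>" for a' N k \<psi>
  proof -
    obtain g where r: "resolved_below k g" and g: "leaves_colored g \<psi>" using I by blast
    have kn: "k \<le> n" using k by simp
    have gk: "\<psi> (a k) = Some (g k)" using leaf_color[OF g k(1) kn] .
    let ?P = "\<lambda>v. v \<noteq> a k \<and> \<psi> v = \<psi> (a k) \<and> \<psi> (a k) \<noteq> Some TwoC"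
    let ?p = "\<lambda>aj. do {
             cj \<leftarrow> rd \<psi> aj;
             ci \<leftarrow> rd \<psi> (a k);
             op (aj \<noteq> a k \<and> cj = ci \<and> ci \<noteq> Some TwoC) }"
    have found: "\<exists>j. v = a j \<and> rec.conflict k j" if v: "v \<in> set (?L k)" "?P v" for v
    proof -
      obtain j where j: "v = a j" "1 \<le> j" "j \<le> n" "b j = b k" "is_two (f j)" using v(1) by auto
      have "rec.conflict k j"
        by (rule equal_sibling_conflict[OF r k(1) kn j(2,3)])
          (use v(2) j leaf_color[OF g j(2,3)] gk in auto)
      then show ?thesis using j(1) by blast
    qed
    have len: "length (?L k) \<le> 5"
    proof -
      have "length (?L k) = card (set (filter (\<lambda>j. b j = b k \<and> is_two (f j)) [1..<n + 1]))"
        by (subst distinct_card) auto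
      also have "\<dots> \<le> card {j \<in> {1..n}. b j = b k}" by (intro card_mono) auto
      finally show ?thesis using few_siblings[OF k(1) kn] by simp
    qed
    have search: "runs (first_such (?L k) ?p) 21 (\<lambda>res. res = find ?P (?L k))"
      by (rule runs_first_such[where c = 3]) (use len in auto)
    have finish: "runs (test (res \<noteq> None)
             (do {
               c \<leftarrow> color_of a' \<psi> (k - 2);
               test (c \<noteq> TwoC)
                 (wr \<psi> (a k) (Some TwoC))
                 (wr \<psi> (the res) (Some TwoC)) })
             (return \<psi>)) 10 (?I (Suc k))" if res: "res = find ?P (?L k)" and ev: "even k" for res
    proof (cases "\<exists>y. rec.conflict k y")
      case True
      then obtain y where c: "rec.conflict k y" by blast
      note D = rec.conflictD[OF c]
      note same = resolved_below_unchanged[OF r c]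
      have "y \<in> set (filter (\<lambda>j. b j = b k \<and> is_two (f j)) [1..<n + 1])"
        using D by (simp del: upt_Suc)
      then have "a y \<in> set (?L k)" unfolding set_map by (rule imageI)
      moreover have "a y \<noteq> a k" using inj_onD[OF inj_a, of y k] D by auto
      then have "?P (a y)" using leaf_color[OF g, of y] gk same D by auto
      ultimately have "\<exists>v. v \<in> set (?L k) \<and> ?P v" by - (rule exI[of _ "a y"], rule conjI, assumption+)
      then have "res \<noteq> None" unfolding res find_None_iff not_not .
      then obtain v where v: "res = Some v" by blast
      then have "v \<in> set (?L k) \<and> ?P v" using find_SomeD[of ?P "?L k" v] res by simp
      then obtain j where "v = a j" "rec.conflict k j" using found[of v] by blast
      then have v': "res = Some (a y)" using rec.one_conflict[OF c] v by auto
      have k2: "2 \<le> k" using rec.conflict_ge_2[OF c] .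
      have trig: "the (\<psi> (a' (k - 2))) = (if k = 2 then f n else g (k - 2))"
      proof (cases "k = 2")
        case True
        then show ?thesis using leaf_color[OF g, of n] n_ge_3 same(3) a' by simp
      next
        case False
        then show ?thesis using leaf_color[OF g, of "k - 2"] k2 kn a' by simp
      qed
      let ?g = "if (if k = 2 then f n else g (k - 2)) = TwoC then g(y := TwoC) else g(k := TwoC)"
      have "leaves_colored (g(y := TwoC)) (\<psi>(a y := Some TwoC))" "leaves_colored (g(k := TwoC)) (\<psi>(a k := Some TwoC))"
        using leaves_colored_upd[OF g] D kn by auto
      then have "leaves_colored ?g (if (if k = 2 then f n else g (k - 2)) = TwoC
          then \<psi>(a y := Some TwoC) else \<psi>(a k := Some TwoC))"
        by simp
      moreover have "resolved_below (Suc k) ?g" by (rule resolved_below_step[OF r c])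
      ultimately have "?I (Suc k) (if (if k = 2 then f n else g (k - 2)) = TwoC
          then \<psi>(a y := Some TwoC) else \<psi>(a k := Some TwoC))"
        by blast
      then show ?thesis by (intro runsI) (auto simp: v' trig split: if_splits)
    next
      case False
      have "res = None"
      proof (rule ccontr)
        assume "res \<noteq> None"
        then obtain v where "res = Some v" by blast
        then have "v \<in> set (?L k) \<and> ?P v" using find_SomeD[of ?P "?L k" v] res by simp
        then show False using found[of v] False by blast
      qed
      moreover have "resolved_below (Suc k) g" using resolved_below_skip[OF r] False by blast
      ultimately show ?thesis using g by (intro runsI) auto
    qed
    show ?thesis
    proof (cases "even k")
      case True
      have "the (fst (rd N (fst (rd b k)))) = ?L k" "fst (rd a' k) = a k"
        using k kn a' N by auto
      then show ?thesis
        by - (rule runs_test[where c = 44], rule runs_step[OF order_refl, where d = 43],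
            rule runs_step[OF order_refl, where d = 42], rule runs_step[OF order_refl, where d = 41],
            simp only:, rule runs_bind[OF search finish[OF _ True]], simp_all add: True)
    next
      case False
      then have "\<not> rec.conflict k y" for y using rec.conflict_even by blast
      then have "resolved_below (Suc k) g" using resolved_below_skip[OF r] by blast
      then show ?thesis using g False by (intro runsI) auto
    qed
  qed
  have loop: "runs (for_each [1..<n + 1] (?body a' N) \<phi>) ((45 + 1) * (n + 1 - 1) + 1) (?I (n + 1))"
    if "a' = a(0 := a n)"
      and "\<forall>k. 1 \<le> k \<longrightarrow> k \<le> n \<longrightarrow> N (b k) = Some (?L k)" for a' N
    by (rule runs_for_each_upt) (use body[OF that] resolved_below_start \<phi> in auto)
  show ?thesis
    unfolding resolve_conflicts_def
    by (rule runs_bind[OF runs_build_dictionary[OF \<phi>], where d = "46 * n + 5"],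
        rule runs_step[OF order_refl, where d = "46 * n + 4"],
        rule runs_step[OF order_refl, where d = "46 * n + 3"], rule runs_weaken[OF loop])
      (use resolved_below_end in auto)
qed

end

section \<open>Breadth-first search colors the tree properly\<close>

context embedded_tree
begin

definition tree_coloring :: "'v coloring \<Rightarrow> bool" where
  "tree_coloring \<phi> \<longleftrightarrow> dom \<phi> = V \<and> (\<forall>v x. \<phi> v = Some x \<longrightarrow> x = One \<or> x = One') \<and>
     (\<forall>u v. (u, v) \<in> E \<longrightarrow> \<phi> v = Some (other (the (\<phi> u))))"

text \<open>
  The colored vertices are those in the queue.  They are connected among each other, properly colored,
  and contain the neighbours of all vertices that have been visited.
\<close>

definition bfs_inv :: "'v coloring \<Rightarrow> (nat \<Rightarrow> 'v) \<Rightarrow> nat \<Rightarrow> nat \<Rightarrow> bool" where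
  "bfs_inv \<phi> Q h q \<longleftrightarrow>
     inj_on Q {..<q} \<and> dom \<phi> = Q ` {..<q} \<and> dom \<phi> \<subseteq> V \<and> dom \<phi> \<noteq> {} \<and>
     (\<forall>v x. \<phi> v = Some x \<longrightarrow> x = One \<or> x = One') \<and>
     (\<forall>u v. (u, v) \<in> E \<longrightarrow> u \<in> dom \<phi> \<longrightarrow> v \<in> dom \<phi> \<longrightarrow> \<phi> v = Some (other (the (\<phi> u)))) \<and>
     (\<forall>u \<in> dom \<phi>. \<forall>v \<in> dom \<phi>. (u, v) \<in> (E \<inter> dom \<phi> \<times> dom \<phi>)\<^sup>*) \<and>
     (\<forall>k < h. \<forall>w. (Q k, w) \<in> E \<longrightarrow> w \<in> dom \<phi>)"

lemma finite_V: "finite V" by simp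

lemma card_V: "card V = length (vlist T)"
  using plane by (simp add: is_plane_tree_def distinct_card)

lemma bfs_inv_size:
  assumes "bfs_inv \<phi> Q h q"
  shows "q \<le> card V"
proof -
  have q: "q = card (Q ` {..<q})" using assms by (simp add: bfs_inv_def card_image)
  have "dom \<phi> = Q ` {..<q}" "dom \<phi> \<subseteq> V" using assms unfolding bfs_inv_def by blast+
  then have "card (Q ` {..<q}) \<le> card V" by (intro card_mono finite_V) (simp only:)
  then show ?thesis using q by simp
qed

lemma other_cases: "other x = One \<or> other x = One'"
  by (simp add: other_def)

lemma other_other: "x = One \<or> x = One' \<Longrightarrow> other (other x) = x"
  by (auto simp: other_def)

text \<open>
  The new vertex \<open>w\<close> has no colored neighbour besides \<open>u\<close>, because the colored vertices are connected
  without using \<open>w\<close>.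
\<close>

lemma bfs_discover:
  assumes inv: "bfs_inv \<phi> Q h q" and h: "h \<le> q"
    and u: "u \<in> dom \<phi>" and uw: "(u, w) \<in> E" and w: "w \<notin> dom \<phi>"
  shows "bfs_inv (\<phi>(w := Some (other (the (\<phi> u))))) (Q(q := w)) h (q + 1)"
proof -
  let ?\<phi> = "\<phi>(w := Some (other (the (\<phi> u))))" and ?D = "dom \<phi>"
  let ?R = "E \<inter> ?D \<times> ?D" and ?R' = "E \<inter> insert w ?D \<times> insert w ?D"
  have D: "?D = Q ` {..<q}" and inj: "inj_on Q {..<q}"
    and cols: "\<And>v x. \<phi> v = Some x \<Longrightarrow> x = One \<or> x = One'"
    and proper: "\<And>x y. (x, y) \<in> E \<Longrightarrow> x \<in> ?D \<Longrightarrow> y \<in> ?D \<Longrightarrow> \<phi> y = Some (other (the (\<phi> x)))"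
    and conn: "\<And>x y. x \<in> ?D \<Longrightarrow> y \<in> ?D \<Longrightarrow> (x, y) \<in> ?R\<^sup>*"
    and closed: "\<And>k y. k < h \<Longrightarrow> (Q k, y) \<in> E \<Longrightarrow> y \<in> ?D" and DV: "?D \<subseteq> V"
    using inv unfolding bfs_inv_def by blast+
  have dom: "dom ?\<phi> = insert w ?D" by auto
  have img: "(Q(q := w)) ` {..<q + 1} = insert w (Q ` {..<q})"
  proof -
    have "{..<q + 1} = insert q {..<q}" by auto
    then show ?thesis by auto
  qed
  have colu: "the (\<phi> u) = One \<or> the (\<phi> u) = One'"
    using u cols[of u "the (\<phi> u)"] by auto
  have only: "x = u" if "(x, w) \<in> E" "x \<in> ?D" for x
    using no_detour[OF arc_sym[OF uw] arc_sym[OF that(1)] conn[OF u that(2)] w] by simp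
  have nw: "w \<noteq> u" using u w by auto
  have proper': "?\<phi> y = Some (other (the (?\<phi> x)))" if e: "(x, y) \<in> E" "x \<in> insert w ?D" "y \<in> insert w ?D" for x y
  proof (cases "x = w")
    case True
    then have "y \<noteq> w" using e(1) no_loop by auto
    moreover from this have "y = u" using only[OF arc_sym[OF e(1)[unfolded True]]] e(3) by simp
    ultimately show ?thesis using True other_other[OF colu] u by auto
  next
    case False
    then have x: "x \<in> ?D" using e by simp
    show ?thesis
    proof (cases "y = w")
      case True
      then have "x = u" using only e x by blast
      then show ?thesis using True nw by simp
    next
      case False
      then show ?thesis using proper[OF e(1) x] e(3) \<open>x \<noteq> w\<close> by simp
    qed
  qed
  have mono: "?R\<^sup>* \<subseteq> ?R'\<^sup>*" by (rule rtrancl_mono) auto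
  have to_u: "(x, u) \<in> ?R'\<^sup>*" "(u, x) \<in> ?R'\<^sup>*" if "x \<in> insert w ?D" for x
  proof -
    have e: "(u, w) \<in> ?R'" "(w, u) \<in> ?R'" using uw arc_sym[OF uw] u by auto
    note r_into_rtrancl[OF e(1)] r_into_rtrancl[OF e(2)]
    then show "(x, u) \<in> ?R'\<^sup>*" "(u, x) \<in> ?R'\<^sup>*"
      using that conn[of x u] conn[of u x] u mono by (cases "x = w"; blast)+
  qed
  have conn': "(x, y) \<in> ?R'\<^sup>*" if "x \<in> insert w ?D" "y \<in> insert w ?D" for x y
    using rtrancl_trans[OF to_u(1)[OF that(1)] to_u(2)[OF that(2)]] .
  have inj': "inj_on (Q(q := w)) {..<q + 1}"
  proof -
    have "{..<q + 1} = insert q {..<q}" by auto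
    moreover have "inj_on (Q(q := w)) {..<q}"
      using inj by (auto simp: inj_on_def)
    moreover have "w \<notin> Q ` {..<q}" using w D by simp
    ultimately show ?thesis by (auto simp: inj_on_insert)
  qed
  have closed': "y \<in> insert w ?D" if "k < h" "((Q(q := w)) k, y) \<in> E" for k y
    using that closed[of k y] h by auto
  have cols': "x = One \<or> x = One'" if "?\<phi> v = Some x" for v x
    using that cols[of v x] other_cases[of "the (\<phi> u)"] by (auto split: if_splits)
  have "w \<in> V" using arc_verts(2)[OF uw] .
  then show ?thesis
    unfolding bfs_inv_def dom
  proof (intro conjI)
    show "insert w ?D = (Q(q := w)) ` {..<q + 1}" using img D by simp
    show "insert w ?D \<subseteq> V" using DV \<open>w \<in> V\<close> by simp
    show "\<forall>x y. (x, y) \<in> E \<longrightarrow> x \<in> insert w ?D \<longrightarrow> y \<in> insert w ?D \<longrightarrow> ?\<phi> y = Some (other (the (?\<phi> x)))"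
      by (intro allI impI proper')
    show "\<forall>x \<in> insert w ?D. \<forall>y \<in> insert w ?D. (x, y) \<in> ?R'\<^sup>*"
      by (intro ballI conn')
    show "\<forall>k < h. \<forall>y. ((Q(q := w)) k, y) \<in> E \<longrightarrow> y \<in> insert w ?D"
      by (intro allI impI closed')
    show "\<forall>v x. ?\<phi> v = Some x \<longrightarrow> x = One \<or> x = One'"
      by (intro allI impI cols')
  qed (use inj' in auto)
qed

lemma runs_bfs_visit:
  assumes inv: "bfs_inv \<phi> Q h q" and h: "h < q"
    and deg: "\<And>v. v \<in> V \<Longrightarrow> out_degree (tree_graph T) v \<le> 5"
  shows "runs (bfs_visit T (\<phi>, Q, h, q)) 40 (\<lambda>(\<phi>', Q', h', q'). h' = h + 1 \<and> h' \<le> q' \<and> bfs_inv \<phi>' Q' h' q')"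
proof -
  define u where "u = Q h"
  have u: "u \<in> dom \<phi>" using inv h by (auto simp: bfs_inv_def u_def)
  then have uV: "u \<in> V" using inv by (auto simp: bfs_inv_def)
  then have len: "length (rot T u) \<le> 5" using deg[OF uV] by (simp add: out_degree_rot)
  let ?body = "\<lambda>w (\<phi>', Q', q'). do {
       cw \<leftarrow> rd \<phi>' w;
       test (cw = None)
         (do {
           \<phi>' \<leftarrow> wr \<phi>' w (Some (other (the (\<phi> u))));
           Q' \<leftarrow> wr Q' q' w;
           q' \<leftarrow> op (q' + 1);
           return (\<phi>', Q', q') })
         (return (\<phi>', Q', q')) }"
  let ?I = "\<lambda>ws (\<phi>', Q', q'). bfs_inv \<phi>' Q' h q' \<and> q \<le> q' \<and> \<phi>' u = \<phi> u \<and> Q' h = u \<and>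
      u \<in> dom \<phi>' \<and> set ws \<subseteq> dom \<phi>'"
  have loop: "runs (for_each (rot T u) ?body (\<phi>, Q, q)) ((5 + 1) * length (rot T u) + 1) (?I (rot T u))"
  proof (rule runs_for_each)
    show "?I [] (\<phi>, Q, q)" using inv u by (simp add: u_def)
    fix xs w ys and s :: "'v coloring \<times> (nat \<Rightarrow> 'v) \<times> nat"
    assume ws: "rot T u = xs @ w # ys" and I: "?I xs s"
    obtain \<phi>' Q' q' where s: "s = (\<phi>', Q', q')" by (cases s)
    have uw: "(u, w) \<in> E" using uV ws by (simp add: arc_iff)
    have I': "bfs_inv \<phi>' Q' h q'" "q \<le> q'" "\<phi>' u = \<phi> u" "Q' h = u" "u \<in> dom \<phi>'" "set xs \<subseteq> dom \<phi>'"
      using I s by auto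
    show "runs (?body w s) 5 (?I (xs @ [w]))"
    proof (cases "\<phi>' w = None")
      case True
      have "bfs_inv (\<phi>'(w := Some (other (the (\<phi> u))))) (Q'(q' := w)) h (q' + 1)"
        using bfs_discover[OF I'(1) _ I'(5) uw] True I' h by auto
      moreover have "u \<noteq> w" using no_loop uw by auto
      ultimately show ?thesis
        using True I' h by (intro runsI) (auto simp: s)
    next
      case False
      then show ?thesis using I' by (intro runsI) (auto simp: s)
    qed
  qed
  have finish: "runs (return (\<phi>', Q', h + 1, q')) 0
       (\<lambda>(\<phi>', Q', h', q'). h' = h + 1 \<and> h' \<le> q' \<and> bfs_inv \<phi>' Q' h' q')"
    if I: "?I (rot T u) (\<phi>', Q', q')" for \<phi>' Q' q'
  proof -
    have "bfs_inv \<phi>' Q' (h + 1) q'"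
    proof -
      have inv': "bfs_inv \<phi>' Q' h q'" using I by simp
      have "w \<in> dom \<phi>'" if "(Q' k, w) \<in> E" "k < h + 1" for k w
      proof (cases "k = h")
        case True
        then show ?thesis using I that by (auto simp: arc_iff)
      next
        case False
        then have "k < h" using that by simp
        then show ?thesis using inv' that unfolding bfs_inv_def by blast
      qed
      then show ?thesis using inv' unfolding bfs_inv_def by blast
    qed
    then show ?thesis using that h by (intro runsI) auto
  qed
  have loop': "runs (for_each (rot T u) ?body (\<phi>, Q, q)) 31 (?I (rot T u))"
    by (rule runs_weaken[OF loop]) (use len in auto)
  have "runs (for_each (rot T u) ?body (\<phi>, Q, q) \<bind> (\<lambda>(\<phi>', Q', q'). return (\<phi>', Q', h + 1, q'))) 31
       (\<lambda>(\<phi>', Q', h', q'). h' = h + 1 \<and> h' \<le> q' \<and> bfs_inv \<phi>' Q' h' q')"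
    by (rule runs_bind[OF loop', where d = 0]) (use finish in \<open>auto split: prod.split\<close>)
  then show ?thesis
    unfolding bfs_visit_def prod.case
    by - (rule runs_step[OF order_refl, where d = 35], rule runs_step[OF order_refl, where d = 34],
        rule runs_step[OF order_refl, where d = 33], rule runs_step[OF order_refl, where d = 31],
        simp_all add: u_def[symmetric])
qed

lemma bfs_inv_done:
  assumes inv: "bfs_inv \<phi> Q q q"
  shows "tree_coloring \<phi>"
proof -
  have D: "dom \<phi> = Q ` {..<q}" and ne: "dom \<phi> \<noteq> {}" and DV: "dom \<phi> \<subseteq> V"
    and proper: "\<And>x y. (x, y) \<in> E \<Longrightarrow> x \<in> dom \<phi> \<Longrightarrow> y \<in> dom \<phi> \<Longrightarrow> \<phi> y = Some (other (the (\<phi> x)))"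
    and closed: "\<And>k y. k < q \<Longrightarrow> (Q k, y) \<in> E \<Longrightarrow> y \<in> dom \<phi>"
    using inv unfolding bfs_inv_def by blast+
  obtain r where r: "r \<in> dom \<phi>" using ne by blast
  have step: "y \<in> dom \<phi>" if "(x, y) \<in> E" "x \<in> dom \<phi>" for x y
    using closed that D by auto
  have "y \<in> dom \<phi>" if "(r, y) \<in> E\<^sup>*" for y
    using that by induction (use r step in auto)
  then have "V \<subseteq> dom \<phi>" using connected_arcs r DV by blast
  then have "dom \<phi> = V" using DV by simp
  then show ?thesis
    using inv proper arc_verts unfolding tree_coloring_def bfs_inv_def by auto
qed

text \<open>
  Every vertex enters the queue at most once, and visiting it takes constant time because its degree is
  bounded.
\<close>

theorem bfs_coloring_correct:
  assumes r: "r \<in> V" and deg: "\<And>v. v \<in> V \<Longrightarrow> out_degree (tree_graph T) v \<le> 5"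
  obtains \<phi> t where "bfs_coloring T r = Some (\<phi>, t)" "tree_coloring \<phi>" "t \<le> 50 * card V + 10"
proof -
  define s where "s = ((\<lambda>_. None)(r := Some One), (\<lambda>_::nat. r)(0 := r), 0::nat, 1::nat)"
  have init: "bfs_init T r = (s, 2 * card V + 4)"
    by (rule prod_eqI) (simp_all add: bfs_init_def s_def card_V)
  let ?b = "\<lambda>((\<phi>, Q, h, q), t). h < q"
  let ?c = "\<lambda>m. do { s \<leftarrow> m; s' \<leftarrow> op s; bfs_visit T s' }"
  let ?P = "\<lambda>((\<phi>, Q, h, q), t). bfs_inv \<phi> Q h q \<and> h \<le> q \<and> t \<le> 41 * h + 1"
  let ?m = "\<lambda>((\<phi>, Q, h, q), t). card V - h"
  have step: "?P (?c m) \<and> ?m (?c m) < ?m m" if P: "?P m" and b: "?b m" for m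
  proof -
    obtain \<phi> Q h q t where m: "m = ((\<phi>, Q, h, q), t)" by (metis prod.collapse)
    have inv: "bfs_inv \<phi> Q h q" and h: "h < q" and t: "t \<le> 41 * h + 1" using P b m by auto
    have v: "runs (bfs_visit T (\<phi>, Q, h, q)) 40 (\<lambda>(\<phi>', Q', h', q'). h' = h + 1 \<and> h' \<le> q' \<and> bfs_inv \<phi>' Q' h' q')"
      by (rule runs_bfs_visit[OF inv h deg])
    obtain \<phi>' Q' h' q' t' where v': "bfs_visit T (\<phi>, Q, h, q) = ((\<phi>', Q', h', q'), t')"
      by (metis prod.collapse)
    have c: "?c m = ((\<phi>', Q', h', q'), t + (1 + t'))"
      by (simp add: m v' bind_tm_def op_def)
    have "h < card V" using bfs_inv_size[OF inv] h by simp
    then show ?thesis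
      using v t unfolding c unfolding m v' runs_def by auto
  qed
  have start: "bfs_inv \<psi> (\<lambda>_. r) 0 1" if \<psi>: "\<psi> = (\<lambda>v. if v = r then Some One else None)" for \<psi>
  proof -
    have dom: "dom \<psi> = {r}" using \<psi> by (auto split: if_splits)
    have one: "{..<1::nat} = {0}" by auto
    show ?thesis
      unfolding bfs_inv_def dom one
    proof (intro conjI)
      show "\<forall>v x. \<psi> v = Some x \<longrightarrow> x = One \<or> x = One'" by (simp add: \<psi>)
    qed (use r no_loop in simp_all)
  qed
  have "s = ((\<lambda>v. if v = r then Some One else None), (\<lambda>_. r), 0, 1)"
    by (auto simp: s_def fun_eq_iff)
  then have P0: "?P (op s)"
    using start[OF refl] by (simp add: op_def)
  obtain m where m: "while_option ?b ?c (op s) = Some m"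
    using measure_while_option_Some[of ?P ?b ?c ?m "op s", OF step P0] by (rule exE)
  have Pm: "?P m"
    by (rule while_option_rule[where P = ?P, OF conjunct1[OF step] m P0])
  have stop: "\<not> ?b m" by (rule while_option_stop[OF m])
  obtain \<phi> Q h q t where mm: "m = ((\<phi>, Q, h, q), t)" by (metis prod.collapse)
  have fin: "bfs_inv \<phi> Q h q" "h = q" "t \<le> 41 * h + 1" using Pm stop mm by auto
  have b: "(\<lambda>(s, t). (\<lambda>(\<phi>, Q, h, t). h < t) s) = ?b" by (auto simp: fun_eq_iff)
  have "while_tm (\<lambda>(\<phi>, Q, h, t). h < t) (bfs_visit T) s = Some ((\<phi>, Q, h, q), t)"
    unfolding while_tm_def b m mm ..
  then have "bfs_coloring T r = Some (\<phi>, 2 * card V + 4 + t)"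
    by (simp add: bfs_coloring_def init)
  moreover have "tree_coloring \<phi>" using bfs_inv_done fin by blast
  moreover have "2 * card V + 4 + t \<le> 50 * card V + 10"
    using fin bfs_inv_size[OF fin(1)] by simp
  ultimately show ?thesis by (rule that)
qed

end

section \<open>Distances in the Halin graph\<close>

context wf_digraph
begin

lemma le_distanceI:
  assumes "\<And>p. awalk u p v \<Longrightarrow> k \<le> length p"
  shows "ereal (real k) \<le> \<mu> (\<lambda>_. 1) u v"
  unfolding \<mu>_def
proof (rule INF_greatest)
  fix p assume "p \<in> {p. awalk u p v}"
  moreover have "awalk_cost (\<lambda>_. 1) p = real (length p)" by (induction p) auto
  ultimately show "ereal (real k) \<le> ereal (awalk_cost (\<lambda>_. 1) p)" using assms by simp
qed

lemma distance_ge_2: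
  assumes "u \<noteq> v" "\<And>e. e \<in> arcs G \<Longrightarrow> tail G e = u \<Longrightarrow> head G e \<noteq> v"
  shows "2 \<le> \<mu> (\<lambda>_. 1) u v"
proof -
  have "2 \<le> length p" if "awalk u p v" for p
    using that assms by (cases p; cases "tl p") (auto simp: awalk_simps)
  then show ?thesis using le_distanceI[of u v 2] by simp
qed

lemma distance_ge_3:
  assumes "u \<noteq> v" "\<And>e. e \<in> arcs G \<Longrightarrow> tail G e = u \<Longrightarrow> head G e \<noteq> v"
    and "\<And>e e'. e \<in> arcs G \<Longrightarrow> e' \<in> arcs G \<Longrightarrow> tail G e = u \<Longrightarrow> head G e = tail G e' \<Longrightarrow> head G e' \<noteq> v"
  shows "3 \<le> \<mu> (\<lambda>_. 1) u v"
proof -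
  have "3 \<le> length p" if "awalk u p v" for p
    using that assms by (cases p; cases "tl p"; cases "tl (tl p)") (auto simp: awalk_simps)
  then show ?thesis using le_distanceI[of u v 3] by simp
qed

end

context halin
begin

abbreviation ring :: "('v \<times> 'v) set" where
  "ring \<equiv> {(as ! i, as ! (Suc i mod n)) | i. i < n}"

lemma parcs_G: "parcs G = E \<union> ring \<union> ring\<inverse>"
  by (simp add: halin_graph_def Let_def)

lemma pverts_G: "pverts G = V"
  by (simp add: halin_graph_def Let_def pverts_tree)

lemma finite_parcs_G: "finite (parcs G)"
proof -
  have "ring = (\<lambda>i. (as ! i, as ! (Suc i mod n))) ` {..<n}" by auto
  then have "finite ring" by simp
  then show ?thesis using tree.pair_finite_arcs by (simp add: parcs_G)
qed

lemma ring_leaves: "(u, v) \<in> ring \<union> ring\<inverse> \<Longrightarrow> is_leaf T u \<and> is_leaf T v"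
  using leaf_nth n_pos by auto

sublocale graph: pair_wf_digraph G
proof
  fix e assume "e \<in> parcs G"
  then have "e \<in> E \<or> (is_leaf T (fst e) \<and> is_leaf T (snd e))"
    using ring_leaves[of "fst e" "snd e"] by (auto simp: parcs_G)
  then show "fst e \<in> pverts G" "snd e \<in> pverts G"
    using arc_verts[of "fst e" "snd e"] by (auto simp: pverts_G leaf_V)
qed

lemma tree_degree:
  assumes "max_degree G \<le> 5" "v \<in> V"
  shows "out_degree (tree_graph T) v \<le> 5"
proof -
  have "out_arcs (tree_graph T) v \<subseteq> out_arcs G v"
    by (auto simp: out_arcs_def parcs_G)
  moreover have "finite (out_arcs G v)"
    by (rule finite_subset[OF _ finite_parcs_G]) (auto simp: out_arcs_def)
  ultimately have "out_degree (tree_graph T) v \<le> out_degree G v"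
    unfolding out_degree_def by (rule card_mono[rotated])
  also have "\<dots> \<le> max_degree G"
    unfolding max_degree_def using assms(2) by (intro Max_ge) (auto simp: pverts_G)
  finally show ?thesis using assms(1) by simp
qed

lemma mod_Suc_cases: "i < n \<Longrightarrow> Suc i mod n = (if Suc i = n then 0 else Suc i)"
  by (auto simp: mod_Suc)

lemma ring_adjacent:
  assumes "(u, v) \<in> ring \<union> ring\<inverse>"
  obtains k l where "k \<in> {1..n}" "l \<in> {1..n}" "u = as ! (k - 1)" "v = as ! (l - 1)" "adjacent n k l"
proof -
  obtain i where i: "i < n" "(u, v) = (as ! i, as ! (Suc i mod n)) \<or> (v, u) = (as ! i, as ! (Suc i mod n))"
    using assms by auto
  define l where "l = Suc (Suc i mod n)"
  have l: "l \<in> {1..n}" "as ! (Suc i mod n) = as ! (l - 1)" "adjacent n (Suc i) l" "adjacent n l (Suc i)"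
    using i(1) n_pos by (auto simp: l_def mod_Suc_cases adjacent_def)
  have "Suc i \<in> {1..n}" "as ! i = as ! (Suc i - 1)" using i(1) by auto
  then show ?thesis using i(2) l that[of "Suc i" l] that[of l "Suc i"] by auto
qed

lemma leaf_blocks:
  assumes deg: "max_degree G \<le> 5"
    and b: "\<And>k. 1 \<le> k \<Longrightarrow> k \<le> n \<Longrightarrow> b k = parent (as ! (k - 1))"
  shows "leaf_blocks n b"
proof
  fix i j k l assume *: "1 \<le> i" "i < j" "j < k" "k < l" "l \<le> n" "b i = b k" "b j = b l"
  have "i - 1 < j - 1" "j - 1 < k - 1" "k - 1 < l - 1" "l - 1 < n" using * by linarith+
  from noncrossing[OF this] show "b i = b j" using * b by simp
next
  fix i j k assume *: "1 \<le> i" "i < j" "j < k" "k \<le> n" "b i = b j" "b j = b k"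
  have "parent (as ! (i - 1)) \<in> V"
    using leaf_arc_iff[OF leaf_nth, of "i - 1"] arc_verts(2) * by fastforce
  then have "\<exists>p \<in> {i - 1, j - 1, k - 1}. \<exists>q \<in> {i - 1, j - 1, k - 1}. q = Suc p mod n"
    by (intro sibling_spread[OF tree_degree[OF deg]]) (use * b in auto)
  then obtain p q where pq: "p \<in> {i - 1, j - 1, k - 1}" "q \<in> {i - 1, j - 1, k - 1}" "q = Suc p mod n"
    by blast
  moreover have "p < n" using pq(1) * by auto
  ultimately have q: "q = (if Suc p = n then 0 else Suc p)" using mod_Suc_cases by simp
  show "adjacent n i j \<or> adjacent n j k \<or> adjacent n i k"
    using pq(1,2) q * by (auto simp: adjacent_def split: if_splits)
qed (rule n_ge_3)

lemma position_unique:
  assumes "1 \<le> x" "x \<le> n" "1 \<le> y" "y \<le> n" "as ! (x - 1) = as ! (y - 1)"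
  shows "x = y"
proof -
  have "x - 1 < n" "y - 1 < n" using assms by linarith+
  then have "x - 1 = y - 1" using assms(5) distinct_as by (simp add: nth_eq_iff_index_eq)
  then show ?thesis using assms by linarith
qed

lemma few_siblings:
  assumes deg: "max_degree G \<le> 5"
    and b: "\<And>k. 1 \<le> k \<Longrightarrow> k \<le> n \<Longrightarrow> b k = parent (as ! (k - 1))"
    and k: "1 \<le> k" "k \<le> n"
  shows "card {j \<in> {1..n}. b j = b k} \<le> 5"
proof -
  let ?S = "{j \<in> {1..n}. b j = b k}"
  have leaf: "is_leaf T (as ! (j - 1))" "parent (as ! (j - 1)) = b k" if "j \<in> ?S" for j
    using that b by (auto intro!: leaf_nth)
  have arc: "(b k, as ! (j - 1)) \<in> E" if "j \<in> ?S" for j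
  proof (rule arc_sym)
    show "(as ! (j - 1), b k) \<in> E" using leaf[OF that] leaf_arc_iff by simp
  qed
  have "b k \<in> V" using arc_verts(1)[OF arc[of k]] k by simp
  have "inj_on (\<lambda>j. as ! (j - 1)) ?S"
  proof (rule inj_onI)
    fix x y assume "x \<in> ?S" "y \<in> ?S" "as ! (x - 1) = as ! (y - 1)"
    then show "x = y" using position_unique by simp
  qed
  then have "card ?S = card ((\<lambda>j. as ! (j - 1)) ` ?S)" by (simp add: card_image)
  also have "\<dots> \<le> card (set (rot T (b k)))"
    using arc by (intro card_mono) (auto simp: arc_iff)
  also have "\<dots> = out_degree (tree_graph T) (b k)"
    using \<open>b k \<in> V\<close> by (simp add: out_degree_rot distinct_card distinct_rot)
  also have "\<dots> \<le> 5" by (rule tree_degree[OF deg \<open>b k \<in> V\<close>])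
  finally show ?thesis .
qed

lemma labelled:
  assumes ab: "\<And>k. 1 \<le> k \<Longrightarrow> k \<le> n \<Longrightarrow> a k = as ! (k - 1) \<and> b k = parent (as ! (k - 1))"
  shows "labelled n a b"
proof
  show "inj_on a {1..n}"
  proof (rule inj_onI)
    fix x y assume xy: "x \<in> {1..n}" "y \<in> {1..n}" "a x = a y"
    then have "as ! (x - 1) = as ! (y - 1)" using ab by auto
    then show "x = y"
      using xy position_unique by simp
  qed
  show "b k \<notin> a ` {1..n}" if k: "1 \<le> k" "k \<le> n" for k
  proof
    assume "b k \<in> a ` {1..n}"
    then have "is_leaf T (b k)" using ab by (auto intro!: leaf_nth)
    then show False using ab[OF k] parent_not_leaf leaf_nth[of "k - 1"] k by auto
  qed
qed (rule n_ge_3)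

lemma leaf_position:
  assumes "is_leaf T u"
  obtains k where "1 \<le> k" "k \<le> n" "u = as ! (k - 1)"
proof -
  have "u \<in> set as" using assms set_as by simp
  then obtain i where "i < n" "u = as ! i" by (auto simp: in_set_conv_nth)
  then show ?thesis using that[of "Suc i"] by simp
qed

text \<open>
  The only neighbours of a leaf are its parent and the two leaves next to it.  So two leaves that are not
  near each other on the cycle and have different parents are at distance at least 3, and all vertices
  with a class \<open>2\<close> color are leaves.
\<close>

lemma packing_coloringI:
  assumes ab: "\<And>k. 1 \<le> k \<Longrightarrow> k \<le> n \<Longrightarrow> a k = as ! (k - 1) \<and> b k = parent (as ! (k - 1))"
    and \<phi>0: "tree_coloring \<phi>0"
    and leaves: "labelled.leaves_colored n a \<phi>0 g \<phi>"
    and proper: "proper_around n b (labelled.c b \<phi>0) g"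
  shows "packing_coloring G \<phi>"
proof -
  interpret lab: labelled n a b \<phi>0 by (rule labelled[OF ab])
  have leaf: "\<phi> (as ! (k - 1)) = Some (g k)" if "1 \<le> k" "k \<le> n" for k
    using lab.leaf_color[OF leaves that] ab[OF that] by simp
  have inner: "\<phi> v = \<phi>0 v" if "\<not> is_leaf T v" for v
  proof -
    have "v \<notin> a ` {1..n}" using that ab by (auto intro!: leaf_nth)
    then show ?thesis using leaves by (simp add: lab.leaves_colored_def)
  qed
  have dom0: "dom \<phi>0 = V" and cols0: "\<And>v x. \<phi>0 v = Some x \<Longrightarrow> x = One \<or> x = One'"
    and proper0: "\<And>u v. (u, v) \<in> E \<Longrightarrow> \<phi>0 v = Some (other (the (\<phi>0 u)))"
    using \<phi>0 unfolding tree_coloring_def by blast+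
  have sp: "\<not> near n i j \<and> b i \<noteq> b j" if "1 \<le> i" "i < j" "j \<le> n" "g i = g j" "is_two (g i)" for i j
    using proper that unfolding proper_around_def spaced_def by blast
  have one: "g k = other (lab.c k)" if "1 \<le> k" "k \<le> n" "\<not> is_two (g k)" for k
    using proper that unfolding proper_around_def by blast
  have ones: "lab.c i \<noteq> lab.c j"
    if "1 \<le> i" "i < j" "j \<le> n" "adjacent n i j" "\<not> is_two (g i)" "\<not> is_two (g j)" for i j
    using proper that unfolding proper_around_def by blast
  have parentV: "parent v \<in> V" if "is_leaf T v" for v
    using leaf_arc_iff[OF that] arc_verts(2) by blast
  have c_cases: "lab.c k = One \<or> lab.c k = One'" "\<phi> (parent (as ! (k - 1))) = Some (lab.c k)"
    if k: "1 \<le> k" "k \<le> n" for k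
  proof -
    have l: "is_leaf T (as ! (k - 1))" using k by (intro leaf_nth) simp
    then obtain x where x: "\<phi>0 (parent (as ! (k - 1))) = Some x" using parentV dom0 by blast
    then have "lab.c k = x" using ab[OF k] by (simp add: lab.c_def)
    then show "lab.c k = One \<or> lab.c k = One'" "\<phi> (parent (as ! (k - 1))) = Some (lab.c k)"
      using x cols0[OF x] inner[OF parent_not_leaf[OF l]] by auto
  qed
  have two_one: "\<not> is_two One" "\<not> is_two One'" by (auto simp: is_two_iff)
  have dom: "dom \<phi> = pverts G"
  proof -
    have "v \<in> dom \<phi> \<longleftrightarrow> v \<in> V" for v
    proof (cases "is_leaf T v")
      case True
      then obtain k where "1 \<le> k" "k \<le> n" "v = as ! (k - 1)" by (rule leaf_position)
      then show ?thesis using leaf True leaf_V by auto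
    next
      case False
      then show ?thesis using inner dom0 by (metis domIff)
    qed
    then show ?thesis by (auto simp: pverts_G)
  qed
  have ring_neq: "\<phi> u \<noteq> \<phi> v" if uv: "(u, v) \<in> ring \<union> ring\<inverse>" for u v
  proof -
    obtain k l where kl: "k \<in> {1..n}" "l \<in> {1..n}" "u = as ! (k - 1)" "v = as ! (l - 1)" "adjacent n k l"
      using uv by (rule ring_adjacent)
    have main: "g i \<noteq> g j" if ij: "1 \<le> i" "i < j" "j \<le> n" "adjacent n i j" for i j
    proof
      assume eq: "g i = g j"
      have "near n i j" using ij by (auto simp: adjacent_def near_def)
      then have "\<not> is_two (g i)" using sp[OF ij(1-3) eq] by blast
      then have "lab.c i \<noteq> lab.c j" "g i = other (lab.c i)" "g j = other (lab.c j)"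
        using ones[OF ij] one[of i] one[of j] eq ij by auto
      then show False using eq c_cases(1)[of i] c_cases(1)[of j] ij by (auto simp: other_def)
    qed
    have "k \<noteq> l" using kl n_ge_3 by (auto simp: adjacent_def)
    moreover have "adjacent n l k" using kl by (auto simp: adjacent_def)
    ultimately have "g k \<noteq> g l"
      using main[of k l] main[of l k] kl by (metis atLeastAtMost_iff linorder_neqE_nat)
    then show ?thesis using leaf kl by auto
  qed
  have leaf_parent: "\<phi> u \<noteq> \<phi> (parent u)" if u: "is_leaf T u" for u
  proof -
    obtain k where k: "1 \<le> k" "k \<le> n" "u = as ! (k - 1)" using u by (rule leaf_position)
    have "g k \<noteq> lab.c k"
    proof (cases "is_two (g k)")
      case True
      then show ?thesis using c_cases(1)[OF k(1,2)] two_one by auto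
    next
      case False
      then show ?thesis using one[OF k(1,2)] c_cases(1)[OF k(1,2)] by (auto simp: other_def)
    qed
    then show ?thesis using leaf c_cases(2) k by auto
  qed
  have arc_neq: "\<phi> u \<noteq> \<phi> v" if uv: "(u, v) \<in> parcs G" for u v
  proof (cases "(u, v) \<in> E")
    case True
    show ?thesis
    proof (cases "is_leaf T u")
      case u: True
      then have "v = parent u" using True leaf_arc_iff by simp
      then show ?thesis using leaf_parent[OF u] by simp
    next
      case u: False
      show ?thesis
      proof (cases "is_leaf T v")
        case v: True
        then have "u = parent v" using arc_sym[OF True] leaf_arc_iff by simp
        then show ?thesis using leaf_parent[OF v] by simp
      next
        case False
        have "u \<in> V" using arc_verts(1)[OF True] .
        then obtain x where x: "\<phi>0 u = Some x" using dom0 by blast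
        then have "\<phi>0 v \<noteq> \<phi>0 u" using proper0[OF True] cols0[OF x] by (auto simp: other_def)
        then show ?thesis using inner[OF u] inner[OF False] by simp
      qed
    qed
  next
    case False
    then show ?thesis using ring_neq uv by (auto simp: parcs_G)
  qed
  have two_leaf: "is_leaf T u" if "\<phi> u = Some x" "is_two x" for u x
  proof (rule ccontr)
    assume "\<not> is_leaf T u"
    then show False using inner cols0 that two_one by metis
  qed
  have no_common: "v \<noteq> w"
    if c: "\<phi> u = Some x" "\<phi> w = Some x" "is_two x" "u \<noteq> w" and uz: "(u, z) \<in> parcs G" and zv: "(z, v) \<in> parcs G"
    for u v w x z
  proof
    assume "v = w"
    have lu: "is_leaf T u" and lw: "is_leaf T w" using two_leaf c by auto
    obtain i where i: "1 \<le> i" "i \<le> n" "u = as ! (i - 1)" using lu by (rule leaf_position)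
    obtain j where j: "1 \<le> j" "j \<le> n" "w = as ! (j - 1)" using lw by (rule leaf_position)
    have g: "g i = x" "g j = x" using leaf i j c by auto
    have ne: "i \<noteq> j" using i j c by auto
    have far: "\<not> near n p q \<and> b p \<noteq> b q" if "p < q" "{p, q} = {i, j}" for p q
      using sp[of p q] that i j g c by (auto simp: doubleton_eq_iff)
    have bij: "b i \<noteq> b j" using far[of i j] far[of j i] ne by (metis insert_commute linorder_neqE_nat)
    show False
    proof (cases "is_leaf T z")
      case True
      then have "z \<noteq> parent u" "z \<noteq> parent w" "w \<noteq> parent z"
        using parent_not_leaf lu lw by blast+
      then have "(u, z) \<notin> E" "(z, w) \<notin> E"
        using leaf_arc_iff lu True by auto
      then have r: "(u, z) \<in> ring \<union> ring\<inverse>" "(z, w) \<in> ring \<union> ring\<inverse>"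
        using uz zv \<open>v = w\<close> by (auto simp: parcs_G)
      obtain i' k where ik: "i' \<in> {1..n}" "k \<in> {1..n}" "u = as ! (i' - 1)" "z = as ! (k - 1)" "adjacent n i' k"
        using r(1) by (rule ring_adjacent)
      obtain k' j' where kj: "k' \<in> {1..n}" "j' \<in> {1..n}" "z = as ! (k' - 1)" "w = as ! (j' - 1)" "adjacent n k' j'"
        using r(2) by (rule ring_adjacent)
      have same: "p = q" if "p \<in> {1..n}" "q \<in> {1..n}" "as ! (p - 1) = as ! (q - 1)" for p q
        using that position_unique by simp
      have "i' = i" "j' = j" "k' = k"
        using same[of i' i] same[of j' j] same[of k' k] i j ik kj by auto
      then have adj: "adjacent n i k" "adjacent n k j" using ik kj by auto
      have "near n i j" if "i < j" using adj that i j ik(2) ne unfolding adjacent_def near_def by auto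
      moreover have "near n j i" if "j < i" using adj that i j ik(2) ne unfolding adjacent_def near_def by auto
      ultimately show False using far[of i j] far[of j i] ne by (metis insert_commute linorder_neqE_nat)
    next
      case False
      then have "(u, z) \<in> E" "(z, w) \<in> E"
        using uz zv ring_leaves[of u z] ring_leaves[of z w] \<open>v = w\<close> by (auto simp: parcs_G)
      then have "z = parent u" "z = parent w"
        using leaf_arc_iff lu lw arc_sym by blast+
      then show False using bij ab i j by auto
    qed
  qed
  have far: "separation x \<le> distance G u v"
    if c: "\<phi> u = Some x" "\<phi> v = Some x" "u \<noteq> v" for u v x
  proof (cases "is_two x")
    case True
    have "3 \<le> distance G u v"
      unfolding distance_def
    proof (rule graph.distance_ge_3)
      show "u \<noteq> v" by (rule c(3))
      show "snd e \<noteq> v" if "e \<in> parcs G" "fst e = u" for e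
        using arc_neq[of "fst e" "snd e"] that c by auto
      show "snd e' \<noteq> v" if ee: "e \<in> parcs G" "e' \<in> parcs G" "fst e = u" "snd e = fst e'" for e e'
      proof -
        obtain z y where "e = (u, z)" "e' = (z, y)" using ee by (metis prod.collapse)
        then show ?thesis using no_common[OF c(1,2) True c(3), of z y] ee by simp
      qed
    qed
    then show ?thesis using True by (cases x) (auto simp: is_two_iff)
  next
    case False
    have "2 \<le> distance G u v"
      unfolding distance_def
    proof (rule graph.distance_ge_2)
      show "u \<noteq> v" by (rule c(3))
      show "snd e \<noteq> v" if "e \<in> parcs G" "fst e = u" for e
        using arc_neq[of "fst e" "snd e"] that c by auto
    qed
    then show ?thesis using False by (cases x) (auto simp: is_two_iff)
  qed
  show ?thesis
    unfolding packing_coloring_def using dom far by blast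
qed

end

section \<open>Renumbering the leaves\<close>

lemma nth_rotate_Suc:
  assumes "i < length xs"
  shows "rotate d xs ! (Suc i mod length xs) = xs ! (Suc ((d + i) mod length xs) mod length xs)"
proof -
  have "0 < length xs" using assms by auto
  then have "rotate d xs ! (Suc i mod length xs) = xs ! ((d + Suc i mod length xs) mod length xs)"
    by (intro nth_rotate) simp
  then show ?thesis by (simp add: mod_simps)
qed

text \<open>
  Where the numbering of the leaves starts is immaterial; so the arrays after relabelling come from
  another description of the same graph.
\<close>

lemma is_halin_rotate:
  assumes "is_halin T as"
  shows "is_halin T (rotate d as)"
proof -
  have len: "length (rotate d as) = length as" by simp
  have "next_leaf T (rotate d as ! i) (rotate d as ! (Suc i mod length (rotate d as)))"
    if i: "i < length (rotate d as)" for i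
  proof -
    have "(d + i) mod length as < length as" using i by (intro mod_less_divisor) auto
    then show ?thesis
      using assms i unfolding len is_halin_def adjoint_cycle_def
      by (simp add: nth_rotate nth_rotate_Suc)
  qed
  then show ?thesis
    using assms by (simp add: is_halin_def adjoint_cycle_def)
qed

lemma halin_graph_rotate: "halin_graph T (rotate d as) = halin_graph T as"
proof -
  let ?n = "length as"
  have "{(rotate d as ! i, rotate d as ! (Suc i mod ?n)) | i. i < ?n} =
      {(as ! i, as ! (Suc i mod ?n)) | i. i < ?n}" (is "?L = ?R")
  proof
    show "?L \<subseteq> ?R"
    proof
      fix e assume "e \<in> ?L"
      then obtain i where i: "i < ?n" "e = (rotate d as ! i, rotate d as ! (Suc i mod ?n))" by blast
      then have "e = (as ! ((d + i) mod ?n), as ! (Suc ((d + i) mod ?n) mod ?n))"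
        by (simp add: nth_rotate nth_rotate_Suc)
      moreover have "(d + i) mod ?n < ?n" using i by (intro mod_less_divisor) auto
      ultimately show "e \<in> ?R" by blast
    qed
    show "?R \<subseteq> ?L"
    proof
      fix e assume "e \<in> ?R"
      then obtain j where j: "j < ?n" "e = (as ! j, as ! (Suc j mod ?n))" by blast
      define i where "i = (j + (?n - d mod ?n)) mod ?n"
      have n: "0 < ?n" using j by auto
      then have i: "i < ?n" by (simp add: i_def)
      have "(d + i) mod ?n = (d mod ?n + (j + (?n - d mod ?n))) mod ?n"
        by (simp add: i_def mod_simps)
      also have "d mod ?n + (j + (?n - d mod ?n)) = j + ?n"
        using mod_less_divisor[OF n, of d] by linarith
      finally have "(d + i) mod ?n = j" using j(1) by simp
      then have "e = (rotate d as ! i, rotate d as ! (Suc i mod ?n))"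
        using i j by (simp add: nth_rotate nth_rotate_Suc)
      then show "e \<in> ?L" using i by blast
    qed
  qed
  then show ?thesis by (simp add: halin_graph_def)
qed

lemma shift_rotate:
  assumes "d < length as" "1 \<le> k" "k \<le> length as"
  shows "as ! (shift (length as) d k - 1) = rotate d as ! (k - 1)"
proof -
  let ?n = "length as"
  have "shift ?n d k - 1 = (d + (k - 1)) mod ?n"
  proof (cases "d + k \<le> ?n")
    case True
    then show ?thesis using assms by (simp add: shift_def)
  next
    case False
    then have "d + (k - 1) = (shift ?n d k - 1) + ?n" "shift ?n d k - 1 < ?n"
      using assms by (auto simp: shift_def)
    then show ?thesis by simp
  qed
  then show ?thesis using assms by (simp add: nth_rotate)
qed

section \<open>The algorithm is correct and runs in linear time\<close>

lemma packing_coloring_algorithm_correct: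
  assumes H: "is_halin T as" and deg: "max_degree (halin_graph T as) \<le> 5"
    and r: "r \<in> pverts (halin_graph T as)"
  shows "\<exists>\<phi> t. packing_coloring_algorithm T as r = Some (\<phi>, t) \<and>
           packing_coloring (halin_graph T as) \<phi> \<and>
           t \<le> 400 * card (pverts (halin_graph T as))"
proof -
  interpret halin T as by unfold_locales (rule H)
  have rV: "r \<in> V" using r by (simp add: pverts_G)
  obtain \<phi>0 t0 where bfs: "bfs_coloring T r = Some (\<phi>0, t0)" "tree_coloring \<phi>0" "t0 \<le> 50 * card V + 10"
    using bfs_coloring_correct[OF rV tree_degree[OF deg]] by blast
  have nV: "n \<le> card V"
  proof -
    have "card (set as) \<le> card V" using set_as leaf_V by (intro card_mono) auto
    then show ?thesis by (simp add: distinct_card[OF distinct_as])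
  qed
  let ?good = "\<lambda>\<phi>. packing_coloring G \<phi>"
  have resolve: "runs (resolve_conflicts T a' b' n \<phi>) (60 * n + length (vlist T) + 10) ?good"
    if ab: "\<And>k. 1 \<le> k \<Longrightarrow> k \<le> n \<Longrightarrow> a' k = rotate d as ! (k - 1) \<and> b' k = parent (rotate d as ! (k - 1))"
      and how: "labelled.recolored_by n b' \<phi>0 f" and leaves: "labelled.leaves_colored n a' \<phi>0 f \<phi>"
    for a' b' \<phi> d f
  proof -
    interpret rot: halin T "rotate d as" by unfold_locales (rule is_halin_rotate[OF H])
    have len: "length (rotate d as) = n" by simp
    have deg': "max_degree (halin_graph T (rotate d as)) \<le> 5" using deg by (simp add: halin_graph_rotate)
    have ab': "b' k = parent (rotate d as ! (k - 1))" if "1 \<le> k" "k \<le> length (rotate d as)" for k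
      using that ab by simp
    have ab'': "a' k = rotate d as ! (k - 1) \<and> b' k = parent (rotate d as ! (k - 1))"
      if "1 \<le> k" "k \<le> length (rotate d as)" for k
      using that ab by simp
    interpret lab: labelled n a' b' \<phi>0
      using rot.labelled[OF ab''] unfolding len .
    interpret blocks: leaf_blocks n b'
      using rot.leaf_blocks[OF deg' ab'] unfolding len .
    have "recolored n b' f"
    proof (cases "f = pattern_1 lab.c n")
      case True
      then show ?thesis using blocks.recolored_pattern_1 by simp
    next
      case False
      then have "f = case_2_pattern n b' lab.c"
        using how unfolding lab.recolored_by_def by blast
      then show ?thesis using blocks.recolored_case_2 by simp
    qed
    then interpret rec: resolving n a' b' \<phi>0 f
      using rot.few_siblings[OF deg' ab'] unfolding len
      by (intro resolving.intro resolving_axioms.intro lab.labelled_axioms)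
    have "packing_coloring G \<psi>" if res: "resolves n b' f g" and l: "lab.leaves_colored g \<psi>" for g \<psi>
    proof -
      have "proper_around n b' lab.c g"
        using how res blocks.proper_around_pattern_1 blocks.proper_around_pattern_2
        unfolding lab.recolored_by_def by blast
      then have "packing_coloring (halin_graph T (rotate d as)) \<psi>"
        using rot.packing_coloringI[OF ab'' bfs(2), of g \<psi>] l unfolding len by simp
      then show ?thesis by (simp add: halin_graph_rotate)
    qed
    then show ?thesis
      by (intro runs_weaken[OF rec.runs_resolve_conflicts[OF leaves]]) auto
  qed
  have recolor: "runs (recoloring a b n \<phi>0 \<bind> (\<lambda>(a, b, \<phi>). resolve_conflicts T a b n \<phi>))
      (120 * n + length (vlist T) + 110) ?good"
    if ab: "\<And>k. 1 \<le> k \<Longrightarrow> k \<le> n \<Longrightarrow> a k = as ! (k - 1) \<and> b k = parent (as ! (k - 1))" for a b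
  proof -
    interpret lab: labelled n a b \<phi>0 by (rule labelled[OF ab])
    have init: "\<phi>0 (a k) = Some (other (lab.c k)) \<and> (lab.c k = One \<or> lab.c k = One')"
      if k: "1 \<le> k" "k \<le> n" for k
    proof -
      have l: "is_leaf T (a k)" using ab[OF k] k by (auto intro!: leaf_nth)
      have e: "(b k, a k) \<in> E" using arc_sym leaf_arc_iff[OF l] ab[OF k] by simp
      then obtain x where x: "\<phi>0 (b k) = Some x"
        using bfs(2) arc_verts(1)[OF e] unfolding tree_coloring_def by blast
      then show ?thesis
        using bfs(2) e unfolding tree_coloring_def by (auto simp: lab.c_def)
    qed
    \<comment> \<open>RECOLORING may have changed the numbering, so the tree is considered with its leaves rotated.\<close>
    show ?thesis
    proof (rule runs_bind[OF lab.runs_recoloring[OF init]])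
      fix x assume x: "(\<lambda>(a', b', \<phi>). \<exists>d < n. (\<forall>k. 1 \<le> k \<longrightarrow> k \<le> n \<longrightarrow> a' k = a (shift n d k) \<and> b' k = b (shift n d k)) \<and>
        (\<exists>f. labelled.recolored_by n b' \<phi>0 f \<and> labelled.leaves_colored n a' \<phi>0 f \<phi>)) x"
      obtain a' b' \<phi> where xs: "x = (a', b', \<phi>)" by (cases x)
      then obtain d f where d: "d < n"
        and sh: "\<And>k. 1 \<le> k \<Longrightarrow> k \<le> n \<Longrightarrow> a' k = a (shift n d k) \<and> b' k = b (shift n d k)"
        and f: "labelled.recolored_by n b' \<phi>0 f" "labelled.leaves_colored n a' \<phi>0 f \<phi>"
        using x by auto
      have "a' k = rotate d as ! (k - 1) \<and> b' k = parent (rotate d as ! (k - 1))" if k: "1 \<le> k" "k \<le> n" for k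
        using sh[OF k] ab[of "shift n d k"] shift_range[OF d k] shift_rotate[OF d k] by simp
      from resolve[OF this f]
      show "runs ((\<lambda>(a, b, \<phi>). resolve_conflicts T a b n \<phi>) x) (60 * n + length (vlist T) + 10) ?good"
        by (simp add: xs)
    qed (use init in simp_all)
  qed
  let ?rest = "op (length as) \<bind> (\<lambda>n. load T as n \<bind> (\<lambda>(a, b). recoloring a b n \<phi>0 \<bind>
       (\<lambda>(a, b, \<phi>). resolve_conflicts T a b n \<phi>)))"
  have "runs ?rest (128 * n + length (vlist T) + 120) ?good"
  proof (rule runs_step[OF order_refl, where d = "128 * n + length (vlist T) + 115"])
    have "runs (load T as n \<bind> (\<lambda>(a, b). recoloring a b n \<phi>0 \<bind>
       (\<lambda>(a, b, \<phi>). resolve_conflicts T a b n \<phi>))) (128 * n + length (vlist T) + 115) ?good"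
    proof (rule runs_bind[OF runs_load])
      fix x assume "(\<lambda>(a, b). \<forall>k. 1 \<le> k \<longrightarrow> k \<le> n \<longrightarrow> a k = as ! (k - 1) \<and> b k = hd (rot T (as ! (k - 1)))) x"
      then show "runs ((\<lambda>(a, b). recoloring a b n \<phi>0 \<bind>
          (\<lambda>(a, b, \<phi>). resolve_conflicts T a b n \<phi>)) x) (120 * n + length (vlist T) + 110) ?good"
        using recolor by (cases x) (simp add: parent_def)
    qed simp
    then show "runs (load T as (fst (op n)) \<bind> (\<lambda>(a, b). recoloring a b (fst (op n)) \<phi>0 \<bind>
       (\<lambda>(a, b, \<phi>). resolve_conflicts T a b (fst (op n)) \<phi>))) (128 * n + length (vlist T) + 115) ?good"
      by simp
  qed simp
  moreover have "packing_coloring_algorithm T as r = Some (fst ?rest, t0 + snd ?rest)"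
    by (simp add: packing_coloring_algorithm_def bfs(1) prod_eq_iff)
  moreover have "1 \<le> card V"
  proof -
    have "V \<noteq> {}" using rV by (metis empty_iff)
    then have "0 < card V" using card_gt_0_iff finite_V by blast
    then show ?thesis by simp
  qed
  \<comment> \<open>With \<open>N\<close> vertices, the search takes at most \<open>50 N + 10\<close> steps and the rest \<open>129 N + 120\<close>.\<close>
  ultimately show ?thesis
    using bfs(3) nV card_V by (auto simp: runs_def pverts_G)
qed

theorem theorem3p6:
  shows "\<exists>K :: nat. \<forall>(T :: 'v plane_tree) as r.
    is_halin T as \<and> max_degree (halin_graph T as) \<le> 5 \<and> r \<in> pverts (halin_graph T as) \<longrightarrow>
    (\<exists>\<phi> t. packing_coloring_algorithm T as r = Some (\<phi>, t) \<and>
           packing_coloring (halin_graph T as) \<phi> \<and>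
           t \<le> K * card (pverts (halin_graph T as)))"
  by (intro exI[of _ 400] allI impI, elim conjE) (rule packing_coloring_algorithm_correct)

end
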